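(* Let $(M,g)$ be a compact Riemannian manifold of dimension $n$, let $1\leq k\leq n$, and let $\varphi\in C^{\infty}(T^kM)$. For $i,j\in\{1,\ldots,k\}$ consider the semi-basic vector fields on $T^kM$ given, for $f=(v_1,\ldots,v_k)\in T^kM$, by $$Y^{j,i}(f)=\langle\operatorname{grad}^h\varphi(f),\operatorname{grad}^{v,j}\varphi(f)\rangle\, v_i-\big(G^i\varphi(f)\big)\operatorname{grad}^{v,j}\varphi(f),\qquad Z^i(f)=\big(G^i\varphi(f)\big)\operatorname{grad}^h\varphi(f).$$ Then, for all $i,j\in\{1,\ldots,k\}$ and all $f=(v_1,\ldots,v_k)\in T^kM$, $$\operatorname{div}^{v,j}Z^i(f)+\operatorname{div}^hY^{j,i}(f)+\delta_{ij}\|\operatorname{grad}^h\varphi(f)\|^2=\sum_{l=1}^k\langle R(\operatorname{grad}^{v,l}\varphi(f),v_l)v_i,\operatorname{grad}^{v,j}\varphi(f)\rangle+2\langle\operatorname{grad}^h\varphi(f),\operatorname{grad}^{v,j}G^i\varphi(f)\rangle.$$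
   Context: $T^kM=\bigcup_{p\in M}T_pM\times\cdots\times T_pM$ ($k$ factors) is the bundle of $k$-tuples of tangent vectors with common footpoint, with projection $\pi^k:T^kM\to M$. All inner products are those of $T_pM$. $R$ is the curvature tensor with $R(X,Y)Z=\nabla_X\nabla_YZ-\nabla_Y\nabla_XZ-\nabla_{[X,Y]}Z$, and $\frac{D}{dt}$ is the covariant derivative along curves. For $u\in T_pM$, $c_u$ is the geodesic with $c_u(0)=p$, $c_u'(0)=u$, and for $f=(v_1,\ldots,v_k)$ over $p$, $f_u(t)$ is the $k$-tuple over $c_u(t)$ obtained by parallel transporting each $v_j$ along $c_u$. The $i$-th frame flow is $F^i_t(f)=f_{v_i}(t)$, and $G^i\varphi(f)=\frac{d}{dt}\big|_{t=0}\varphi(F^i_t(f))$. For $\varphi\in C^\infty(T^kM)$, the horizontal gradient and $i$-th vertical gradient ($i=1,\ldots,k$) at $f$ are the vectors in $T_pM$, $p=\pi^k(f)$, determined by, for all $u\in T_pM$, $$\langle\operatorname{grad}^h\varphi(f),u\rangle=\tfrac{d}{dt}\big|_{t=0}\varphi(f_u(t)),\qquad \langle\operatorname{grad}^{v,i}\varphi(f),u\rangle=\tfrac{d}{dt}\big|_{t=0}\varphi(v_1,\ldots,v_i+tu,\ldots,v_k).$$ A semi-basic vector field is a smooth map $X:T^kM\to TM$ with $X(f)\in T_{\pi^k(f)}M$ for all $f$. For $u\in T_pM$, $$\nabla^h_uX(f)=\tfrac{D}{dt}\big|_{t=0}X(f_u(t)),\qquad \nabla^{v,i}_uX(f)=\tfrac{D}{dt}\big|_{t=0}X(v_1,\ldots,v_i+tu,\ldots,v_k)$$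 (the latter is an ordinary derivative in $T_pM$), and for an orthonormal basis $e_1,\ldots,e_n$ of $T_pM$, $\operatorname{div}^hX(f)=\sum_{m=1}^n\langle\nabla^h_{e_m}X(f),e_m\rangle$ and $\operatorname{div}^{v,i}X(f)=\sum_{m=1}^n\langle\nabla^{v,i}_{e_m}X(f),e_m\rangle$. *)

theory Defs
  imports "HOL-Analysis.Analysis"
begin

section \<open>Smooth maps between Euclidean spaces\<close>

text \<open>Meant for open \<open>S\<close> and finite-dimensional domains, where iterated directional derivatives
  give the usual classes \<open>C\<^sup>n\<close>.\<close>

primrec Ck_on ::
    "nat \<Rightarrow> ('a::real_normed_vector \<Rightarrow> 'b::real_normed_vector) \<Rightarrow> 'a set \<Rightarrow> bool" where
  "Ck_on 0 f S \<longleftrightarrow> continuous_on S f"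
| "Ck_on (Suc n) f S \<longleftrightarrow>
     (\<forall>x\<in>S. f differentiable (at x)) \<and> (\<forall>v. Ck_on n (\<lambda>x. frechet_derivative f (at x) v) S)"

definition smooth_on ::
    "('a::real_normed_vector \<Rightarrow> 'b::real_normed_vector) \<Rightarrow> 'a set \<Rightarrow> bool" where
  "smooth_on f S \<longleftrightarrow> (\<forall>n. Ck_on n f S)"


section \<open>Riemannian manifolds\<close>

text \<open>
  A chart is a pair of its domain and its coordinate map into the model space \<open>'e\<close>, so the
  manifold has dimension \<open>DIM('e)\<close>.

  A tangent vector at \<open>p\<close> is represented by an element of \<open>'e\<close>: its components in one chart
  around \<open>p\<close>, selected once and for all by \<open>pref_chart\<close>. Thus every \<open>T\<^sub>pM\<close> is the vector space
  \<open>'e\<close>; its inner product is \<open>metric M p\<close>, never the inner product of \<open>'e\<close>. Vectors over different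
  points are related only through \<open>to_chart\<close> and \<open>from_chart\<close>. Nothing is assumed about how
  \<open>pref_chart M p\<close> varies with \<open>p\<close>.
\<close>

type_synonym ('a, 'e) chart = "'a set \<times> ('a \<Rightarrow> 'e)"

record ('a, 'e) manifold =
  mtop :: "'a topology"
  atlas :: "('a, 'e) chart set"
  metric :: "'a \<Rightarrow> 'e \<Rightarrow> 'e \<Rightarrow> real"

definition chart_inv :: "('a, 'e) chart \<Rightarrow> 'e \<Rightarrow> 'a" where
  "chart_inv c = inv_into (fst c) (snd c)"

definition chart_image :: "('a, 'e) chart \<Rightarrow> 'e set" where
  "chart_image c = snd c ` fst c"

definition pref_chart :: "('a, 'e) manifold \<Rightarrow> 'a \<Rightarrow> ('a, 'e) chart" where
  "pref_chart M p = (SOME c. c \<in> atlas M \<and> p \<in> fst c)"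

text \<open>\<open>to_chart M c p v\<close> is the component vector in the chart \<open>c\<close> of \<open>v \<in> T\<^sub>pM\<close>;
  \<open>from_chart M c p\<close> is the inverse map.\<close>

definition to_chart ::
    "('a, 'e::euclidean_space) manifold \<Rightarrow> ('a, 'e) chart \<Rightarrow> 'a \<Rightarrow> 'e \<Rightarrow> 'e" where
  "to_chart M c p v =
     frechet_derivative (\<lambda>x. snd c (chart_inv (pref_chart M p) x)) (at (snd (pref_chart M p) p)) v"

definition from_chart ::
    "('a, 'e::euclidean_space) manifold \<Rightarrow> ('a, 'e) chart \<Rightarrow> 'a \<Rightarrow> 'e \<Rightarrow> 'e" where
  "from_chart M c p a =
     frechet_derivative (\<lambda>x. snd (pref_chart M p) (chart_inv c x)) (at (snd c p)) a"

definition smooth_manifold :: "('a, 'e::euclidean_space) manifold \<Rightarrow> bool" where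
  "smooth_manifold M \<longleftrightarrow>
     Hausdorff_space (mtop M) \<and> second_countable (mtop M) \<and>
     (\<Union>c\<in>atlas M. fst c) = topspace (mtop M) \<and>
     (\<forall>c\<in>atlas M. openin (mtop M) (fst c) \<and> open (chart_image c) \<and>
        homeomorphic_map (subtopology (mtop M) (fst c)) (top_of_set (chart_image c)) (snd c)) \<and>
     (\<forall>c\<in>atlas M. \<forall>c'\<in>atlas M. smooth_on (\<lambda>x. snd c' (chart_inv c x)) (snd c ` (fst c \<inter> fst c')))"

definition chart_metric ::
    "('a, 'e::euclidean_space) manifold \<Rightarrow> ('a, 'e) chart \<Rightarrow> 'e \<Rightarrow> 'e \<Rightarrow> 'e \<Rightarrow> real" where
  "chart_metric M c x a b =
     metric M (chart_inv c x) (from_chart M c (chart_inv c x) a) (from_chart M c (chart_inv c x) b)"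

definition riemannian_manifold :: "('a, 'e::euclidean_space) manifold \<Rightarrow> bool" where
  "riemannian_manifold M \<longleftrightarrow>
     smooth_manifold M \<and>
     (\<forall>p\<in>topspace (mtop M).
        bilinear (metric M p) \<and>
        (\<forall>u v. metric M p u v = metric M p v u) \<and>
        (\<forall>u. u \<noteq> 0 \<longrightarrow> metric M p u u > 0)) \<and>
     (\<forall>c\<in>atlas M. \<forall>a b. smooth_on (\<lambda>x. chart_metric M c x a b) (chart_image c))"

definition compact_riemannian_manifold :: "('a, 'e::euclidean_space) manifold \<Rightarrow> bool" where
  "compact_riemannian_manifold M \<longleftrightarrow> riemannian_manifold M \<and> compact_space (mtop M)"


section \<open>Levi-Civita connection and curvature\<close>

text \<open>\<open>christoffel M c x a b\<close> is \<open>\<Sum>\<^sub>i\<^sub>j\<^sub>k \<Gamma>\<^sup>k\<^sub>i\<^sub>j a\<^sup>i b\<^sup>j \<partial>\<^sub>k\<close>, i.e. the covariant derivative in direction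
  \<open>a\<close> of the field with constant components \<open>b\<close> in the chart \<open>c\<close>, as given by the Koszul formula.\<close>

definition christoffel ::
    "('a, 'e::euclidean_space) manifold \<Rightarrow> ('a, 'e) chart \<Rightarrow> 'e \<Rightarrow> 'e \<Rightarrow> 'e \<Rightarrow> 'e" where
  "christoffel M c x a b =
     (let D = (\<lambda>u v w. frechet_derivative (\<lambda>y. chart_metric M c y v w) (at x) u)
      in THE w. \<forall>d. 2 * chart_metric M c x w d = D a b d + D b a d - D d a b)"

text \<open>\<open>field_in_chart M c Z\<close> is the component function of the vector field \<open>Z\<close> in the chart \<open>c\<close>.\<close>

definition field_in_chart ::
    "('a, 'e::euclidean_space) manifold \<Rightarrow> ('a, 'e) chart \<Rightarrow> ('a \<Rightarrow> 'e) \<Rightarrow> 'e \<Rightarrow> 'e" where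
  "field_in_chart M c Z x = to_chart M c (chart_inv c x) (Z (chart_inv c x))"

definition nabla ::
    "('a, 'e::euclidean_space) manifold \<Rightarrow> 'e \<Rightarrow> ('a \<Rightarrow> 'e) \<Rightarrow> 'a \<Rightarrow> 'e" where
  "nabla M u Z p =
     (let c = pref_chart M p
      in frechet_derivative (field_in_chart M c Z) (at (snd c p)) u + christoffel M c (snd c p) u (Z p))"

definition lie_bracket ::
    "('a, 'e::euclidean_space) manifold \<Rightarrow> ('a \<Rightarrow> 'e) \<Rightarrow> ('a \<Rightarrow> 'e) \<Rightarrow> 'a \<Rightarrow> 'e" where
  "lie_bracket M X Y p =
     (let c = pref_chart M p
      in frechet_derivative (field_in_chart M c Y) (at (snd c p)) (X p)
       - frechet_derivative (field_in_chart M c X) (at (snd c p)) (Y p))"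

definition curvature_fields ::
    "('a, 'e::euclidean_space) manifold \<Rightarrow> ('a \<Rightarrow> 'e) \<Rightarrow> ('a \<Rightarrow> 'e) \<Rightarrow> ('a \<Rightarrow> 'e) \<Rightarrow> 'a \<Rightarrow> 'e" where
  "curvature_fields M X Y Z p =
     nabla M (X p) (\<lambda>q. nabla M (Y q) Z q) p
     - nabla M (Y p) (\<lambda>q. nabla M (X q) Z q) p
     - nabla M (lie_bracket M X Y p) Z p"

text \<open>\<open>R(x,y)z\<close> for vectors at \<open>p\<close>: the curvature is tensorial, so it may be evaluated on any
  smooth local extensions; we take those with constant components in the chart \<open>pref_chart M p\<close>.\<close>

definition local_extension ::
    "('a, 'e::euclidean_space) manifold \<Rightarrow> 'a \<Rightarrow> 'e \<Rightarrow> 'a \<Rightarrow> 'e" where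
  "local_extension M p u q = from_chart M (pref_chart M p) q u"

definition curvature ::
    "('a, 'e::euclidean_space) manifold \<Rightarrow> 'a \<Rightarrow> 'e \<Rightarrow> 'e \<Rightarrow> 'e \<Rightarrow> 'e" where
  "curvature M p x y z =
     curvature_fields M (local_extension M p x) (local_extension M p y) (local_extension M p z) p"


section \<open>Curves, geodesics and parallel transport\<close>

definition smooth_curve_on ::
    "('a, 'e::euclidean_space) manifold \<Rightarrow> real set \<Rightarrow> (real \<Rightarrow> 'a) \<Rightarrow> bool" where
  "smooth_curve_on M I \<gamma> \<longleftrightarrow>
     continuous_map (top_of_set I) (mtop M) \<gamma> \<and>
     (\<forall>c\<in>atlas M. smooth_on (\<lambda>t. snd c (\<gamma> t)) {t\<in>I. \<gamma> t \<in> fst c})"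

definition smooth_field_along_on ::
    "('a, 'e::euclidean_space) manifold \<Rightarrow> real set \<Rightarrow> (real \<Rightarrow> 'a) \<Rightarrow> (real \<Rightarrow> 'e) \<Rightarrow> bool" where
  "smooth_field_along_on M I \<gamma> V \<longleftrightarrow>
     (\<forall>c\<in>atlas M. smooth_on (\<lambda>t. to_chart M c (\<gamma> t) (V t)) {t\<in>I. \<gamma> t \<in> fst c})"

definition velocity :: "('a, 'e::euclidean_space) manifold \<Rightarrow> (real \<Rightarrow> 'a) \<Rightarrow> real \<Rightarrow> 'e" where
  "velocity M \<gamma> t = vector_derivative (\<lambda>s. snd (pref_chart M (\<gamma> t)) (\<gamma> s)) (at t)"

text \<open>\<open>cov_deriv M \<gamma> V t\<close> is \<open>D/dt V\<close> at time \<open>t\<close>, for a vector field \<open>V\<close> along \<open>\<gamma>\<close>.\<close>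

definition cov_deriv ::
    "('a, 'e::euclidean_space) manifold \<Rightarrow> (real \<Rightarrow> 'a) \<Rightarrow> (real \<Rightarrow> 'e) \<Rightarrow> real \<Rightarrow> 'e" where
  "cov_deriv M \<gamma> V t =
     (let c = pref_chart M (\<gamma> t)
      in vector_derivative (\<lambda>s. to_chart M c (\<gamma> s) (V s)) (at t)
       + christoffel M c (snd c (\<gamma> t)) (velocity M \<gamma> t) (V t))"

definition geodesic_on ::
    "('a, 'e::euclidean_space) manifold \<Rightarrow> real set \<Rightarrow> (real \<Rightarrow> 'a) \<Rightarrow> bool" where
  "geodesic_on M I \<gamma> \<longleftrightarrow>
     smooth_curve_on M I \<gamma> \<and> (\<forall>t\<in>I. cov_deriv M \<gamma> (velocity M \<gamma>) t = 0)"

definition parallel_on ::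
    "('a, 'e::euclidean_space) manifold \<Rightarrow> real set \<Rightarrow> (real \<Rightarrow> 'a) \<Rightarrow> (real \<Rightarrow> 'e) \<Rightarrow> bool" where
  "parallel_on M I \<gamma> V \<longleftrightarrow>
     smooth_field_along_on M I \<gamma> V \<and> (\<forall>t\<in>I. cov_deriv M \<gamma> V t = 0)"

text \<open>The geodesic \<open>c\<^sub>u\<close> with footpoint \<open>p\<close>, and parallel transport along a curve from time \<open>0\<close>
  to time \<open>t\<close>. The solutions are required on some open interval containing \<open>0\<close> and \<open>t\<close>; their value
  at \<open>t\<close> does not depend on it.\<close>

definition geodesic_at ::
    "('a, 'e::euclidean_space) manifold \<Rightarrow> 'a \<Rightarrow> 'e \<Rightarrow> real \<Rightarrow> 'a" where
  "geodesic_at M p u t =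
     (THE q. \<exists>I \<gamma>. open I \<and> is_interval I \<and> 0 \<in> I \<and> t \<in> I \<and>
        geodesic_on M I \<gamma> \<and> \<gamma> 0 = p \<and> velocity M \<gamma> 0 = u \<and> \<gamma> t = q)"

definition parallel_transport ::
    "('a, 'e::euclidean_space) manifold \<Rightarrow> (real \<Rightarrow> 'a) \<Rightarrow> 'e \<Rightarrow> real \<Rightarrow> 'e" where
  "parallel_transport M \<gamma> v t =
     (THE w. \<exists>I V. open I \<and> is_interval I \<and> 0 \<in> I \<and> t \<in> I \<and>
        parallel_on M I \<gamma> V \<and> V 0 = v \<and> V t = w)"


section \<open>The bundle of tangent tuples\<close>

text \<open>An element of \<open>T\<^sup>kM\<close> is a pair of its footpoint and its tuple of tangent vectors, with index
  type \<open>'k\<close> of cardinality \<open>k\<close>.\<close>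

type_synonym ('a, 'e, 'k) tuple = "'a \<times> ('e ^ 'k)"

definition tuple_bundle :: "('a, 'e::euclidean_space) manifold \<Rightarrow> ('a, 'e, 'k::finite) tuple set" where
  "tuple_bundle M = topspace (mtop M) \<times> UNIV"

definition smooth_on_tuple_bundle ::
    "('a, 'e::euclidean_space) manifold \<Rightarrow> (('a, 'e, 'k::finite) tuple \<Rightarrow> real) \<Rightarrow> bool" where
  "smooth_on_tuple_bundle M \<phi> \<longleftrightarrow>
     (\<forall>c\<in>atlas M. smooth_on
        (\<lambda>(x, a). \<phi> (chart_inv c x, \<chi> m. from_chart M c (chart_inv c x) (a $ m)))
        (chart_image c \<times> UNIV))"

text \<open>\<open>transported M f u t\<close> is \<open>f\<^sub>u(t)\<close>.\<close>

definition transported ::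
    "('a, 'e::euclidean_space) manifold \<Rightarrow> ('a, 'e, 'k::finite) tuple \<Rightarrow> 'e \<Rightarrow> real \<Rightarrow> ('a, 'e, 'k) tuple" where
  "transported M f u t =
     (let \<gamma> = geodesic_at M (fst f) u
      in (\<gamma> t, \<chi> m. parallel_transport M \<gamma> (snd f $ m) t))"

text \<open>\<open>shifted f i w\<close> is \<open>(v\<^sub>1, \<dots>, v\<^sub>i + w, \<dots>, v\<^sub>k)\<close>.\<close>

definition shifted :: "('a, 'e::euclidean_space, 'k::finite) tuple \<Rightarrow> 'k \<Rightarrow> 'e \<Rightarrow> ('a, 'e, 'k) tuple" where
  "shifted f i w = (fst f, \<chi> m. if m = i then snd f $ m + w else snd f $ m)"

definition frame_flow ::
    "('a, 'e::euclidean_space) manifold \<Rightarrow> 'k::finite \<Rightarrow> real \<Rightarrow> ('a, 'e, 'k) tuple \<Rightarrow> ('a, 'e, 'k) tuple" where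
  "frame_flow M i t f = transported M f (snd f $ i) t"

definition flow_deriv ::
    "('a, 'e::euclidean_space) manifold \<Rightarrow> 'k::finite \<Rightarrow> (('a, 'e, 'k) tuple \<Rightarrow> real)
      \<Rightarrow> ('a, 'e, 'k) tuple \<Rightarrow> real" where
  "flow_deriv M i \<phi> f = deriv (\<lambda>t. \<phi> (frame_flow M i t f)) 0"

definition hgrad ::
    "('a, 'e::euclidean_space) manifold \<Rightarrow> (('a, 'e, 'k::finite) tuple \<Rightarrow> real)
      \<Rightarrow> ('a, 'e, 'k) tuple \<Rightarrow> 'e" where
  "hgrad M \<phi> f = (THE w. \<forall>u.
     ((\<lambda>t. \<phi> (transported M f u t)) has_real_derivative metric M (fst f) w u) (at 0))"

definition vgrad ::
    "('a, 'e::euclidean_space) manifold \<Rightarrow> 'k::finite \<Rightarrow> (('a, 'e, 'k) tuple \<Rightarrow> real)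
      \<Rightarrow> ('a, 'e, 'k) tuple \<Rightarrow> 'e" where
  "vgrad M i \<phi> f = (THE w. \<forall>u.
     ((\<lambda>t. \<phi> (shifted f i (t *\<^sub>R u))) has_real_derivative metric M (fst f) w u) (at 0))"

definition hnabla ::
    "('a, 'e::euclidean_space) manifold \<Rightarrow> 'e \<Rightarrow> (('a, 'e, 'k::finite) tuple \<Rightarrow> 'e)
      \<Rightarrow> ('a, 'e, 'k) tuple \<Rightarrow> 'e" where
  "hnabla M u X f = cov_deriv M (\<lambda>t. fst (transported M f u t)) (\<lambda>t. X (transported M f u t)) 0"

text \<open>Here the footpoint is constant, so \<open>D/dt\<close> is the derivative in the vector space \<open>T\<^sub>pM\<close>.\<close>

definition vnabla ::
    "'k::finite \<Rightarrow> 'e::euclidean_space \<Rightarrow> (('a, 'e, 'k) tuple \<Rightarrow> 'e) \<Rightarrow> ('a, 'e, 'k) tuple \<Rightarrow> 'e" where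
  "vnabla i u X f = vector_derivative (\<lambda>t. X (shifted f i (t *\<^sub>R u))) (at 0)"

definition orthonormal_basis :: "('a, 'e::euclidean_space) manifold \<Rightarrow> 'a \<Rightarrow> 'e set \<Rightarrow> bool" where
  "orthonormal_basis M p B \<longleftrightarrow>
     finite B \<and> card B = DIM('e) \<and>
     (\<forall>u\<in>B. \<forall>v\<in>B. metric M p u v = (if u = v then 1 else 0))"

definition some_onb :: "('a, 'e::euclidean_space) manifold \<Rightarrow> 'a \<Rightarrow> 'e set" where
  "some_onb M p = (SOME B. orthonormal_basis M p B)"

definition hdiv ::
    "('a, 'e::euclidean_space) manifold \<Rightarrow> (('a, 'e, 'k::finite) tuple \<Rightarrow> 'e)
      \<Rightarrow> ('a, 'e, 'k) tuple \<Rightarrow> real" where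
  "hdiv M X f = (\<Sum>e\<in>some_onb M (fst f). metric M (fst f) (hnabla M e X f) e)"

definition vdiv ::
    "('a, 'e::euclidean_space) manifold \<Rightarrow> 'k::finite \<Rightarrow> (('a, 'e, 'k) tuple \<Rightarrow> 'e)
      \<Rightarrow> ('a, 'e, 'k) tuple \<Rightarrow> real" where
  "vdiv M i X f = (\<Sum>e\<in>some_onb M (fst f). metric M (fst f) (vnabla i e X f) e)"


section \<open>The semi-basic vector fields of the identity\<close>

definition Yfield ::
    "('a, 'e::euclidean_space) manifold \<Rightarrow> (('a, 'e, 'k::finite) tuple \<Rightarrow> real) \<Rightarrow> 'k \<Rightarrow> 'k
      \<Rightarrow> ('a, 'e, 'k) tuple \<Rightarrow> 'e" where
  "Yfield M \<phi> j i f =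
     metric M (fst f) (hgrad M \<phi> f) (vgrad M j \<phi> f) *\<^sub>R (snd f $ i)
     - flow_deriv M i \<phi> f *\<^sub>R vgrad M j \<phi> f"

definition Zfield ::
    "('a, 'e::euclidean_space) manifold \<Rightarrow> (('a, 'e, 'k::finite) tuple \<Rightarrow> real) \<Rightarrow> 'k
      \<Rightarrow> ('a, 'e, 'k) tuple \<Rightarrow> 'e" where
  "Zfield M \<phi> i f = flow_deriv M i \<phi> f *\<^sub>R hgrad M \<phi> f"

end

theory Submission
  imports Defs
begin

text \<open>
  In a chart with Christoffel symbols \<open>\<Gamma>\<close>, the curve \<open>f\<^sub>u\<close> starts at \<open>z = (x, a)\<close> with velocity
  \<open>(u, (- \<Gamma>\<^sub>x(u, a\<^sub>l))\<^sub>l)\<close>. Hence all operators are first order differential operators in \<open>(x, a)\<close>, and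
  the dependence of geodesics on their initial data never enters. Write \<open>h\<close> for the horizontal gradient, \<open>w\<^sub>l\<close>
  for the vertical ones, \<open>a\<^sub>i\<close> for the \<open>i\<close>-th vector of the tuple and \<open>\<nabla>\<close> for the horizontal covariant
  derivative. Symmetry of second derivatives gives
  \<open>\<langle>\<partial>\<^sub>j\<^sub>,\<^sub>w h, u\<rangle> = \<langle>\<nabla>\<^sub>u w\<^sub>j, w\<rangle>\<close> and
  \<open>\<langle>\<nabla>\<^sub>u h, v\<rangle> - \<langle>\<nabla>\<^sub>v h, u\<rangle> = - \<Sum>\<^sub>l \<langle>w\<^sub>l, R(u, v) a\<^sub>l\<rangle>\<close>.
  By the first identity the terms containing \<open>div h\<close> and \<open>div w\<^sub>j\<close> cancel; the second one, applied to
  \<open>u = a\<^sub>i\<close> and \<open>v = w\<^sub>j\<close>, yields the curvature term through the pair symmetry of \<open>R\<close>.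
\<close>

section \<open>Smooth maps between Euclidean spaces\<close>

text \<open>Two features of the definitions shape the proof. \<open>geodesic_at\<close> and
  \<open>parallel_transport\<close> are unique-choice terms over solutions on arbitrary intervals,
  whose curves may leave any given chart; they can be evaluated only after existence is known and
  uniqueness holds against every competing curve on \<open>M\<close>. As only derivatives at time 0
  occur, a solution on a small interval inside one chart suffices. Secondly,
  \<open>pref_chart M p\<close> varies arbitrarily with \<open>p\<close>, so the values of a
  semi-basic field need not vary continuously. Hence all fields are written as
  \<open>from_chart M c\<close> applied to component functions in one fixed chart \<open>c\<close>.
  The covariant derivative, defined through the preferred chart, has the expected form in
  \<open>c\<close> because the inhomogeneous term in the change of Christoffel symbols cancels the
  derivative of the Jacobian. At the end \<open>c\<close> is the preferred chart of the footpoint of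
  \<open>f\<close>, where components and vectors coincide.\<close>

abbreviation D :: "('a::real_normed_vector \<Rightarrow> 'b::real_normed_vector) \<Rightarrow> 'a \<Rightarrow> 'a \<Rightarrow> 'b" where
  "D f x \<equiv> frechet_derivative f (at x)"

lemma has_derivative_cong_open:
  assumes "open S" "x \<in> S" "\<And>y. y \<in> S \<Longrightarrow> f y = g y"
  shows "(f has_derivative f') (at x) \<longleftrightarrow> (g has_derivative f') (at x)"
  using assms has_derivative_transform_within_open[of f f' x UNIV S g]
    has_derivative_transform_within_open[of g f' x UNIV S f] by auto

lemma has_derivative_transform_open:
  assumes "open S" "x \<in> S" "(h has_derivative f') (at x)" "\<And>y. y \<in> S \<Longrightarrow> f y = h y"
  shows "(f has_derivative f') (at x)"
  using has_derivative_cong_open[OF assms(1,2), of f h f'] assms(3,4) by blast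

lemma differentiable_cong_open:
  assumes "open S" "x \<in> S" "\<And>y. y \<in> S \<Longrightarrow> f y = g y"
  shows "f differentiable (at x) \<longleftrightarrow> g differentiable (at x)"
  unfolding differentiable_def using has_derivative_cong_open[OF assms] by simp

lemma D_cong_open:
  assumes "open S" "x \<in> S" "\<And>y. y \<in> S \<Longrightarrow> f y = g y"
  shows "D f x = D g x"
  unfolding frechet_derivative_def using has_derivative_cong_open[OF assms] by simp

lemma D_eqI: "(f has_derivative f') (at x) \<Longrightarrow> D f x v = f' v"
  using frechet_derivative_at by metis

lemma has_derivative_D: "f differentiable (at x) \<Longrightarrow> (f has_derivative D f x) (at x)"
  by (simp add: frechet_derivative_works)

lemma linear_D: "f differentiable (at x) \<Longrightarrow> linear (D f x)"
  using has_derivative_D has_derivative_linear by blast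

section \<open>Closure properties of the classes of n times differentiable maps\<close>

lemma Ck_on_cong_open:
  assumes "open S" "\<And>y. y \<in> S \<Longrightarrow> f y = g y"
  shows "Ck_on n f S \<longleftrightarrow> Ck_on n g S"
  using assms(2)
proof (induction n arbitrary: f g)
  case 0
  then show ?case by (simp cong: continuous_on_cong)
next
  case (Suc n)
  have "D f x = D g x" if "x \<in> S" for x
    using D_cong_open[OF assms(1) that] Suc.prems by blast
  then have "Ck_on n (\<lambda>x. D f x v) S \<longleftrightarrow> Ck_on n (\<lambda>x. D g x v) S" for v
    by (intro Suc.IH) simp
  moreover have "f differentiable (at x) \<longleftrightarrow> g differentiable (at x)" if "x \<in> S" for x
    using differentiable_cong_open[OF assms(1) that] Suc.prems by blast
  ultimately show ?case by simp
qed

lemma smooth_on_cong_open: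
  assumes "open S" "\<And>y. y \<in> S \<Longrightarrow> f y = g y"
  shows "smooth_on f S \<longleftrightarrow> smooth_on g S"
  unfolding smooth_on_def using Ck_on_cong_open[OF assms(1), of f g] assms(2) by blast

lemma smooth_on_transform:
  assumes "open S" "smooth_on g S" "\<And>y. y \<in> S \<Longrightarrow> f y = g y"
  shows "smooth_on f S"
  using smooth_on_cong_open[OF assms(1), of f g] assms by blast

lemma Ck_on_continuous: "Ck_on n f S \<Longrightarrow> continuous_on S f"
  by (cases n) (auto intro: differentiable_imp_continuous_on simp: continuous_at_imp_continuous_on
      differentiable_imp_continuous_within)

lemma Ck_on_SucD: "Ck_on (Suc n) f S \<Longrightarrow> Ck_on n f S"
proof (induction n arbitrary: f)
  case 0
  then show ?case using Ck_on_continuous by (metis Ck_on.simps(1))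
next
  case (Suc n)
  then show ?case by (metis Ck_on.simps(2))
qed

lemma Ck_on_subset: "Ck_on n f S \<Longrightarrow> T \<subseteq> S \<Longrightarrow> Ck_on n f T"
proof (induction n arbitrary: f)
  case 0
  then show ?case by (auto intro: continuous_on_subset)
next
  case (Suc n)
  then show ?case by auto
qed

lemma smooth_on_subset: "smooth_on f S \<Longrightarrow> T \<subseteq> S \<Longrightarrow> smooth_on f T"
  unfolding smooth_on_def using Ck_on_subset by blast

lemma Ck_on_zero [simp]: "Ck_on n (\<lambda>x. 0) S"
  by (induction n) auto

lemma Ck_on_const [simp]: "Ck_on n (\<lambda>x. c) S"
  by (cases n) auto

lemma Ck_on_bounded_linear:
  assumes "bounded_linear f"
  shows "Ck_on n f S"
proof (cases n)
  case 0
  then show ?thesis using assms by (simp add: linear_continuous_on)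
next
  case (Suc m)
  have "D f x = f" for x
    using assms bounded_linear_imp_has_derivative frechet_derivative_at by metis
  then show ?thesis
    using Suc assms bounded_linear_imp_differentiable by auto
qed

lemma Ck_on_add:
  assumes "open S" "Ck_on n f S" "Ck_on n g S"
  shows "Ck_on n (\<lambda>x. f x + g x) S"
  using assms(2,3)
proof (induction n arbitrary: f g)
  case 0
  then show ?case by (auto intro: continuous_intros)
next
  case (Suc n)
  have "D (\<lambda>x. f x + g x) x v = D f x v + D g x v" if "x \<in> S" for x v
    by (rule D_eqI, intro has_derivative_add has_derivative_D) (use Suc.prems that in auto)
  then show ?case
    using Suc Ck_on_cong_open[OF assms(1), of "\<lambda>x. D (\<lambda>x. f x + g x) x _" "\<lambda>x. D f x _ + D g x _"]
    by (auto intro!: differentiable_add)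
qed

lemma Ck_on_sum:
  assumes "open S" "\<And>i. i \<in> I \<Longrightarrow> Ck_on n (f i) S"
  shows "Ck_on n (\<lambda>x. \<Sum>i\<in>I. f i x) S"
  using assms(2)
  by (induction I rule: infinite_finite_induct) (auto intro: Ck_on_add assms(1))

text \<open>By the product rule the derivative is a sum of two pairings of the same kind, so the
  induction must run over all \<open>f\<close> and \<open>g\<close>; \<open>Ck_on_SucD\<close>
  lowers the order of the factor that is not differentiated.\<close>

lemma Ck_on_bounded_bilinear:
  assumes "bounded_bilinear B" "open S" "Ck_on n f S" "Ck_on n g S"
  shows "Ck_on n (\<lambda>x. B (f x) (g x)) S"
  using assms(3,4)
proof (induction n arbitrary: f g)
  case 0
  then show ?case by (auto intro: bounded_bilinear.continuous_on[OF assms(1)])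
next
  case (Suc n)
  have der: "((\<lambda>x. B (f x) (g x)) has_derivative (\<lambda>v. B (f x) (D g x v) + B (D f x v) (g x))) (at x)"
    if "x \<in> S" for x
    by (intro bounded_bilinear.FDERIV[OF assms(1)] has_derivative_D) (use Suc.prems that in auto)
  have "Ck_on n (\<lambda>x. B (f x) (D g x v) + B (D f x v) (g x)) S" for v
    using Suc.prems Ck_on_SucD[OF Suc.prems(1)] Ck_on_SucD[OF Suc.prems(2)]
    by (intro Ck_on_add assms(2) Suc.IH) auto
  then have "Ck_on n (\<lambda>x. D (\<lambda>x. B (f x) (g x)) x v) S" for v
    using Ck_on_cong_open[OF assms(2), of "\<lambda>x. D (\<lambda>x. B (f x) (g x)) x v"
        "\<lambda>x. B (f x) (D g x v) + B (D f x v) (g x)"] D_eqI[OF der] by blast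
  then show ?case using der unfolding Ck_on.simps differentiable_def by blast
qed

lemma linear_basis_expansion:
  fixes L :: "'a::euclidean_space \<Rightarrow> 'b::real_vector"
  assumes "linear L"
  shows "L w = (\<Sum>b\<in>Basis. (w \<bullet> b) *\<^sub>R L b)"
proof -
  have "L (\<Sum>b\<in>Basis. (w \<bullet> b) *\<^sub>R b) = (\<Sum>b\<in>Basis. (w \<bullet> b) *\<^sub>R L b)"
    using assms by (simp add: linear_sum linear_cmul)
  then show ?thesis by (simp add: euclidean_representation)
qed

text \<open>The chain rule produces \<open>D g\<close> in a direction that varies with
  \<open>x\<close>, whereas \<open>Ck_on\<close> only speaks of fixed directions. Expanding the
  direction in the basis of the intermediate space leaves the maps \<open>D g _ b\<close>, to which
  the induction hypothesis applies.\<close>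

lemma Ck_on_compose:
  fixes f :: "'a::real_normed_vector \<Rightarrow> 'b::euclidean_space"
  assumes "open S" "Ck_on n f S" "Ck_on n g T" "f ` S \<subseteq> T"
  shows "Ck_on n (\<lambda>x. g (f x)) S"
  using assms(2,3)
proof (induction n arbitrary: g)
  case 0
  then show ?case using assms(4) by (auto intro: continuous_on_compose2)
next
  case (Suc n)
  have der: "((\<lambda>x. g (f x)) has_derivative (\<lambda>v. D g (f x) (D f x v))) (at x)" if "x \<in> S" for x
    using Suc.prems that assms(4)
    by (intro has_derivative_compose[of f _ x UNIV g] has_derivative_D) auto
  have eq: "D g (f x) w = (\<Sum>b\<in>Basis. (w \<bullet> b) *\<^sub>R D g (f x) b)" if "x \<in> S" for x w
    by (rule linear_basis_expansion, rule linear_D) (use Suc.prems that assms(4) in auto)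
  have "Ck_on n (\<lambda>x. \<Sum>b\<in>Basis. (D f x v \<bullet> b) *\<^sub>R D g (f x) b) S" for v
    using Suc.prems Ck_on_SucD
    by (intro Ck_on_sum assms(1) Ck_on_bounded_bilinear[OF bounded_bilinear_scaleR]
        Ck_on_bounded_bilinear[OF bounded_bilinear_inner] Ck_on_const Suc.IH) auto
  then have "Ck_on n (\<lambda>x. D (\<lambda>x. g (f x)) x v) S" for v
    using Ck_on_cong_open[OF assms(1), of "\<lambda>x. D (\<lambda>x. g (f x)) x v"
        "\<lambda>x. \<Sum>b\<in>Basis. (D f x v \<bullet> b) *\<^sub>R D g (f x) b"] D_eqI[OF der] eq by fastforce
  then show ?case using der unfolding Ck_on.simps differentiable_def by blast
qed

section \<open>Introduction rules for smoothness\<close>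

named_theorems smooth_intros

lemma smooth_on_const [smooth_intros]: "smooth_on (\<lambda>x. c) S"
  by (simp add: smooth_on_def)

lemma bounded_linear_smooth_on: "bounded_linear f \<Longrightarrow> smooth_on f S"
  by (simp add: smooth_on_def Ck_on_bounded_linear)

lemma smooth_on_id [smooth_intros]: "smooth_on (\<lambda>x. x) S"
  by (simp add: bounded_linear_smooth_on bounded_linear_ident)

lemma smooth_on_add [smooth_intros]:
  "smooth_on f S \<Longrightarrow> smooth_on g S \<Longrightarrow> open S \<Longrightarrow> smooth_on (\<lambda>x. f x + g x) S"
  by (simp add: smooth_on_def Ck_on_add)

lemma smooth_on_sum [smooth_intros]:
  "(\<And>i. i \<in> I \<Longrightarrow> smooth_on (f i) S) \<Longrightarrow> open S \<Longrightarrow> smooth_on (\<lambda>x. \<Sum>i\<in>I. f i x) S"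
  by (simp add: smooth_on_def Ck_on_sum)

lemma smooth_on_scaleR [smooth_intros]:
  "smooth_on f S \<Longrightarrow> smooth_on g S \<Longrightarrow> open S \<Longrightarrow> smooth_on (\<lambda>x. f x *\<^sub>R g x) S"
  by (simp add: smooth_on_def Ck_on_bounded_bilinear[OF bounded_bilinear_scaleR])

lemma smooth_on_mult [smooth_intros]:
  fixes f g :: "'a::real_normed_vector \<Rightarrow> real"
  shows "smooth_on f S \<Longrightarrow> smooth_on g S \<Longrightarrow> open S \<Longrightarrow> smooth_on (\<lambda>x. f x * g x) S"
  by (simp add: smooth_on_def Ck_on_bounded_bilinear[OF bounded_bilinear_mult])

lemma smooth_on_inner [smooth_intros]:
  "smooth_on f S \<Longrightarrow> smooth_on g S \<Longrightarrow> open S \<Longrightarrow> smooth_on (\<lambda>x. f x \<bullet> g x) S"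
  by (simp add: smooth_on_def Ck_on_bounded_bilinear[OF bounded_bilinear_inner])

lemma smooth_on_compose:
  fixes f :: "'a::real_normed_vector \<Rightarrow> 'b::euclidean_space"
  shows "smooth_on g T \<Longrightarrow> smooth_on f S \<Longrightarrow> f ` S \<subseteq> T \<Longrightarrow> open S \<Longrightarrow> smooth_on (\<lambda>x. g (f x)) S"
  unfolding smooth_on_def using Ck_on_compose by blast

lemma smooth_on_linear_compose:
  fixes f :: "'a::real_normed_vector \<Rightarrow> 'b::euclidean_space"
  shows "bounded_linear g \<Longrightarrow> smooth_on f S \<Longrightarrow> open S \<Longrightarrow> smooth_on (\<lambda>x. g (f x)) S"
  by (rule smooth_on_compose[of g UNIV]) (auto intro: bounded_linear_smooth_on)

lemma smooth_on_minus [smooth_intros]: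
  fixes f :: "'a::real_normed_vector \<Rightarrow> 'b::euclidean_space"
  shows "smooth_on f S \<Longrightarrow> open S \<Longrightarrow> smooth_on (\<lambda>x. - f x) S"
  by (rule smooth_on_linear_compose) (auto intro: bounded_linear_minus bounded_linear_ident)

lemma smooth_on_diff [smooth_intros]:
  fixes f g :: "'a::real_normed_vector \<Rightarrow> 'b::euclidean_space"
  shows "smooth_on f S \<Longrightarrow> smooth_on g S \<Longrightarrow> open S \<Longrightarrow> smooth_on (\<lambda>x. f x - g x) S"
  using smooth_on_add[of f S "\<lambda>x. - g x"] smooth_on_minus[of g S] by simp

lemma smooth_on_fst [smooth_intros]:
  fixes f :: "'a::real_normed_vector \<Rightarrow> 'b::euclidean_space \<times> 'c::euclidean_space"
  shows "smooth_on f S \<Longrightarrow> open S \<Longrightarrow> smooth_on (\<lambda>x. fst (f x)) S"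
  by (rule smooth_on_linear_compose) (auto intro: bounded_linear_fst)

lemma smooth_on_snd [smooth_intros]:
  fixes f :: "'a::real_normed_vector \<Rightarrow> 'b::euclidean_space \<times> 'c::euclidean_space"
  shows "smooth_on f S \<Longrightarrow> open S \<Longrightarrow> smooth_on (\<lambda>x. snd (f x)) S"
  by (rule smooth_on_linear_compose) (auto intro: bounded_linear_snd)

lemma smooth_on_Pair [smooth_intros]:
  fixes f :: "'a::real_normed_vector \<Rightarrow> 'b::euclidean_space"
    and g :: "'a::real_normed_vector \<Rightarrow> 'c::euclidean_space"
  assumes "smooth_on f S" "smooth_on g S" "open S"
  shows "smooth_on (\<lambda>x. (f x, g x)) S"
proof -
  have "smooth_on (\<lambda>x. (f x, 0) + (0, g x)) S"
    by (intro smooth_on_add smooth_on_linear_compose[of "\<lambda>y. (y, 0)"]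
        smooth_on_linear_compose[of "\<lambda>y. (0, y)"] bounded_linear_Pair bounded_linear_zero
        bounded_linear_ident assms)
  then show ?thesis by simp
qed

lemma smooth_on_vec_nth [smooth_intros]:
  fixes f :: "'a::real_normed_vector \<Rightarrow> 'b::euclidean_space ^ 'k::finite"
  shows "smooth_on f S \<Longrightarrow> open S \<Longrightarrow> smooth_on (\<lambda>x. f x $ l) S"
  by (rule smooth_on_linear_compose) (auto intro: bounded_linear_vec_nth)

lemma bounded_linear_axis: "bounded_linear (axis l :: 'b::euclidean_space \<Rightarrow> 'b ^ 'k::finite)"
  by (rule linear_conv_bounded_linear[THEN iffD1], rule linearI) (auto simp: axis_def vec_eq_iff)

lemma vec_lambda_as_sum_axis:
  "(\<chi> l. f l) = (\<Sum>l\<in>UNIV. axis l (f l :: 'b::real_normed_vector))"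
proof -
  have "(\<Sum>l\<in>UNIV. axis l (f l)) $ m = f m" for m
  proof -
    have "(\<Sum>l\<in>UNIV. axis l (f l)) $ m = (\<Sum>l\<in>UNIV. if l = m then f l else 0)"
      by (simp add: axis_def eq_commute)
    then show ?thesis by simp
  qed
  then show ?thesis by (simp add: vec_eq_iff)
qed

lemma smooth_on_vec_lambda [smooth_intros]:
  fixes f :: "'k::finite \<Rightarrow> 'a::real_normed_vector \<Rightarrow> 'b::euclidean_space"
  assumes "\<And>l. smooth_on (f l) S" "open S"
  shows "smooth_on (\<lambda>x. \<chi> l. f l x) S"
  unfolding vec_lambda_as_sum_axis
  by (intro smooth_on_sum smooth_on_linear_compose[OF bounded_linear_axis] assms)

lemma smooth_on_D [smooth_intros]:
  "smooth_on f S \<Longrightarrow> smooth_on (\<lambda>x. D f x v) S"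
  unfolding smooth_on_def by (metis Ck_on.simps(2))

lemma smooth_on_differentiable: "smooth_on f S \<Longrightarrow> x \<in> S \<Longrightarrow> f differentiable (at x)"
  unfolding smooth_on_def by (metis Ck_on.simps(2))

lemma smooth_on_has_derivative:
  "smooth_on f S \<Longrightarrow> x \<in> S \<Longrightarrow> (f has_derivative D f x) (at x)"
  using smooth_on_differentiable has_derivative_D by blast

lemma smooth_on_continuous: "smooth_on f S \<Longrightarrow> continuous_on S f"
  unfolding smooth_on_def using Ck_on_continuous by blast

text \<open>A map linear in its last argument is a finite combination of its values on the basis, so
  smoothness for each fixed argument \<open>b\<close> extends to a moving argument
  \<open>V s\<close>.\<close>

lemma smooth_on_linear_family:
  fixes L :: "'a::real_normed_vector \<Rightarrow> 'f::euclidean_space \<Rightarrow> 'b::real_normed_vector"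
    and \<xi> :: "'c::real_normed_vector \<Rightarrow> 'a"
  assumes "\<And>x. x \<in> S \<Longrightarrow> linear (L x)" "\<And>b. smooth_on (\<lambda>s. L (\<xi> s) b) T" "\<xi> ` T \<subseteq> S"
    "smooth_on V T" "open T"
  shows "smooth_on (\<lambda>s. L (\<xi> s) (V s)) T"
proof -
  have "smooth_on (\<lambda>s. \<Sum>b\<in>Basis. (V s \<bullet> b) *\<^sub>R L (\<xi> s) b) T"
    by (intro smooth_intros assms)
  then show ?thesis
  proof (rule smooth_on_transform[OF assms(5)])
    show "L (\<xi> s) (V s) = (\<Sum>b\<in>Basis. (V s \<bullet> b) *\<^sub>R L (\<xi> s) b)" if "s \<in> T" for s
      using that assms(3) by (intro linear_basis_expansion assms(1)) auto
  qed
qed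

lemma has_derivative_linear_family:
  fixes L :: "'a::real_normed_vector \<Rightarrow> 'f::euclidean_space \<Rightarrow> 'b::real_normed_vector"
    and \<xi> :: "'c::real_normed_vector \<Rightarrow> 'a"
  assumes S: "open S" "\<xi> t \<in> S" and lin: "\<And>x. x \<in> S \<Longrightarrow> linear (L x)"
    and dif: "\<And>b. (\<lambda>x. L x b) differentiable (at (\<xi> t))"
    and \<xi>: "(\<xi> has_derivative \<xi>') (at t)" and V: "(V has_derivative V') (at t)"
  shows "((\<lambda>s. L (\<xi> s) (V s)) has_derivative
          (\<lambda>h. D (\<lambda>x. L x (V t)) (\<xi> t) (\<xi>' h) + L (\<xi> t) (V' h))) (at t)"
proof -
  let ?R = "\<lambda>s. \<Sum>b\<in>Basis. (V s \<bullet> b) *\<^sub>R L (\<xi> s) b"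
  have dL: "((\<lambda>x. L x b) has_derivative D (\<lambda>x. L x b) (\<xi> t)) (at (\<xi> t))" for b
    using dif has_derivative_D by blast
  have d1: "((\<lambda>s. L (\<xi> s) b) has_derivative (\<lambda>h. D (\<lambda>x. L x b) (\<xi> t) (\<xi>' h))) (at t)" for b
    using has_derivative_compose[OF \<xi> dL] .
  have d2: "((\<lambda>s. V s \<bullet> b) has_derivative (\<lambda>h. V' h \<bullet> b)) (at t)" for b
    using V by (rule has_derivative_inner_left)
  have R: "(?R has_derivative (\<lambda>h. \<Sum>b\<in>Basis. (V t \<bullet> b) *\<^sub>R D (\<lambda>x. L x b) (\<xi> t) (\<xi>' h)
      + (V' h \<bullet> b) *\<^sub>R L (\<xi> t) b)) (at t)"
    by (intro has_derivative_sum has_derivative_scaleR d1 d2)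
  have Lx: "L x v = (\<Sum>b\<in>Basis. (v \<bullet> b) *\<^sub>R L x b)" if "x \<in> S" for x v
    using that lin linear_basis_expansion by blast
  have "((\<lambda>x. \<Sum>b\<in>Basis. (V t \<bullet> b) *\<^sub>R L x b) has_derivative
      (\<lambda>h. \<Sum>b\<in>Basis. (V t \<bullet> b) *\<^sub>R D (\<lambda>x. L x b) (\<xi> t) h)) (at (\<xi> t))"
    by (intro has_derivative_sum has_derivative_scaleR_right dL)
  then have "((\<lambda>x. L x (V t)) has_derivative
      (\<lambda>h. \<Sum>b\<in>Basis. (V t \<bullet> b) *\<^sub>R D (\<lambda>x. L x b) (\<xi> t) h)) (at (\<xi> t))"
    by (rule has_derivative_transform_open[OF S]) (rule Lx)
  then have e1: "D (\<lambda>x. L x (V t)) (\<xi> t) h = (\<Sum>b\<in>Basis. (V t \<bullet> b) *\<^sub>R D (\<lambda>x. L x b) (\<xi> t) h)" for h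
    by (rule D_eqI)
  have e2: "L (\<xi> t) (V' h) = (\<Sum>b\<in>Basis. (V' h \<bullet> b) *\<^sub>R L (\<xi> t) b)" for h
    using Lx S(2) .
  have R': "(?R has_derivative
          (\<lambda>h. D (\<lambda>x. L x (V t)) (\<xi> t) (\<xi>' h) + L (\<xi> t) (V' h))) (at t)"
    using R unfolding e1 e2 sum.distrib .
  \<comment> \<open>The basis expansion of \<open>L x\<close> is available on \<open>S\<close> only;
    by continuity \<open>\<xi>\<close> maps a neighbourhood of \<open>t\<close> into
    \<open>S\<close>, and there the two functions of \<open>s\<close> agree.\<close>
  obtain e where e: "e > 0" "ball (\<xi> t) e \<subseteq> S"
    using S openE by blast
  have "isCont \<xi> t" using \<xi> has_derivative_continuous by blast
  then obtain d where d: "d > 0" "\<And>s. dist s t < d \<Longrightarrow> dist (\<xi> s) (\<xi> t) < e"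
    using e(1) unfolding continuous_at_eps_delta by blast
  show ?thesis
  proof (rule has_derivative_transform_within_open[OF R', of "ball t d"])
    fix s assume "s \<in> ball t d"
    then have "\<xi> s \<in> S" using d(2)[of s] e(2) by (auto simp: dist_commute)
    then show "?R s = L (\<xi> s) (V s)" using Lx by simp
  qed (use d in auto)
qed

text \<open>The factor \<open>c\<close> is carried through the induction because each derivative is
  again a constant times a power.\<close>

lemma smooth_on_powr:
  "smooth_on (\<lambda>t::real. t powr r) {0<..}"
proof -
  have "Ck_on n (\<lambda>t::real. c * t powr r) {0<..}" for n c
  proof (induction n arbitrary: c r)
    case 0
    then show ?case by (auto intro!: continuous_intros)
  next
    case (Suc n)
    have der: "((\<lambda>t::real. c * t powr r) has_derivative (\<lambda>v. (v * (c * r)) * x powr (r - 1))) (at x)"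
      if "x \<in> {0<..}" for x
      using that by (auto intro!: derivative_eq_intros simp: powr_diff field_simps)
    have "Ck_on n (\<lambda>x. D (\<lambda>t::real. c * t powr r) x v) {0<..}" for v
      using Ck_on_cong_open[of "{0::real<..}" "\<lambda>x. D (\<lambda>t::real. c * t powr r) x v"]
        D_eqI[OF der] Suc.IH by fastforce
    then show ?case using der unfolding Ck_on.simps differentiable_def by blast
  qed
  from this[of _ 1] show ?thesis by (simp add: smooth_on_def)
qed

lemma smooth_on_inverse_sqrt [smooth_intros]:
  fixes f :: "'a::real_normed_vector \<Rightarrow> real"
  assumes "smooth_on f S" "\<And>x. x \<in> S \<Longrightarrow> f x > 0" "open S"
  shows "smooth_on (\<lambda>x. 1 / sqrt (f x)) S"
proof -
  have "smooth_on (\<lambda>x. f x powr (- 1/2)) S"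
    by (rule smooth_on_compose[OF smooth_on_powr assms(1)]) (use assms in auto)
  then show ?thesis
  proof (rule smooth_on_transform[OF assms(3)])
    show "1 / sqrt (f x) = f x powr (- 1/2)" if "x \<in> S" for x
      using assms(2)[OF that] by (simp add: powr_minus_divide powr_half_sqrt)
  qed
qed

text \<open>The mean value theorem is applied twice: along \<open>u\<close> to the difference in
  direction \<open>v\<close>, then along \<open>v\<close> to the derivative in direction
  \<open>u\<close>. The left-hand side is symmetric in \<open>u\<close> and \<open>v\<close>, which
  yields the symmetry of second derivatives.\<close>

lemma mixed_difference_mvt:
  fixes f :: "'a::real_normed_vector \<Rightarrow> real"
  assumes r: "0 < t" "t * (norm u + norm v) < r" and C2: "Ck_on 2 f (ball x r)"
  shows "\<exists>p. norm (p - x) \<le> t * (norm u + norm v) \<and>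
    f (x + t *\<^sub>R u + t *\<^sub>R v) - f (x + t *\<^sub>R u) - f (x + t *\<^sub>R v) + f x
      = t * t * D (\<lambda>y. D f y u) p v"
proof -
  have df: "(f has_derivative D f y) (at y)" if "y \<in> ball x r" for y
    using C2 that by (intro has_derivative_D) (auto simp: numeral_2_eq_2)
  have ddf: "((\<lambda>y. D f y u) has_derivative D (\<lambda>y. D f y u) y) (at y)" if "y \<in> ball x r" for y
    using C2 that by (intro has_derivative_D) (auto simp: numeral_2_eq_2)
  have dist: "norm (s *\<^sub>R u + s' *\<^sub>R v) \<le> t * (norm u + norm v)"
    if "0 \<le> s" "s \<le> t" "0 \<le> s'" "s' \<le> t" for s s'
  proof -
    have "norm (s *\<^sub>R u + s' *\<^sub>R v) \<le> s * norm u + s' * norm v"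
      using norm_triangle_ineq[of "s *\<^sub>R u" "s' *\<^sub>R v"] that by simp
    also have "\<dots> \<le> t * norm u + t * norm v"
      using that by (intro add_mono mult_right_mono) auto
    finally show ?thesis by (simp add: algebra_simps)
  qed
  have mem: "x + s *\<^sub>R u + s' *\<^sub>R v \<in> ball x r" if "0 \<le> s" "s \<le> t" "0 \<le> s'" "s' \<le> t" for s s'
  proof -
    have "dist x (x + s *\<^sub>R u + s' *\<^sub>R v) = norm (s *\<^sub>R u + s' *\<^sub>R v)"
      unfolding dist_norm by (subst norm_minus_commute) (simp add: algebra_simps)
    then show ?thesis using dist[OF that] r(2) by simp
  qed
  define q where "q s = f (x + s *\<^sub>R u + t *\<^sub>R v) - f (x + s *\<^sub>R u)" for s
  have q: "(q has_real_derivative (D f (x + s *\<^sub>R u + t *\<^sub>R v) u - D f (x + s *\<^sub>R u) u)) (at s)"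
    if "0 \<le> s" "s \<le> t" for s
  proof -
    have m: "x + s *\<^sub>R u + t *\<^sub>R v \<in> ball x r" "x + s *\<^sub>R u \<in> ball x r"
      using mem[of s t] mem[of s 0] that r by auto
    have i1: "((\<lambda>s. x + s *\<^sub>R u + t *\<^sub>R v) has_derivative (\<lambda>h. h *\<^sub>R u)) (at s)"
      by (auto intro!: derivative_eq_intros)
    have i2: "((\<lambda>s. x + s *\<^sub>R u) has_derivative (\<lambda>h. h *\<^sub>R u)) (at s)"
      by (auto intro!: derivative_eq_intros)
    have 1: "((\<lambda>s. f (x + s *\<^sub>R u + t *\<^sub>R v)) has_derivative (\<lambda>h. D f (x + s *\<^sub>R u + t *\<^sub>R v) (h *\<^sub>R u))) (at s)"
      by (rule has_derivative_compose[OF i1, OF df[OF m(1)]])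
    have 2: "((\<lambda>s. f (x + s *\<^sub>R u)) has_derivative (\<lambda>h. D f (x + s *\<^sub>R u) (h *\<^sub>R u))) (at s)"
      by (rule has_derivative_compose[OF i2, OF df[OF m(2)]])
    have "(q has_derivative (\<lambda>h. D f (x + s *\<^sub>R u + t *\<^sub>R v) (h *\<^sub>R u) - D f (x + s *\<^sub>R u) (h *\<^sub>R u))) (at s)"
      unfolding q_def by (rule has_derivative_diff[OF 1 2])
    moreover have "D f (x + s *\<^sub>R u + t *\<^sub>R v) (h *\<^sub>R u) - D f (x + s *\<^sub>R u) (h *\<^sub>R u) =
      (D f (x + s *\<^sub>R u + t *\<^sub>R v) u - D f (x + s *\<^sub>R u) u) * h" for h
      using has_derivative_linear[OF df[OF m(1)]] has_derivative_linear[OF df[OF m(2)]]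
      by (simp add: linear_cmul algebra_simps)
    ultimately show ?thesis unfolding has_field_derivative_def by simp
  qed
  obtain s where s: "0 < s" "s < t"
    "q t - q 0 = (t - 0) * (D f (x + s *\<^sub>R u + t *\<^sub>R v) u - D f (x + s *\<^sub>R u) u)"
    using MVT2[OF r(1), of q "\<lambda>s. D f (x + s *\<^sub>R u + t *\<^sub>R v) u - D f (x + s *\<^sub>R u) u"] q by blast
  define w where "w s' = D f (x + s *\<^sub>R u + s' *\<^sub>R v) u" for s'
  have w: "(w has_real_derivative D (\<lambda>y. D f y u) (x + s *\<^sub>R u + s' *\<^sub>R v) v) (at s')"
    if "0 \<le> s'" "s' \<le> t" for s'
  proof -
    have m: "x + s *\<^sub>R u + s' *\<^sub>R v \<in> ball x r" using mem[of s s'] that s by auto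
    have i1: "((\<lambda>s'. x + s *\<^sub>R u + s' *\<^sub>R v) has_derivative (\<lambda>h. h *\<^sub>R v)) (at s')"
      by (auto intro!: derivative_eq_intros)
    have "(w has_derivative (\<lambda>h. D (\<lambda>y. D f y u) (x + s *\<^sub>R u + s' *\<^sub>R v) (h *\<^sub>R v))) (at s')"
      unfolding w_def
      by (rule has_derivative_compose[OF i1, OF ddf[OF m]])
    moreover have "D (\<lambda>y. D f y u) (x + s *\<^sub>R u + s' *\<^sub>R v) (h *\<^sub>R v) =
      D (\<lambda>y. D f y u) (x + s *\<^sub>R u + s' *\<^sub>R v) v * h" for h
      using has_derivative_linear[OF ddf[OF m]] by (simp add: linear_cmul)
    ultimately show ?thesis unfolding has_field_derivative_def by simp
  qed
  obtain s' where s': "0 < s'" "s' < t"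
    "w t - w 0 = (t - 0) * D (\<lambda>y. D f y u) (x + s *\<^sub>R u + s' *\<^sub>R v) v"
    using MVT2[OF r(1), of w "\<lambda>s'. D (\<lambda>y. D f y u) (x + s *\<^sub>R u + s' *\<^sub>R v) v"] w by blast
  show ?thesis
  proof (intro exI conjI)
    show "norm (x + s *\<^sub>R u + s' *\<^sub>R v - x) \<le> t * (norm u + norm v)"
      using dist[of s s'] s s' by (simp add: add.assoc)
    show "f (x + t *\<^sub>R u + t *\<^sub>R v) - f (x + t *\<^sub>R u) - f (x + t *\<^sub>R v) + f x
      = t * t * D (\<lambda>y. D f y u) (x + s *\<^sub>R u + s' *\<^sub>R v) v"
      using s(3) s'(3) unfolding q_def w_def by (simp add: algebra_simps)
  qed
qed

lemma symmetric_second_derivative_real: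
  fixes f :: "'a::real_normed_vector \<Rightarrow> real"
  assumes "open S" "x \<in> S" "Ck_on 2 f S"
  shows "D (\<lambda>y. D f y u) x v = D (\<lambda>y. D f y v) x u"
proof (rule ccontr)
  let ?A = "\<lambda>p. D (\<lambda>y. D f y u) p v" and ?B = "\<lambda>p. D (\<lambda>y. D f y v) p u"
  assume "?A x \<noteq> ?B x"
  \<comment> \<open>Half the gap: values within \<open>e\<close> of \<open>?A x\<close> and of
    \<open>?B x\<close> cannot coincide, yet the mixed difference forces \<open>?A p = ?B q\<close>
    at nearby points.\<close>
  define e where "e = \<bar>?A x - ?B x\<bar> / 2"
  have e: "e > 0" using \<open>?A x \<noteq> ?B x\<close> by (simp add: e_def)
  obtain r where r: "r > 0" "ball x r \<subseteq> S" using assms openE by blast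
  have cont: "continuous_on S ?A" "continuous_on S ?B"
    using assms(3) by (auto simp: numeral_2_eq_2)
  then have "isCont ?A x" "isCont ?B x"
    using assms continuous_on_eq_continuous_at by blast+
  then obtain d1 d2 where d: "d1 > 0" "d2 > 0" "\<And>p. dist p x < d1 \<Longrightarrow> dist (?A p) (?A x) < e"
    "\<And>p. dist p x < d2 \<Longrightarrow> dist (?B p) (?B x) < e"
    using e unfolding continuous_at_eps_delta by metis
  define m where "m = min r (min d1 d2)"
  have m: "m > 0" using r d by (simp add: m_def)
  \<comment> \<open>The summand 1 keeps the denominator of \<open>t\<close> positive when both
    vectors vanish.\<close>
  define N where "N = norm u + norm v + 1"
  have N: "N > 0" by (simp add: N_def add_nonneg_pos)
  define t where "t = m / (2 * N)"
  have t: "t > 0" using m N by (simp add: t_def)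
  have "t * (norm u + norm v) \<le> t * N" using t by (simp add: N_def)
  also have "\<dots> < m" using m N by (simp add: t_def)
  finally have tm: "t * (norm u + norm v) < m" .
  have C: "Ck_on 2 f (ball x r)" using Ck_on_subset assms(3) r(2) by blast
  have tr: "t * (norm u + norm v) < r" using tm by (simp add: m_def)
  obtain p where p: "norm (p - x) \<le> t * (norm u + norm v)"
    "f (x + t *\<^sub>R u + t *\<^sub>R v) - f (x + t *\<^sub>R u) - f (x + t *\<^sub>R v) + f x = t * t * ?A p"
    using mixed_difference_mvt[OF t tr C] by blast
  obtain q where q: "norm (q - x) \<le> t * (norm u + norm v)"
    "f (x + t *\<^sub>R v + t *\<^sub>R u) - f (x + t *\<^sub>R v) - f (x + t *\<^sub>R u) + f x = t * t * ?B q"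
    using mixed_difference_mvt[OF t _ C, of v u] tr by (auto simp: add.commute)
  have sw: "x + t *\<^sub>R v + t *\<^sub>R u = x + t *\<^sub>R u + t *\<^sub>R v" by simp
  have "t * t * ?A p = t * t * ?B q" using p(2) q(2) unfolding sw by linarith
  then have "?A p = ?B q" using t by simp
  moreover have "dist (?A p) (?A x) < e" "dist (?B q) (?B x) < e"
    using d(3)[of p] d(4)[of q] p(1) q(1) tm by (auto simp: dist_norm m_def)
  ultimately show False by (auto simp: e_def dist_real_def abs_if split: if_splits)
qed

lemma D_inner_left:
  "f differentiable (at x) \<Longrightarrow> D (\<lambda>y. f y \<bullet> b) x v = D f x v \<bullet> b"
  by (rule D_eqI, rule has_derivative_inner_left, rule has_derivative_D)

lemma symmetric_second_derivative:
  fixes f :: "'a::real_normed_vector \<Rightarrow> 'b::euclidean_space"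
  assumes S: "open S" "x \<in> S" and f: "smooth_on f S"
  shows "D (\<lambda>y. D f y u) x v = D (\<lambda>y. D f y v) x u"
proof (rule euclidean_eqI)
  fix b :: 'b assume "b \<in> Basis"
  have C: "Ck_on 2 (\<lambda>y. f y \<bullet> b) S"
    using smooth_on_inner[OF f smooth_on_const S(1)] unfolding smooth_on_def by blast
  have "D (\<lambda>y. D (\<lambda>y. f y \<bullet> b) y u) x v = D (\<lambda>y. D f y u) x v \<bullet> b" for u v
  proof -
    have "D (\<lambda>y. D (\<lambda>y. f y \<bullet> b) y u) x = D (\<lambda>y. D f y u \<bullet> b) x"
      using S f by (intro D_cong_open[of S]) (auto intro: D_inner_left smooth_on_differentiable)
    then show ?thesis
      using D_inner_left[OF smooth_on_differentiable[OF smooth_on_D[OF f] S(2)]] by metis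
  qed
  then show "D (\<lambda>y. D f y u) x v \<bullet> b = D (\<lambda>y. D f y v) x u \<bullet> b"
    using symmetric_second_derivative_real[OF S C, of u v] by metis
qed

text \<open>The linear case is used twice: first with the first argument frozen, then with the
  parameter \<open>s\<close> itself indexing the family of maps linear in the first
  argument.\<close>

lemma smooth_on_bilinear_family:
  fixes B :: "'a::euclidean_space \<Rightarrow> 'f::euclidean_space \<Rightarrow> 'h::euclidean_space \<Rightarrow> 'b::real_normed_vector"
    and \<xi> :: "'c::real_normed_vector \<Rightarrow> 'a"
  assumes bil: "\<And>x. x \<in> S \<Longrightarrow> bilinear (B x)" and sm: "\<And>a b. smooth_on (\<lambda>x. B x a b) S"
    and \<xi>: "smooth_on \<xi> T" "\<xi> ` T \<subseteq> S" and "smooth_on V T" "smooth_on W T" "open T"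
  shows "smooth_on (\<lambda>s. B (\<xi> s) (V s) (W s)) T"
proof -
  have 0: "smooth_on (\<lambda>s. B (\<xi> s) a b) T" for a b
    using smooth_on_compose[OF sm \<xi> assms(7)] .
  have 1: "smooth_on (\<lambda>s. B (\<xi> s) a (W s)) T" for a
    by (rule smooth_on_linear_family[where L = "\<lambda>x. B x a" and S = S])
      (use 0 bil assms(4,6,7) in \<open>auto simp: bilinear_def\<close>)
  show ?thesis
    by (rule smooth_on_linear_family[where L = "\<lambda>s a. B (\<xi> s) a (W s)" and S = T and \<xi> = "\<lambda>s. s"])
      (use bil \<xi>(2) 1 assms(5,7) in \<open>auto simp: bilinear_def\<close>)
qed

text \<open>The pair of base point and first argument serves as the parameter of a family linear in
  the second argument, so the linear product rule applies twice.\<close>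

lemma has_derivative_bilinear_family:
  fixes B :: "'a::real_normed_vector \<Rightarrow> 'f::euclidean_space \<Rightarrow> 'h::euclidean_space \<Rightarrow> 'b::real_normed_vector"
    and \<xi> :: "'c::real_normed_vector \<Rightarrow> 'a"
  assumes S: "open S" "\<xi> t \<in> S" and bil: "\<And>x. x \<in> S \<Longrightarrow> bilinear (B x)"
    and dif: "\<And>a b. (\<lambda>x. B x a b) differentiable (at (\<xi> t))"
    and \<xi>: "(\<xi> has_derivative \<xi>') (at t)" and V: "(V has_derivative V') (at t)"
    and W: "(W has_derivative W') (at t)"
  shows "((\<lambda>s. B (\<xi> s) (V s) (W s)) has_derivative
          (\<lambda>h. D (\<lambda>x. B x (V t) (W t)) (\<xi> t) (\<xi>' h) + B (\<xi> t) (V' h) (W t) + B (\<xi> t) (V t) (W' h))) (at t)"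
proof -
  have pair: "((\<lambda>p. B (fst p) (snd p) b) has_derivative
      (\<lambda>h. D (\<lambda>x. B x (V t) b) (\<xi> t) (fst h) + B (\<xi> t) (snd h) b)) (at (\<xi> t, V t))" for b
    using has_derivative_linear_family[of S fst "(\<xi> t, V t)" "\<lambda>x a. B x a b" fst snd snd] S bil dif
    by (simp add: bilinear_def has_derivative_fst has_derivative_snd)
  have "((\<lambda>s. (\<lambda>p. B (fst p) (snd p)) (\<xi> s, V s) (W s)) has_derivative
      (\<lambda>h. D (\<lambda>p. B (fst p) (snd p) (W t)) (\<xi> t, V t) (\<xi>' h, V' h) + B (fst (\<xi> t, V t)) (snd (\<xi> t, V t)) (W' h))) (at t)"
  proof (rule has_derivative_linear_family[where S = "S \<times> UNIV"])
    show "(\<lambda>p. B (fst p) (snd p) b) differentiable at (\<xi> t, V t)" for b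
      using pair differentiable_def by blast
  qed (use S bil \<xi> V W in \<open>auto simp: bilinear_def intro: open_Times has_derivative_Pair\<close>)
  then show ?thesis unfolding D_eqI[OF pair] by simp
qed

text \<open>Pairing with a member of \<open>B\<close> recovers its coefficient. This makes
  \<open>B\<close> independent, hence spanning by its cardinality, and identifies the coefficients
  of \<open>v\<close>.\<close>

lemma orthonormal_expansion:
  fixes G :: "'e::euclidean_space \<Rightarrow> 'e \<Rightarrow> real"
  assumes bil: "bilinear G" and B: "finite B" "card B = DIM('e)"
    and on: "\<And>u v. u \<in> B \<Longrightarrow> v \<in> B \<Longrightarrow> G u v = (if u = v then 1 else 0)"
  shows "v = (\<Sum>e\<in>B. G v e *\<^sub>R e)"
proof -
  have coeff: "G (\<Sum>e\<in>B. c e *\<^sub>R e) e' = c e'" if "e' \<in> B" for c e'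
  proof -
    have "linear (\<lambda>x. G x e')" using bil by (simp add: bilinear_def)
    then have "G (\<Sum>e\<in>B. c e *\<^sub>R e) e' = (\<Sum>e\<in>B. c e * G e e')"
      using linear_sum[of "\<lambda>x. G x e'" "\<lambda>e. c e *\<^sub>R e" B] linear_cmul[of "\<lambda>x. G x e'"] by simp
    also have "\<dots> = (\<Sum>e\<in>B. if e = e' then c e else 0)"
      using on that by (intro sum.cong) auto
    finally show ?thesis using that B by simp
  qed
  have "independent B"
  proof
    assume "dependent B"
    then obtain c e where c: "(\<Sum>e\<in>B. c e *\<^sub>R e) = 0" "e \<in> B" "c e \<noteq> 0"
      using B by (auto simp: dependent_finite)
    have "c e = G 0 e" using coeff[OF c(2), of c] c(1) by simp
    then show False using c(3) bil by (simp add: bilinear_lzero)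
  qed
  then have "UNIV \<subseteq> span B"
    using B by (intro card_ge_dim_independent) auto
  then have "v \<in> span B" by auto
  then obtain c where c: "v = (\<Sum>e\<in>B. c e *\<^sub>R e)"
    using B by (auto simp: span_finite)
  have "G v e = c e" if "e \<in> B" for e using coeff[OF that, of c] c by simp
  then show ?thesis using c by simp
qed


section \<open>Riemannian metrics on open subsets of a Euclidean space\<close>

text \<open>Isolates what a chart contributes: on \<open>chart_image c\<close> the form
  \<open>chart_metric M c\<close> is such a metric, and the tensor calculus below takes place
  entirely in the model space.\<close>

locale local_metric =
  fixes U :: "'e::euclidean_space set" and g :: "'e \<Rightarrow> 'e \<Rightarrow> 'e \<Rightarrow> real"
  assumes open_U: "open U"
    and bilinear_g: "x \<in> U \<Longrightarrow> bilinear (g x)"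
    and sym_g: "x \<in> U \<Longrightarrow> g x a b = g x b a"
    and pos_g: "x \<in> U \<Longrightarrow> a \<noteq> 0 \<Longrightarrow> g x a a > 0"
    and smooth_g: "smooth_on (\<lambda>x. g x a b) U"
begin

lemma linear_g_left: "x \<in> U \<Longrightarrow> linear (\<lambda>a. g x a b)"
  and linear_g_right: "x \<in> U \<Longrightarrow> linear (g x a)"
  using bilinear_g by (auto simp: bilinear_def)

lemma g_add [simp]:
  "x \<in> U \<Longrightarrow> g x (a + b) c = g x a c + g x b c"
  "x \<in> U \<Longrightarrow> g x c (a + b) = g x c a + g x c b"
  by (simp_all add: bilinear_g bilinear_ladd bilinear_radd)

lemma g_diff [simp]:
  "x \<in> U \<Longrightarrow> g x (a - b) c = g x a c - g x b c"
  "x \<in> U \<Longrightarrow> g x c (a - b) = g x c a - g x c b"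
  by (simp_all add: bilinear_g bilinear_lsub bilinear_rsub)

lemma g_minus [simp]:
  "x \<in> U \<Longrightarrow> g x (- a) c = - g x a c"
  "x \<in> U \<Longrightarrow> g x c (- a) = - g x c a"
  by (simp_all add: bilinear_g bilinear_lneg bilinear_rneg)

lemma g_scaleR [simp]:
  "x \<in> U \<Longrightarrow> g x (r *\<^sub>R a) c = r * g x a c"
  "x \<in> U \<Longrightarrow> g x c (r *\<^sub>R a) = r * g x c a"
  by (simp_all add: bilinear_g bilinear_lmul bilinear_rmul)

lemma g_zero [simp]:
  "x \<in> U \<Longrightarrow> g x 0 c = 0"
  "x \<in> U \<Longrightarrow> g x c 0 = 0"
  by (simp_all add: bilinear_g bilinear_lzero bilinear_rzero)

lemma g_sum_left: "x \<in> U \<Longrightarrow> g x (\<Sum>i\<in>I. f i) c = (\<Sum>i\<in>I. g x (f i) c)"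
  using linear_sum[OF linear_g_left] by blast

lemma g_nondegenerate:
  assumes "x \<in> U" "\<And>d. g x a d = g x b d"
  shows "a = b"
proof (rule ccontr)
  assume "a \<noteq> b"
  then have "g x (a - b) (a - b) > 0" using pos_g[OF assms(1), of "a - b"] by (simp del: g_diff)
  moreover have "g x (a - b) (a - b) = 0" using assms(1) assms(2)[of a] assms(2)[of b] by simp
  ultimately show False by simp
qed

lemma smooth_on_g:
  fixes \<xi> :: "'c::real_normed_vector \<Rightarrow> 'e"
  assumes "smooth_on \<xi> T" "\<xi> ` T \<subseteq> U" "smooth_on V T" "smooth_on W T" "open T"
  shows "smooth_on (\<lambda>s. g (\<xi> s) (V s) (W s)) T"
  by (rule smooth_on_bilinear_family[OF bilinear_g smooth_g]) (use assms in auto)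

text \<open>Gram--Schmidt on the coordinate basis at all points at once. The span condition belongs
  to the induction: it keeps the next basis vector outside the span of the earlier frame, so the
  vector to be normalised vanishes nowhere.\<close>

lemma orthonormal_frame_exists_on:
  assumes "finite B" "B \<subseteq> Basis"
  shows "\<exists>E. (\<forall>b\<in>B. smooth_on (E b) U) \<and> (\<forall>x\<in>U. \<forall>b\<in>B. E b x \<in> span B) \<and>
     (\<forall>x\<in>U. \<forall>b\<in>B. \<forall>c\<in>B. g x (E b x) (E c x) = (if b = c then 1 else 0))"
  using assms
proof (induction B rule: finite_induct)
  case empty
  then show ?case by simp
next
  case (insert c B)
  then have "B \<subseteq> Basis" by simp
  from insert.IH[OF this] obtain E where E0: "\<forall>b\<in>B. smooth_on (E b) U" "\<forall>x\<in>U. \<forall>b\<in>B. E b x \<in> span B"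
     "\<forall>x\<in>U. \<forall>b\<in>B. \<forall>c\<in>B. g x (E b x) (E c x) = (if b = c then 1 else 0)"
    by (elim exE conjE)
  have E: "\<And>b. b \<in> B \<Longrightarrow> smooth_on (E b) U"
    "\<And>x b. x \<in> U \<Longrightarrow> b \<in> B \<Longrightarrow> E b x \<in> span B"
    "\<And>x b c. x \<in> U \<Longrightarrow> b \<in> B \<Longrightarrow> c \<in> B \<Longrightarrow> g x (E b x) (E c x) = (if b = c then 1 else 0)"
    using E0 by simp_all
  define v where "v x = c - (\<Sum>b\<in>B. g x c (E b x) *\<^sub>R E b x)" for x
  have sv: "smooth_on v U"
    unfolding v_def by (intro smooth_intros smooth_on_g E open_U) auto
  have in_span: "(\<Sum>b\<in>B. g x c (E b x) *\<^sub>R E b x) \<in> span B" if "x \<in> U" for x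
    using E(2)[OF that] by (intro span_sum span_scale)
  have "independent (insert c B)"
    using insert.prems independent_Basis independent_mono by blast
  then have "c \<notin> span B"
    using insert.hyps by (simp add: independent_insert)
  then have v0: "v x \<noteq> 0" if "x \<in> U" for x
    using in_span[OF that] by (auto simp: v_def)
  have vpos: "g x (v x) (v x) > 0" if "x \<in> U" for x
    using pos_g v0 that by blast
  have vE: "g x (v x) (E b x) = 0" if "x \<in> U" "b \<in> B" for x b
  proof -
    have "(\<Sum>i\<in>B. g x c (E i x) * g x (E i x) (E b x)) = (\<Sum>i\<in>B. if i = b then g x c (E i x) else 0)"
      using E(3)[OF that(1) _ that(2)] by (intro sum.cong) auto
    then show ?thesis
      using that insert.hyps by (simp add: v_def g_sum_left)
  qed
  define E' where "E' b x = (if b = c then (1 / sqrt (g x (v x) (v x))) *\<^sub>R v x else E b x)" for b x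
  have s1: "smooth_on (\<lambda>x. (1 / sqrt (g x (v x) (v x))) *\<^sub>R v x) U"
    by (intro smooth_intros smooth_on_g sv vpos open_U) auto
  have 1: "smooth_on (E' b) U" if "b \<in> insert c B" for b
    using that s1 E(1)[of b] unfolding E'_def by (cases "b = c") auto
  have 2: "E' b x \<in> span (insert c B)" if "x \<in> U" "b \<in> insert c B" for x b
  proof -
    have "v x \<in> span (insert c B)"
      unfolding v_def
      by (rule span_diff[OF span_base[OF insertI1] subsetD[OF span_mono[OF subset_insertI] in_span[OF that(1)]]])
    then show ?thesis
      using E(2)[OF that(1), of b] that span_mono[of B "insert c B"]
      by (auto simp: E'_def intro!: span_scale)
  qed
  have 3: "g x (E' b x) (E' d x) = (if b = d then 1 else 0)"
    if "x \<in> U" "b \<in> insert c B" "d \<in> insert c B" for x b d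
    using vE[OF that(1)] vpos[OF that(1)] E(3)[OF that(1)] that insert.hyps sym_g[OF that(1)]
    by (auto simp: E'_def)
  show ?case
    using 1 2 3 by (intro exI[of _ E'] conjI ballI) auto
qed

text \<open>A smooth orthonormal frame, obtained by Gram--Schmidt, makes the solution \<open>sharp x k\<close> of
  \<open>g\<^sub>x(w, \<cdot>) = k\<close> smooth in \<open>x\<close> without inverting the matrix of \<open>g\<^sub>x\<close>.\<close>

definition frame :: "'e \<Rightarrow> 'e \<Rightarrow> 'e" where
  "frame = (SOME E. (\<forall>b\<in>Basis. smooth_on (E b) U) \<and>
     (\<forall>x\<in>U. \<forall>b\<in>Basis. \<forall>c\<in>Basis. g x (E b x) (E c x) = (if b = c then 1 else 0)))"

lemma smooth_frame: "b \<in> Basis \<Longrightarrow> smooth_on (frame b) U"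
  and frame_orthonormal:
    "x \<in> U \<Longrightarrow> b \<in> Basis \<Longrightarrow> c \<in> Basis \<Longrightarrow> g x (frame b x) (frame c x) = (if b = c then 1 else 0)"
proof -
  obtain E where E: "(\<forall>b\<in>(Basis :: 'e set). smooth_on (E b) U) \<and> (\<forall>x\<in>U. \<forall>b\<in>Basis. E b x \<in> span Basis) \<and>
     (\<forall>x\<in>U. \<forall>b\<in>Basis. \<forall>c\<in>Basis. g x (E b x) (E c x) = (if b = c then 1 else 0))"
    using orthonormal_frame_exists_on[OF finite_Basis order_refl] by (elim exE) (rule that)
  note fr = someI[of "\<lambda>E. (\<forall>b\<in>Basis. smooth_on (E b) U) \<and>
     (\<forall>x\<in>U. \<forall>b\<in>Basis. \<forall>c\<in>Basis. g x (E b x) (E c x) = (if b = c then 1 else 0))" E,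
     OF conjI[OF conjunct1[OF E] conjunct2[OF conjunct2[OF E]]], folded frame_def]
  show "b \<in> Basis \<Longrightarrow> smooth_on (frame b) U"
    by (rule bspec[OF conjunct1[OF fr]])
  show "x \<in> U \<Longrightarrow> b \<in> Basis \<Longrightarrow> c \<in> Basis \<Longrightarrow> g x (frame b x) (frame c x) = (if b = c then 1 else 0)"
    by (rule bspec[OF bspec[OF bspec[OF conjunct2[OF fr]]]])
qed

lemma inj_on_frame: "x \<in> U \<Longrightarrow> inj_on (\<lambda>b. frame b x) Basis"
  using frame_orthonormal by (intro inj_onI) (metis zero_neq_one)

lemma frame_basis:
  assumes "x \<in> U"
  shows "finite ((\<lambda>b. frame b x) ` Basis)" "card ((\<lambda>b. frame b x) ` Basis) = DIM('e)"
    "\<And>u v. u \<in> (\<lambda>b. frame b x) ` Basis \<Longrightarrow> v \<in> (\<lambda>b. frame b x) ` Basis \<Longrightarrow>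
       g x u v = (if u = v then 1 else 0)"
proof -
  show "finite ((\<lambda>b. frame b x) ` Basis)" by simp
  show "card ((\<lambda>b. frame b x) ` Basis) = DIM('e)"
    using card_image[OF inj_on_frame[OF assms]] by simp
  show "g x u v = (if u = v then 1 else 0)"
    if "u \<in> (\<lambda>b. frame b x) ` Basis" "v \<in> (\<lambda>b. frame b x) ` Basis" for u v
  proof -
    from that obtain b c where "u = frame b x" "v = frame c x" "b \<in> Basis" "c \<in> Basis" by auto
    then show ?thesis
      using frame_orthonormal[OF assms, of b c] inj_onD[OF inj_on_frame[OF assms], of b c] by auto
  qed
qed

lemma frame_expansion:
  assumes "x \<in> U"
  shows "v = (\<Sum>b\<in>Basis. g x v (frame b x) *\<^sub>R frame b x)"
  using orthonormal_expansion[OF bilinear_g[OF assms] frame_basis[OF assms], of v]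
  by (simp add: sum.reindex[OF inj_on_frame[OF assms]])

definition sharp :: "'e \<Rightarrow> ('e \<Rightarrow> real) \<Rightarrow> 'e" where
  "sharp x k = (\<Sum>b\<in>Basis. k (frame b x) *\<^sub>R frame b x)"

lemma g_sharp:
  assumes "x \<in> U" "linear k"
  shows "g x (sharp x k) d = k d"
proof -
  have "k d = k (\<Sum>b\<in>Basis. g x d (frame b x) *\<^sub>R frame b x)"
    using frame_expansion[OF assms(1)] by metis
  also have "\<dots> = (\<Sum>b\<in>Basis. g x d (frame b x) * k (frame b x))"
    using assms(2) by (simp add: linear_sum linear_cmul)
  also have "\<dots> = (\<Sum>b\<in>Basis. k (frame b x) * g x (frame b x) d)"
    using sym_g[OF assms(1)] by (metis mult.commute)
  finally show ?thesis using assms(1) by (simp add: sharp_def g_sum_left)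
qed

text \<open>The form need only be smooth in \<open>s\<close> at each fixed vector; its values on the
  moving frame are then smooth by linearity.\<close>

lemma smooth_on_sharp:
  fixes \<xi> :: "'c::real_normed_vector \<Rightarrow> 'e"
  assumes "smooth_on \<xi> T" "\<xi> ` T \<subseteq> U" "open T"
    and "\<And>s. s \<in> T \<Longrightarrow> linear (k s)" "\<And>b. smooth_on (\<lambda>s. k s b) T"
  shows "smooth_on (\<lambda>s. sharp (\<xi> s) (k s)) T"
proof -
  have fr: "smooth_on (\<lambda>s. frame b (\<xi> s)) T" if "b \<in> Basis" for b
    using smooth_on_compose[OF smooth_frame[OF that] assms(1-3)] .
  have "smooth_on (\<lambda>s. k s (frame b (\<xi> s))) T" if "b \<in> Basis" for b
    by (rule smooth_on_linear_family[where L = k and S = T and \<xi> = "\<lambda>s. s"])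
      (use assms fr that in auto)
  then show ?thesis
    unfolding sharp_def by (intro smooth_intros fr assms)
qed

section \<open>Christoffel symbols\<close>

abbreviation dg :: "'e \<Rightarrow> 'e \<Rightarrow> 'e \<Rightarrow> 'e \<Rightarrow> real" where
  "dg x u a b \<equiv> D (\<lambda>y. g y a b) x u"

lemma g_has_derivative:
  fixes \<xi> :: "'c::real_normed_vector \<Rightarrow> 'e"
  assumes "\<xi> t \<in> U" "(\<xi> has_derivative \<xi>') (at t)" "(V has_derivative V') (at t)" "(W has_derivative W') (at t)"
  shows "((\<lambda>s. g (\<xi> s) (V s) (W s)) has_derivative
     (\<lambda>h. dg (\<xi> t) (\<xi>' h) (V t) (W t) + g (\<xi> t) (V' h) (W t) + g (\<xi> t) (V t) (W' h))) (at t)"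
  by (rule has_derivative_bilinear_family[of U])
    (use assms open_U bilinear_g smooth_on_differentiable[OF smooth_g] in auto)

text \<open>Linearity of \<open>g y\<close> in its arguments holds at all \<open>y\<close> in the
  open set \<open>U\<close>, so it survives differentiation in \<open>y\<close>.\<close>

lemma linear_dg:
  assumes "x \<in> U"
  shows "linear (\<lambda>u. dg x u a b)" "linear (\<lambda>a. dg x u a b)" "linear (\<lambda>b. dg x u a b)"
proof -
  have d: "(\<lambda>y. g y a b) differentiable at x" for a b
    using smooth_on_differentiable[OF smooth_g assms] .
  have h: "((\<lambda>y. g y a b) has_derivative D (\<lambda>y. g y a b) x) (at x)" for a b
    using d by (rule has_derivative_D)
  show "linear (\<lambda>u. dg x u a b)" using linear_D[OF d] .
  have add1: "dg x u (a + a') b = dg x u a b + dg x u a' b" for a a' b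
    by (rule D_eqI, rule has_derivative_transform_open[OF open_U assms])
      (auto intro: has_derivative_add h)
  have scale1: "dg x u (r *\<^sub>R a) b = r *\<^sub>R dg x u a b" for a r b
    by (rule D_eqI, rule has_derivative_transform_open[OF open_U assms, where h = "\<lambda>y. r *\<^sub>R g y a b"])
      (auto intro!: has_derivative_mult_right h)
  have swap: "dg x u a b = dg x u b a" for a b
    by (rule fun_cong[OF D_cong_open[OF open_U assms]]) (rule sym_g)
  show lin2: "linear (\<lambda>a. dg x u a b)" for b by (rule linearI) (simp_all add: add1 scale1)
  have "(\<lambda>b. dg x u a b) = (\<lambda>b. dg x u b a)" by (rule ext) (rule swap)
  with lin2[of a] show "linear (\<lambda>b. dg x u a b)" by (simp only:)
qed

lemma dg_sym: "x \<in> U \<Longrightarrow> dg x u a b = dg x u b a"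
  by (rule fun_cong[OF D_cong_open[OF open_U]]) (auto intro: sym_g)

text \<open>Half the right-hand side of the Koszul formula for fields with constant components,
  whose brackets vanish.\<close>

definition koszul :: "'e \<Rightarrow> 'e \<Rightarrow> 'e \<Rightarrow> 'e \<Rightarrow> real" where
  "koszul x a b d = (dg x a b d + dg x b a d - dg x d a b) / 2"

text \<open>The solution of the Koszul equation given by \<open>sharp\<close> is visibly smooth in
  \<open>x\<close>, which the unique-choice term in \<open>christoffel\<close> is not.\<close>

definition Gam :: "'e \<Rightarrow> 'e \<Rightarrow> 'e \<Rightarrow> 'e" where
  "Gam x a b = sharp x (koszul x a b)"

lemma linear_koszul: "x \<in> U \<Longrightarrow> linear (koszul x a b)"
  unfolding koszul_def
  by (rule linearI) (simp_all add: linear_dg linear_add[OF linear_dg(1)] linear_add[OF linear_dg(3)]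
      linear_cmul[OF linear_dg(1)] linear_cmul[OF linear_dg(3)] field_simps)

lemma g_Gam: "x \<in> U \<Longrightarrow> g x (Gam x a b) d = koszul x a b d"
  unfolding Gam_def by (rule g_sharp[OF _ linear_koszul])

lemma Gam_sym: "x \<in> U \<Longrightarrow> Gam x a b = Gam x b a"
  by (rule g_nondegenerate) (auto simp: g_Gam koszul_def dg_sym)

lemma bilinear_Gam:
  assumes "x \<in> U"
  shows "bilinear (Gam x)"
proof -
  have "linear (\<lambda>a. Gam x a b)" for b
    by (rule linearI; rule g_nondegenerate[OF assms])
      (simp_all add: g_Gam assms koszul_def linear_add[OF linear_dg(1)] linear_add[OF linear_dg(2)]
      linear_cmul[OF linear_dg(1)] linear_cmul[OF linear_dg(2)] field_simps)
  then show ?thesis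
    unfolding bilinear_def using Gam_sym[OF assms] by simp
qed

lemma Gam_linear_simps [simp]:
  assumes "x \<in> U"
  shows "Gam x (a + b) c = Gam x a c + Gam x b c" "Gam x c (a + b) = Gam x c a + Gam x c b"
    "Gam x (a - b) c = Gam x a c - Gam x b c" "Gam x c (a - b) = Gam x c a - Gam x c b"
    "Gam x (- a) c = - Gam x a c" "Gam x c (- a) = - Gam x c a"
    "Gam x (r *\<^sub>R a) c = r *\<^sub>R Gam x a c" "Gam x c (r *\<^sub>R a) = r *\<^sub>R Gam x c a"
    "Gam x 0 c = 0" "Gam x c 0 = 0"
  by (simp_all add: bilinear_Gam[OF assms] bilinear_ladd bilinear_radd bilinear_lsub bilinear_rsub
      bilinear_lneg bilinear_rneg bilinear_lmul bilinear_rmul bilinear_lzero bilinear_rzero)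

lemma smooth_Gam: "smooth_on (\<lambda>x. Gam x a b) U"
proof -
  have "smooth_on (\<lambda>x. koszul x a b d) U" for d
    unfolding koszul_def divide_inverse by (intro smooth_intros smooth_g open_U)
  then show ?thesis
    unfolding Gam_def by (intro smooth_on_sharp) (auto intro!: smooth_intros open_U linear_koszul)
qed

lemma smooth_on_Gam:
  fixes \<xi> :: "'c::real_normed_vector \<Rightarrow> 'e"
  assumes "smooth_on \<xi> T" "\<xi> ` T \<subseteq> U" "smooth_on V T" "smooth_on W T" "open T"
  shows "smooth_on (\<lambda>s. Gam (\<xi> s) (V s) (W s)) T"
  by (rule smooth_on_bilinear_family[OF bilinear_Gam smooth_Gam]) (use assms in auto)

section \<open>Curvature and its symmetries\<close>

abbreviation dGam :: "'e \<Rightarrow> 'e \<Rightarrow> 'e \<Rightarrow> 'e \<Rightarrow> 'e" where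
  "dGam x u a b \<equiv> D (\<lambda>y. Gam y a b) x u"

lemma Gam_has_derivative:
  fixes \<xi> :: "'c::real_normed_vector \<Rightarrow> 'e"
  assumes "\<xi> t \<in> U" "(\<xi> has_derivative \<xi>') (at t)" "(V has_derivative V') (at t)" "(W has_derivative W') (at t)"
  shows "((\<lambda>s. Gam (\<xi> s) (V s) (W s)) has_derivative
     (\<lambda>h. dGam (\<xi> t) (\<xi>' h) (V t) (W t) + Gam (\<xi> t) (V' h) (W t) + Gam (\<xi> t) (V t) (W' h))) (at t)"
  by (rule has_derivative_bilinear_family[of U])
    (use assms open_U bilinear_Gam smooth_on_differentiable[OF smooth_Gam] in auto)

text \<open>In the sum of the two Koszul expressions the derivatives in the directions
  \<open>a\<close> and \<open>b\<close> cancel, and the two halves of the derivative along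
  \<open>u\<close> add up.\<close>

lemma metric_compatible:
  "x \<in> U \<Longrightarrow> dg x u a b = g x (Gam x u a) b + g x a (Gam x u b)"
  using sym_g[of x a] dg_sym[of x] by (simp add: g_Gam koszul_def field_simps)

lemma dGam_sym: "x \<in> U \<Longrightarrow> dGam x u a b = dGam x u b a"
  by (rule fun_cong[OF D_cong_open[OF open_U]]) (auto intro: Gam_sym)

text \<open>The coordinate formula for the Riemann tensor: the fields have constant components, so
  there is no bracket term.\<close>

definition curv :: "'e \<Rightarrow> 'e \<Rightarrow> 'e \<Rightarrow> 'e \<Rightarrow> 'e" where
  "curv x u v w = dGam x u v w - dGam x v u w + Gam x u (Gam x v w) - Gam x v (Gam x u w)"

lemma curv_antisym: "curv x u v w = - curv x v u w"
  by (simp add: curv_def)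

text \<open>First Bianchi identity. Both the derivative terms and the quadratic terms cancel in
  pairs because the connection is torsion free.\<close>

lemma bianchi:
  assumes "x \<in> U"
  shows "curv x u v w + curv x v w u + curv x w u v = 0"
  unfolding curv_def dGam_sym[OF assms, of u v w] dGam_sym[OF assms, of v w u] dGam_sym[OF assms, of w u v]
    Gam_sym[OF assms, of v w] Gam_sym[OF assms, of w u] Gam_sym[OF assms, of u v]
  by simp

lemma dg_dg:
  assumes "x \<in> U"
  shows "D (\<lambda>y. dg y v a b) x u =
    g x (Gam x u (Gam x v a)) b + g x (Gam x v a) (Gam x u b) + g x (dGam x u v a) b +
    g x (Gam x u a) (Gam x v b) + g x a (Gam x u (Gam x v b)) + g x a (dGam x u v b)"
proof -
  have id: "((\<lambda>y. y) has_derivative (\<lambda>h. h)) (at x)" by (rule has_derivative_ident)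
  have c: "((\<lambda>y. c) has_derivative (\<lambda>h. 0)) (at x)" for c :: 'e by (rule has_derivative_const)
  have G: "((\<lambda>y. Gam y v a) has_derivative (\<lambda>h. dGam x h v a)) (at x)" for a
    using smooth_on_has_derivative[OF smooth_Gam assms] .
  have "((\<lambda>y. g y (Gam y v a) b + g y a (Gam y v b)) has_derivative
     (\<lambda>h. (dg x h (Gam x v a) b + g x (dGam x h v a) b + g x (Gam x v a) 0) +
          (dg x h a (Gam x v b) + g x 0 (Gam x v b) + g x a (dGam x h v b)))) (at x)"
    by (intro has_derivative_add g_has_derivative id c G assms)
  then have "((\<lambda>y. dg y v a b) has_derivative
     (\<lambda>h. (dg x h (Gam x v a) b + g x (dGam x h v a) b + g x (Gam x v a) 0) +
          (dg x h a (Gam x v b) + g x 0 (Gam x v b) + g x a (dGam x h v b)))) (at x)"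
    by (rule has_derivative_transform_open[OF open_U assms]) (rule metric_compatible)
  from D_eqI[OF this, of u] show ?thesis
    using assms by (simp add: metric_compatible)
qed

text \<open>Second derivatives of the metric components commute. In \<open>dg_dg\<close> the mixed
  products of two Christoffel terms are symmetric in \<open>u\<close> and \<open>v\<close>; what
  remains of the difference is the curvature acting on \<open>a\<close> and on
  \<open>b\<close>.\<close>

lemma curv_skew:
  assumes "x \<in> U"
  shows "g x (curv x u v a) b = - g x a (curv x u v b)"
proof -
  have "D (\<lambda>y. dg y v a b) x u = D (\<lambda>y. dg y u a b) x v"
    using symmetric_second_derivative[OF open_U assms smooth_g] .
  then show ?thesis using assms unfolding dg_dg[OF assms] by (simp add: curv_def)
qed

text \<open>The classical combination of four Bianchi identities, each leaving a different one of
  the four vectors in the last slot, with skew symmetry in the first and in the last pair.\<close>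

lemma curv_pair_sym:
  assumes "x \<in> U"
  shows "g x (curv x u v a) b = g x (curv x a b u) v"
proof -
  let ?R = "\<lambda>u v a b. g x (curv x u v a) b"
  have a: "?R u v a b = - ?R v u a b" for u v a b
    using curv_antisym[of x u v a] assms by simp
  have s: "?R u v a b = - ?R u v b a" for u v a b
    using curv_skew[OF assms] sym_g[OF assms] by metis
  have b: "?R u v a b + ?R v a u b + ?R a u v b = 0" for u v a b
    using bianchi[OF assms, of u v a] assms by (metis g_add(1) g_zero(1))
  show ?thesis
    using b[of v a u b] b[of a u b v] b[of u b v a] b[of b v a u]
      s[of v a u b] s[of a u v b] s[of u b a v] s[of b v u a] a[of v u b a] s[of u v a b]
      a[of a b v u] s[of b a u v] a[of b a u v]
    by linarith
qed

end

text \<open>Differentiating the isometry relation adds second derivatives of \<open>\<psi>\<close>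
  to \<open>dg\<close>. In the Koszul combination they cancel by symmetry except for the one along
  \<open>a\<close> and \<open>b\<close>, which is the inhomogeneous term. Surjectivity turns every
  test vector \<open>d'\<close> into an image.\<close>

lemma Gam_transform:
  fixes U U' V :: "'e::euclidean_space set"
  assumes "local_metric U g" "local_metric U' g'" and V: "open V" "V \<subseteq> U" "x \<in> V"
    and \<psi>: "\<psi> ` V \<subseteq> U'" "smooth_on \<psi> V"
    and iso: "\<And>y a b. y \<in> V \<Longrightarrow> g y a b = g' (\<psi> y) (D \<psi> y a) (D \<psi> y b)"
    and surj: "surj (D \<psi> x)"
  shows "D \<psi> x (local_metric.Gam U g x a b) =
    local_metric.Gam U' g' (\<psi> x) (D \<psi> x a) (D \<psi> x b) + D (\<lambda>y. D \<psi> y b) x a"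
proof -
  interpret L: local_metric U g by fact
  interpret L': local_metric U' g' by fact
  have x: "x \<in> U" "\<psi> x \<in> U'" using V \<psi> by auto
  let ?H = "\<lambda>u v. D (\<lambda>y. D \<psi> y v) x u"
  have sym: "?H u v = ?H v u" for u v
    using symmetric_second_derivative[OF V(1,3) \<psi>(2)] .
  have dg: "L.dg x u b d = L'.dg (\<psi> x) (D \<psi> x u) (D \<psi> x b) (D \<psi> x d)
      + g' (\<psi> x) (?H u b) (D \<psi> x d) + g' (\<psi> x) (D \<psi> x b) (?H u d)" for u b d
  proof -
    have "((\<lambda>y. g' (\<psi> y) (D \<psi> y b) (D \<psi> y d)) has_derivative
      (\<lambda>u. L'.dg (\<psi> x) (D \<psi> x u) (D \<psi> x b) (D \<psi> x d)
      + g' (\<psi> x) (?H u b) (D \<psi> x d) + g' (\<psi> x) (D \<psi> x b) (?H u d))) (at x)"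
      by (rule L'.g_has_derivative[where \<xi> = \<psi> and t = x, OF x(2)])
        (auto intro: smooth_on_has_derivative[OF _ V(3)] \<psi> smooth_on_D)
    then have "((\<lambda>y. g y b d) has_derivative
      (\<lambda>u. L'.dg (\<psi> x) (D \<psi> x u) (D \<psi> x b) (D \<psi> x d)
      + g' (\<psi> x) (?H u b) (D \<psi> x d) + g' (\<psi> x) (D \<psi> x b) (?H u d))) (at x)"
      by (rule has_derivative_transform_open[OF V(1,3)]) (rule iso)
    then show ?thesis by (rule D_eqI)
  qed
  show ?thesis
  proof (rule L'.g_nondegenerate[OF x(2)])
    fix d' obtain d where d: "d' = D \<psi> x d" using surj by auto
    have "g' (\<psi> x) (D \<psi> x (L.Gam x a b)) d' = L.koszul x a b d"
      unfolding d iso[OF V(3), symmetric] by (rule L.g_Gam[OF x(1)])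
    also have "\<dots> = L'.koszul (\<psi> x) (D \<psi> x a) (D \<psi> x b) d' + g' (\<psi> x) (?H a b) d'"
      using L'.sym_g[OF x(2)] sym
      by (simp add: L.koszul_def L'.koszul_def dg d sym[of b a] sym[of d a] sym[of d b] field_simps)
    also have "\<dots> = g' (\<psi> x) (L'.Gam (\<psi> x) (D \<psi> x a) (D \<psi> x b) + ?H a b) d'"
      using x by (simp add: L'.g_Gam)
    finally show "g' (\<psi> x) (D \<psi> x (L.Gam x a b)) d' =
      g' (\<psi> x) (L'.Gam (\<psi> x) (D \<psi> x a) (D \<psi> x b) + ?H a b) d'" .
  qed
qed


section \<open>Ordinary differential equations\<close>

text \<open>On the compact ball the derivatives in the basis directions are bounded, which bounds
  the operator norm; convexity gives the Lipschitz estimate. The summand 1 in \<open>L\<close> only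
  makes it positive.\<close>

lemma smooth_on_Lipschitz_cball:
  fixes F :: "'a::euclidean_space \<Rightarrow> 'b::real_normed_vector"
  assumes F: "smooth_on F W" and r: "cball z r \<subseteq> W"
  obtains L where "L > 0" "\<And>x y. x \<in> cball z r \<Longrightarrow> y \<in> cball z r \<Longrightarrow> norm (F x - F y) \<le> L * norm (x - y)"
proof -
  have "\<exists>C. \<forall>x\<in>cball z r. norm (D F x b) \<le> C" for b
  proof -
    have "continuous_on (cball z r) (\<lambda>x. D F x b)"
      using smooth_on_continuous[OF smooth_on_D[OF F]] continuous_on_subset r by blast
    then have "bounded ((\<lambda>x. D F x b) ` cball z r)"
      using compact_continuous_image compact_imp_bounded compact_cball by blast
    then show ?thesis unfolding bounded_iff by blast
  qed
  then obtain C where C: "\<And>b x. x \<in> cball z r \<Longrightarrow> norm (D F x b) \<le> C b" by metis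
  define L where "L = (\<Sum>b\<in>Basis. \<bar>C b\<bar>) + 1"
  have L: "L > 0" unfolding L_def by (intro add_nonneg_pos sum_nonneg) auto
  have on: "onorm (D F x) \<le> L" if x: "x \<in> cball z r" for x
  proof (rule onorm_le)
    fix v
    have lin: "linear (D F x)" using F x r smooth_on_differentiable linear_D by blast
    have "norm (D F x v) \<le> (\<Sum>b\<in>Basis. norm ((v \<bullet> b) *\<^sub>R D F x b))"
      unfolding linear_basis_expansion[OF lin, of v] by (rule norm_sum)
    also have "\<dots> \<le> (\<Sum>b\<in>Basis. norm v * \<bar>C b\<bar>)"
      using C[OF x] by (intro sum_mono) (auto intro!: mult_mono Basis_le_norm order_trans[OF _ abs_ge_self])
    also have "\<dots> \<le> L * norm v"
      by (simp add: L_def sum_distrib_right[symmetric] sum_distrib_left[symmetric] algebra_simps)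
    finally show "norm (D F x v) \<le> L * norm v" .
  qed
  have "norm (F x - F y) \<le> L * norm (x - y)" if "x \<in> cball z r" "y \<in> cball z r" for x y
  proof (rule differentiable_bound[OF convex_cball _ on that])
    fix x assume "x \<in> cball z r"
    then have "(F has_derivative D F x) (at x)" using smooth_on_has_derivative[OF F] r by blast
    then show "(F has_derivative D F x) (at x within cball z r)" by (rule has_derivative_at_withinI)
  qed
  with L show ?thesis using that by blast
qed

lemma ode_unique_local:
  fixes F :: "'a::euclidean_space \<Rightarrow> 'a"
  assumes W: "open W" "smooth_on F W" and J: "open J" "t0 \<in> J"
    and z: "\<And>t. t \<in> J \<Longrightarrow> z t \<in> W" "\<And>t. t \<in> J \<Longrightarrow> (z has_vector_derivative F (z t)) (at t)"
    and w: "\<And>t. t \<in> J \<Longrightarrow> w t \<in> W" "\<And>t. t \<in> J \<Longrightarrow> (w has_vector_derivative F (w t)) (at t)"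
    and eq: "z t0 = w t0"
  obtains \<delta> where "\<delta> > 0" "ball t0 \<delta> \<subseteq> J" "\<And>t. t \<in> ball t0 \<delta> \<Longrightarrow> z t = w t"
proof -
  obtain r where r: "r > 0" "cball (z t0) r \<subseteq> W"
    using W z(1)[OF J(2)] open_contains_cball by blast
  obtain L where L: "L > 0" "\<And>x y. x \<in> cball (z t0) r \<Longrightarrow> y \<in> cball (z t0) r \<Longrightarrow> norm (F x - F y) \<le> L * norm (x - y)"
    using smooth_on_Lipschitz_cball[OF W(2) r(2)] by metis
  have cz: "isCont z t0" "isCont w t0"
    using z(2)[OF J(2)] w(2)[OF J(2)] has_vector_derivative_continuous by blast+
  obtain d1 where d1: "d1 > 0" "\<And>t. dist t t0 < d1 \<Longrightarrow> dist (z t) (z t0) < r"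
    using cz(1) r(1) unfolding continuous_at_eps_delta by blast
  obtain d2 where d2: "d2 > 0" "\<And>t. dist t t0 < d2 \<Longrightarrow> dist (w t) (w t0) < r"
    using cz(2) r(1) unfolding continuous_at_eps_delta by blast
  obtain d3 where d3: "d3 > 0" "ball t0 d3 \<subseteq> J" using J openE by blast
  \<comment> \<open>The halves keep the closed ball strictly inside the radii \<open>d1\<close>,
    \<open>d2\<close>, \<open>d3\<close>; the last bound makes \<open>L * \<delta>\<close> at most
    one half.\<close>
  define \<delta> where "\<delta> = min (min (d1/2) (d2/2)) (min (d3/2) (1 / (2 * L)))"
  have \<delta>: "\<delta> > 0" "L * \<delta> \<le> 1/2" "cball t0 \<delta> \<subseteq> J"
  proof -
    show "\<delta> > 0" using d1 d2 d3 L by (simp add: \<delta>_def)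
    have "L * \<delta> \<le> L * (1 / (2 * L))" using L by (intro mult_left_mono) (auto simp: \<delta>_def)
    then show "L * \<delta> \<le> 1/2" using L by simp
    have "\<delta> < d3" using d3 by (simp add: \<delta>_def min_def)
    then show "cball t0 \<delta> \<subseteq> J" using d3(2) by auto
  qed
  have inb: "z t \<in> cball (z t0) r" "w t \<in> cball (z t0) r" if "t \<in> cball t0 \<delta>" for t
  proof -
    have "\<delta> < d1" "\<delta> < d2" using d1 d2 by (auto simp: \<delta>_def min_def)
    then have "dist t t0 < d1" "dist t t0 < d2" using that by (auto simp: dist_commute)
    then show "z t \<in> cball (z t0) r" "w t \<in> cball (z t0) r"
      using d1(2)[of t] d2(2)[of t] eq by (auto simp: dist_commute)
  qed
  let ?d = "\<lambda>t. z t - w t"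
  have dd: "(?d has_vector_derivative (F (z t) - F (w t))) (at t)" if "t \<in> cball t0 \<delta>" for t
    using that \<delta>(3) z(2) w(2) by (intro has_vector_derivative_diff) auto
  have "continuous_on (cball t0 \<delta>) (\<lambda>t. norm (?d t))"
    using dd by (intro continuous_on_norm continuous_at_imp_continuous_on ballI has_vector_derivative_continuous)
  \<comment> \<open>At a point of maximal distance the mean value estimate bounds the maximum by
    half of itself, so it is 0; this replaces a Gronwall inequality.\<close>
  then obtain t1 where t1: "t1 \<in> cball t0 \<delta>" "\<And>t. t \<in> cball t0 \<delta> \<Longrightarrow> norm (?d t) \<le> norm (?d t1)"
    using continuous_attains_sup[of "cball t0 \<delta>" "\<lambda>t. norm (?d t)"] \<delta>(1) by auto
  have on: "onorm (\<lambda>h. h *\<^sub>R (F (z t) - F (w t))) \<le> L * norm (?d t1)" if "t \<in> cball t0 \<delta>" for t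
  proof (rule onorm_le)
    fix h :: real
    have "norm (F (z t) - F (w t)) \<le> L * norm (?d t)" using L(2) inb[OF that] by blast
    also have "\<dots> \<le> L * norm (?d t1)" using t1(2)[OF that] L(1) by simp
    finally have "\<bar>h\<bar> * norm (F (z t) - F (w t)) \<le> \<bar>h\<bar> * (L * norm (?d t1))"
      by (rule mult_left_mono) simp
    then show "norm (h *\<^sub>R (F (z t) - F (w t))) \<le> L * norm (?d t1) * norm h"
      by (simp add: mult.commute)
  qed
  have "norm (?d t1 - ?d t0) \<le> L * norm (?d t1) * norm (t1 - t0)"
    by (rule differentiable_bound[OF convex_cball _ on t1(1)])
      (use dd \<delta>(1) in \<open>auto simp: has_vector_derivative_def intro: has_derivative_at_withinI\<close>)
  then have "norm (?d t1) \<le> L * norm (?d t1) * norm (t1 - t0)" using eq by simp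
  also have "\<dots> \<le> L * norm (?d t1) * \<delta>"
    using t1(1) L(1) by (intro mult_left_mono) (auto simp: dist_norm norm_minus_commute)
  also have "\<dots> = (L * \<delta>) * norm (?d t1)" by simp
  also have "\<dots> \<le> (1/2) * norm (?d t1)" using \<delta>(2) by (rule mult_right_mono) simp
  finally have "norm (?d t1) = 0" by simp
  then have "z t = w t" if "t \<in> cball t0 \<delta>" for t using t1(2)[OF that] by simp
  then show ?thesis using that[of \<delta>] \<delta> by fastforce
qed

text \<open>Picard iteration as a contraction on the type of all bounded continuous functions on the
  line. To act on the whole space, the vector field is made globally Lipschitz by projecting to a
  ball, and time is clamped to a compact interval.\<close>

lemma ode_exists_local:
  fixes F :: "'a::euclidean_space \<Rightarrow> 'a"
  assumes W: "open W" "smooth_on F W" "z0 \<in> W"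
  obtains \<epsilon> z where "\<epsilon> > 0" "z 0 = z0" "\<And>t. t \<in> {-\<epsilon><..<\<epsilon>} \<Longrightarrow> z t \<in> W"
    "\<And>t. t \<in> {-\<epsilon><..<\<epsilon>} \<Longrightarrow> (z has_vector_derivative F (z t)) (at t)"
proof -
  obtain r where r: "r > 0" "cball z0 r \<subseteq> W"
    using W open_contains_cball by blast
  obtain L where L: "L > 0" "\<And>x y. x \<in> cball z0 r \<Longrightarrow> y \<in> cball z0 r \<Longrightarrow> norm (F x - F y) \<le> L * norm (x - y)"
    using smooth_on_Lipschitz_cball[OF W(2) r(2)] by metis
  let ?B = "cball z0 r"
  define G where "G x = F (closest_point ?B x)" for x
  have cp: "closest_point ?B x \<in> ?B" for x
    using r(1) by (intro closest_point_in_set) auto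
  have GL: "norm (G x - G y) \<le> L * norm (x - y)" for x y
  proof -
    have "norm (G x - G y) \<le> L * norm (closest_point ?B x - closest_point ?B y)"
      unfolding G_def by (intro L(2) cp)
    also have "\<dots> \<le> L * norm (x - y)"
      using closest_point_lipschitz[of ?B x y] r(1) L(1) by (simp add: dist_norm)
    finally show ?thesis .
  qed
  have Gcont: "continuous_on UNIV G"
  proof -
    have "L-lipschitz_on UNIV G"
      using GL L(1) by (intro lipschitz_onI) (auto simp: dist_norm)
    then show ?thesis by (rule lipschitz_on_continuous_on)
  qed
  \<comment> \<open>Two images differ by integrals over intervals of length at most
    \<open>2 * e\<close> and \<open>e\<close>, so the contraction factor is
    \<open>3 * (e * L)\<close>, that is 1/2.\<close>
  define e where "e = 1 / (6 * L)"
  have e: "e > 0" "e * L = 1/6" using L(1) by (auto simp: e_def)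
  define C where "C t = max (-e) (min e t)" for t :: real
  have C: "-e \<le> C t" "C t \<le> e" "t \<in> {-e..e} \<Longrightarrow> C t = t" for t
    using e by (auto simp: C_def)
  have Ccont: "continuous_on UNIV C"
    unfolding C_def by (intro continuous_intros)
  have Gu: "continuous_on S (\<lambda>s. G (apply_bcontfun u s))" for u :: "real \<Rightarrow>\<^sub>C 'a" and S
    by (rule continuous_on_compose2[OF Gcont]) auto
  \<comment> \<open>Both integrals start at \<open>-e\<close>; their difference is the oriented
    integral from 0 to \<open>C t\<close>, also when \<open>C t\<close> is negative.\<close>
  define T0 where "T0 u t = z0 + integral {-e..C t} (\<lambda>s. G (apply_bcontfun u s))
      - integral {-e..0} (\<lambda>s. G (apply_bcontfun u s))" for u :: "real \<Rightarrow>\<^sub>C 'a" and t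
  have intc: "continuous_on {-e..e} (\<lambda>t. integral {-e..t} (\<lambda>s. G (apply_bcontfun u s)))" for u :: "real \<Rightarrow>\<^sub>C 'a"
    by (intro indefinite_integral_continuous_1 integrable_continuous_real Gu)
  have T0c: "continuous_on UNIV (T0 u)" for u
    unfolding T0_def
    by (intro continuous_intros continuous_on_compose2[OF intc Ccont]) (use C in auto)
  have T0b: "T0 u \<in> bcontfun" for u
  proof -
    have "T0 u t = T0 u (C t)" for t using C(1,2)[of t] C(3)[of "C t"] by (simp add: T0_def)
    then have "T0 u t \<in> T0 u ` {-e..e}" for t
      by (rule image_eqI[of _ _ "C t"]) (use C(1,2) in simp)
    then have "range (T0 u) \<subseteq> T0 u ` {-e..e}" by blast
    moreover have "bounded (T0 u ` {-e..e})"
      using compact_continuous_image[OF continuous_on_subset[OF T0c]] compact_imp_bounded compact_Icc by blast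
    ultimately show ?thesis
      using T0c bounded_subset by (auto simp: bcontfun_def)
  qed
  define T where "T u = Bcontfun (T0 u)" for u
  have T: "apply_bcontfun (T u) t = T0 u t" for u t
    using T0b by (simp add: T_def Bcontfun_inverse)
  have "\<exists>!u. T u = u"
  proof (rule banach_fix_type[of "1/2"])
    show "\<forall>u v. dist (T u) (T v) \<le> 1/2 * dist u v"
    proof (intro allI dist_bound)
      fix u v :: "real \<Rightarrow>\<^sub>C 'a" and t
      let ?h = "\<lambda>s. G (apply_bcontfun u s) - G (apply_bcontfun v s)"
      let ?I = "\<lambda>c f. integral {-e..c} f"
      have sub: "?I c (\<lambda>s. G (apply_bcontfun u s)) - ?I c (\<lambda>s. G (apply_bcontfun v s)) = ?I c ?h" for c
        by (intro integral_diff[symmetric] integrable_continuous_real Gu)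
      have h: "norm (?h s) \<le> L * dist u v" for s
      proof -
        have "norm (?h s) \<le> L * dist (apply_bcontfun u s) (apply_bcontfun v s)" using GL by (simp add: dist_norm)
        also have "\<dots> \<le> L * dist u v" using dist_bounded L(1) by (intro mult_left_mono) auto
        finally show ?thesis .
      qed
      have b: "norm (?I c ?h) \<le> L * dist u v * (c + e)" if "-e \<le> c" for c
      proof -
        have "norm (?I c ?h) \<le> L * dist u v * (c - -e)"
          by (rule integral_bound[OF that continuous_on_diff[OF Gu Gu]]) (rule h)
        then show ?thesis by simp
      qed
      have "dist (T u t) (T v t) = norm (?I (C t) ?h - ?I 0 ?h)"
        unfolding T T0_def dist_norm sub[symmetric] by (simp add: algebra_simps)
      also have "\<dots> \<le> norm (?I (C t) ?h) + norm (?I 0 ?h)" by (rule norm_triangle_ineq4)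
      also have "\<dots> \<le> L * dist u v * (C t + e) + L * dist u v * (0 + e)"
        using b[of "C t"] b[of 0] C(1)[of t] e by (intro add_mono) auto
      also have "\<dots> \<le> L * dist u v * (e + e) + L * dist u v * (0 + e)"
        using C(2)[of t] L(1) by (intro add_mono mult_left_mono) auto
      also have "\<dots> = 3 * (e * L) * dist u v" by (simp add: algebra_simps)
      finally show "dist (T u t) (T v t) \<le> 1/2 * dist u v" using e(2) by simp
    qed
  qed auto
  then obtain u where u: "T u = u" by blast
  define z where "z = apply_bcontfun u"
  have z: "z t = z0 + integral {-e..C t} (\<lambda>s. G (z s)) - integral {-e..0} (\<lambda>s. G (z s))" for t
    using T[of u t] unfolding u T0_def z_def .
  have zd: "(z has_vector_derivative G (z t)) (at t)" if t: "t \<in> {-e<..<e}" for t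
  proof -
    have "((\<lambda>t. integral {-e..t} (\<lambda>s. G (z s))) has_vector_derivative G (z t)) (at t within {-e..e})"
      using t unfolding z_def by (intro integral_has_vector_derivative Gu) auto
    then have "((\<lambda>t. integral {-e..t} (\<lambda>s. G (z s))) has_vector_derivative G (z t)) (at t)"
      using t at_within_interior[of t "{-e..e}"] by simp
    then have "((\<lambda>t. z0 + integral {-e..t} (\<lambda>s. G (z s)) - integral {-e..0} (\<lambda>s. G (z s)))
       has_vector_derivative G (z t)) (at t)"
      by (auto intro!: derivative_eq_intros)
    then show ?thesis
    proof (rule has_vector_derivative_transform_within_open[of _ _ _ "{-e<..<e}"])
      show "z0 + integral {-e..s} (\<lambda>s. G (z s)) - integral {-e..0} (\<lambda>s. G (z s)) = z s"
        if "s \<in> {-e<..<e}" for s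
        unfolding z[of s] using C(3)[of s] that by simp
    qed (use t in auto)
  qed
  have z00: "z 0 = z0" using z[of 0] C(3)[of 0] e by simp
  \<comment> \<open>For small times the fixed point stays in the ball, where the projection is the
    identity, so it solves the original equation.\<close>
  have "isCont z 0" using zd[of 0] e has_vector_derivative_continuous by auto
  then obtain d where d: "d > 0" "\<And>t. dist t 0 < d \<Longrightarrow> dist (z t) (z 0) < r"
    using r(1) unfolding continuous_at_eps_delta by blast
  have inB: "z t \<in> ?B" if "t \<in> {-min d e<..<min d e}" for t
  proof -
    have "\<bar>t\<bar> < d" using that by (auto simp: min_def split: if_splits)
    then have "dist (z t) (z 0) < r" using d(2)[of t] by simp
    then show ?thesis using z00 by (simp add: dist_commute)
  qed
  show ?thesis
  proof (rule that[of "min d e" z])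
    show "z t \<in> W" if "t \<in> {-min d e<..<min d e}" for t using inB[OF that] r by blast
    show "(z has_vector_derivative F (z t)) (at t)" if "t \<in> {-min d e<..<min d e}" for t
      using zd[of t] closest_point_self[OF inB[OF that]] that by (auto simp: G_def)
  qed (use d e z00 in auto)
qed

text \<open>Bootstrapping: if \<open>z\<close> has \<open>n\<close> continuous derivatives, so has
  \<open>F (z t)\<close>, which is the derivative of \<open>z\<close>.\<close>

lemma ode_solution_smooth:
  fixes F :: "'a::euclidean_space \<Rightarrow> 'a"
  assumes F: "smooth_on F W" and J: "open J"
    and z: "\<And>t. t \<in> J \<Longrightarrow> z t \<in> W" "\<And>t. t \<in> J \<Longrightarrow> (z has_vector_derivative F (z t)) (at t)"
  shows "smooth_on z J"
proof -
  have der: "(z has_derivative (\<lambda>h. h *\<^sub>R F (z t))) (at t)" if "t \<in> J" for t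
    using z(2)[OF that] by (simp add: has_vector_derivative_def)
  have "Ck_on n z J" for n
  proof (induction n)
    case 0
    then show ?case
      using has_derivative_continuous[OF der] by (auto intro: continuous_at_imp_continuous_on)
  next
    case (Suc n)
    have "Ck_on n (\<lambda>t. F (z t)) J"
      using Ck_on_compose[OF J Suc] F z(1) unfolding smooth_on_def by blast
    then have "Ck_on n (\<lambda>t. h *\<^sub>R F (z t)) J" for h
      by (intro Ck_on_bounded_bilinear[OF bounded_bilinear_scaleR J Ck_on_const])
    moreover have "Ck_on n (\<lambda>t. D z t h) J \<longleftrightarrow> Ck_on n (\<lambda>t. h *\<^sub>R F (z t)) J" for h
      using D_eqI[OF der] by (intro Ck_on_cong_open J) blast
    ultimately show ?case using der unfolding Ck_on.simps differentiable_def by blast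
  qed
  then show ?thesis by (simp add: smooth_on_def)
qed


section \<open>The identity in a chart\<close>

lemma smooth_on_D_apply:
  fixes f :: "'a::euclidean_space \<Rightarrow> 'b::real_normed_vector"
  assumes "smooth_on f S" "smooth_on V S" "open S"
  shows "smooth_on (\<lambda>x. D f x (V x)) S"
  by (rule smooth_on_linear_family[where L = "D f" and \<xi> = "\<lambda>x. x" and S = S])
    (use assms in \<open>auto intro: linear_D smooth_on_differentiable smooth_on_D\<close>)

lemma D_apply_has_derivative:
  fixes f :: "'a::euclidean_space \<Rightarrow> 'b::real_normed_vector"
  assumes "open S" "x \<in> S" "smooth_on f S" "(V has_derivative V') (at x)"
  shows "((\<lambda>y. D f y (V y)) has_derivative (\<lambda>h. D (\<lambda>y. D f y (V x)) x h + D f x (V' h))) (at x)"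
  by (rule has_derivative_linear_family[where L = "D f" and \<xi> = "\<lambda>x. x" and S = S and t = x])
    (use assms in \<open>auto intro: linear_D smooth_on_differentiable smooth_on_D has_derivative_ident\<close>)

lemma has_derivative_vec_lambda:
  fixes f :: "'k::finite \<Rightarrow> 'a::real_normed_vector \<Rightarrow> 'b::euclidean_space"
  assumes "\<And>l. (f l has_derivative f' l) (at x)"
  shows "((\<lambda>x. \<chi> l. f l x) has_derivative (\<lambda>h. \<chi> l. f' l h)) (at x)"
  unfolding vec_lambda_as_sum_axis
  by (intro has_derivative_sum bounded_linear.has_derivative[OF bounded_linear_axis] assms)

text \<open>The velocity of the curve that adds \<open>t\<close> times \<open>w\<close> to the
  \<open>l\<close>-th vector; the direction behind the vertical derivatives.\<close>

definition vlift :: "'k::finite \<Rightarrow> 'e::euclidean_space \<Rightarrow> 'e \<times> ('e ^ 'k)" where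
  "vlift l w = (0, axis l w)"

lemma fst_vlift [simp]: "fst (vlift l w) = 0"
  and snd_vlift: "snd (vlift l w) $ m = (if m = l then w else 0)"
  by (simp_all add: vlift_def axis_def)

lemma linear_vlift: "linear (vlift l)"
  by (rule linearI) (auto simp: vlift_def axis_def vec_eq_iff)

text \<open>Here \<open>\<phi>\<close> stands for the coordinate expression, in one chart, of a
  function on the bundle of tuples.\<close>

locale chart_function = local_metric U g for U :: "'e::euclidean_space set" and g +
  fixes \<phi> :: "'e \<times> ('e ^ 'k::finite) \<Rightarrow> real"
  assumes smooth_phi: "smooth_on \<phi> (U \<times> UNIV)"
begin

abbreviation TU :: "('e \<times> ('e ^ 'k)) set" where
  "TU \<equiv> U \<times> UNIV"

lemma open_TU: "open TU"
  by (simp add: open_U open_Times)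

text \<open>In a chart, \<open>hlift z u\<close> is the velocity of \<open>f\<^sub>u\<close> at time \<open>0\<close>; \<open>hg\<close>, \<open>vg l\<close>, \<open>fd i\<close>, \<open>nab\<close>, \<open>Yc j i\<close>
  and \<open>Zc i\<close> are the components of \<open>grad\<^sup>h \<phi>\<close>, \<open>grad\<^sup>v\<^sup>,\<^sup>l \<phi>\<close>, \<open>G\<^sup>i \<phi>\<close>, \<open>\<nabla>\<^sup>h\<close>, \<open>Y\<^sup>j\<^sup>,\<^sup>i\<close> and \<open>Z\<^sup>i\<close>.\<close>

definition hlift :: "'e \<times> ('e ^ 'k) \<Rightarrow> 'e \<Rightarrow> 'e \<times> ('e ^ 'k)" where
  "hlift z u = (u, \<chi> l. - Gam (fst z) u (snd z $ l))"

lemma linear_hlift: "fst z \<in> U \<Longrightarrow> linear (hlift z)"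
  by (rule linearI) (auto simp: hlift_def vec_eq_iff)

lemma linear_D_phi: "z \<in> TU \<Longrightarrow> linear (D \<phi> z)"
  using linear_D smooth_on_differentiable smooth_phi by blast

definition hg :: "'e \<times> ('e ^ 'k) \<Rightarrow> 'e" where
  "hg z = sharp (fst z) (\<lambda>u. D \<phi> z (hlift z u))"

definition vg :: "'k \<Rightarrow> 'e \<times> ('e ^ 'k) \<Rightarrow> 'e" where
  "vg l z = sharp (fst z) (\<lambda>w. D \<phi> z (vlift l w))"

definition fd :: "'k \<Rightarrow> 'e \<times> ('e ^ 'k) \<Rightarrow> real" where
  "fd i z = D \<phi> z (hlift z (snd z $ i))"

lemma linear_horizontal: "z \<in> TU \<Longrightarrow> linear (\<lambda>u. D \<phi> z (hlift z u))"
  using linear_compose[OF linear_hlift linear_D_phi] by (auto simp: o_def)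

lemma linear_vertical: "z \<in> TU \<Longrightarrow> linear (\<lambda>u. D \<phi> z (vlift l u))"
  using linear_compose[OF linear_vlift linear_D_phi] by (auto simp: o_def)

lemma g_hg: "z \<in> TU \<Longrightarrow> g (fst z) (hg z) u = D \<phi> z (hlift z u)"
  unfolding hg_def by (rule g_sharp) (auto simp: linear_horizontal)

lemma g_vg: "z \<in> TU \<Longrightarrow> g (fst z) (vg l z) w = D \<phi> z (vlift l w)"
  unfolding vg_def by (rule g_sharp) (auto simp: linear_vertical)

lemma fd_eq: "z \<in> TU \<Longrightarrow> fd i z = g (fst z) (hg z) (snd z $ i)"
  by (simp add: fd_def g_hg)

lemma smooth_hlift: "smooth_on (\<lambda>z. hlift z u) TU"
  unfolding hlift_def
  by (intro smooth_intros smooth_on_Gam open_TU) auto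

lemma smooth_hg: "smooth_on hg TU"
  unfolding hg_def
  by (intro smooth_on_sharp smooth_on_D_apply smooth_hlift smooth_phi smooth_intros open_TU linear_horizontal) auto

lemma smooth_vg: "smooth_on (vg l) TU"
  unfolding vg_def
  by (intro smooth_on_sharp smooth_on_D_apply smooth_phi smooth_intros open_TU linear_vertical) auto

lemma smooth_fd: "smooth_on (fd i) TU"
proof (rule smooth_on_transform[OF open_TU])
  show "smooth_on (\<lambda>z. g (fst z) (hg z) (snd z $ i)) TU"
    by (intro smooth_on_g smooth_intros smooth_hg open_TU) auto
qed (rule fd_eq)

section \<open>Derivatives of the gradients\<close>

definition nab :: "('e \<times> ('e ^ 'k) \<Rightarrow> 'e) \<Rightarrow> 'e \<times> ('e ^ 'k) \<Rightarrow> 'e \<Rightarrow> 'e" where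
  "nab X z u = D X z (hlift z u) + Gam (fst z) u (X z)"

abbreviation hess :: "'e \<times> ('e ^ 'k) \<Rightarrow> 'e \<times> ('e ^ 'k) \<Rightarrow> 'e \<times> ('e ^ 'k) \<Rightarrow> real" where
  "hess z p q \<equiv> D (\<lambda>y. D \<phi> y q) z p"

lemma hess_sym: "z \<in> TU \<Longrightarrow> hess z p q = hess z q p"
  using symmetric_second_derivative[OF open_TU _ smooth_phi] .

lemma fst_has_derivative: "(fst has_derivative fst) (at z)"
  by (rule bounded_linear_imp_has_derivative[OF bounded_linear_fst])

lemma tuple_has_derivative: "((\<lambda>z. snd z $ l) has_derivative (\<lambda>h. snd h $ l)) (at (z :: 'e \<times> ('e ^ 'k)))"
  by (rule bounded_linear_imp_has_derivative[OF bounded_linear_compose[OF bounded_linear_vec_nth bounded_linear_snd]])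

lemma hlift_has_derivative:
  assumes "z \<in> TU"
  shows "((\<lambda>z. hlift z u) has_derivative
    (\<lambda>h. (0, \<chi> l. - (dGam (fst z) (fst h) u (snd z $ l) + Gam (fst z) u (snd h $ l))))) (at z)"
proof -
  have u: "((\<lambda>z. u) has_derivative (\<lambda>h. 0)) (at z)" for z :: "'e \<times> ('e ^ 'k)"
    by (rule has_derivative_const)
  have x: "fst z \<in> U" using assms by auto
  have "((\<lambda>z. Gam (fst z) u (snd z $ l)) has_derivative
    (\<lambda>h. dGam (fst z) (fst h) u (snd z $ l) + Gam (fst z) u (snd h $ l))) (at z)" for l
    using Gam_has_derivative[of fst z, OF x fst_has_derivative u tuple_has_derivative[of l]] x by simp
  then show ?thesis
    unfolding hlift_def
    by (intro has_derivative_Pair has_derivative_vec_lambda has_derivative_minus has_derivative_const)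
qed

text \<open>The direction \<open>hlift z u\<close> itself moves with \<open>z\<close>, so its
  derivative joins the second derivative of \<open>\<phi>\<close>. This extra term carries all the
  geometry.\<close>

lemma D_horizontal:
  assumes "z \<in> TU"
  shows "D (\<lambda>z. D \<phi> z (hlift z u)) z h = hess z h (hlift z u) +
    D \<phi> z (0, \<chi> l. - (dGam (fst z) (fst h) u (snd z $ l) + Gam (fst z) u (snd h $ l)))"
  by (rule D_eqI, rule D_apply_has_derivative[OF open_TU assms smooth_phi hlift_has_derivative[OF assms]])

lemma D_pairing:
  assumes z: "z \<in> TU" and X: "(X has_derivative X') (at z)" and Y: "(Y has_derivative Y') (at z)"
  shows "D (\<lambda>z. g (fst z) (X z) (Y z)) z h =
    dg (fst z) (fst h) (X z) (Y z) + g (fst z) (X' h) (Y z) + g (fst z) (X z) (Y' h)"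
  by (rule D_eqI, rule g_has_derivative[OF _ fst_has_derivative X Y]) (use z in auto)

text \<open>The derivative of the metric along \<open>u\<close> is absorbed by metric compatibility,
  which completes both ordinary derivatives to covariant ones.\<close>

lemma D_pairing_horizontal:
  assumes z: "z \<in> TU" and X: "smooth_on X TU" and Y: "(Y has_derivative Y') (at z)"
  shows "D (\<lambda>z. g (fst z) (X z) (Y z)) z (hlift z u) =
    g (fst z) (nab X z u) (Y z) + g (fst z) (X z) (Y' (hlift z u) + Gam (fst z) u (Y z))"
proof -
  have x: "fst z \<in> U" using z by auto
  show ?thesis
    unfolding D_pairing[OF z smooth_on_has_derivative[OF X z] Y] nab_def
    using x by (simp add: metric_compatible hlift_def)
qed

lemma D_pairing_vertical:
  assumes z: "z \<in> TU" and X: "smooth_on X TU" and Y: "(Y has_derivative Y') (at z)"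
  shows "D (\<lambda>z. g (fst z) (X z) (Y z)) z (vlift j w) =
    g (fst z) (D X z (vlift j w)) (Y z) + g (fst z) (X z) (Y' (vlift j w))"
proof -
  have x: "fst z \<in> U" using z by auto
  show ?thesis
    unfolding D_pairing[OF z smooth_on_has_derivative[OF X z] Y]
    using x linear_0[OF linear_dg(1)[OF x]] by simp
qed

lemma D_hg:
  assumes "z \<in> TU"
  shows "D (\<lambda>z. g (fst z) (hg z) u) z h = hess z h (hlift z u) +
    D \<phi> z (0, \<chi> l. - (dGam (fst z) (fst h) u (snd z $ l) + Gam (fst z) u (snd h $ l)))"
  using D_cong_open[OF open_TU assms g_hg] D_horizontal[OF assms] by simp

lemma D_vg:
  assumes "z \<in> TU"
  shows "D (\<lambda>z. g (fst z) (vg l z) w) z h = hess z h (vlift l w)"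
  using D_cong_open[OF open_TU assms g_vg] by simp

text \<open>After swapping the second derivatives of \<open>\<phi>\<close>, the vertical derivative
  of the horizontal lift remains. It is minus the vertical lift of \<open>Gam\<close> at
  \<open>u\<close> and \<open>w\<close>, exactly the correction that makes the derivative of
  \<open>vg j\<close> covariant.\<close>

lemma commute_horizontal_vertical:
  assumes z: "z \<in> TU"
  shows "g (fst z) (D hg z (vlift j w)) u = g (fst z) (nab (vg j) z u) w"
proof -
  have x: "fst z \<in> U" using z by auto
  have "g (fst z) (D hg z (vlift j w)) u = D (\<lambda>z. g (fst z) (hg z) u) z (vlift j w)"
    using D_pairing_vertical[OF z smooth_hg has_derivative_const] x by simp
  also have "\<dots> = hess z (vlift j w) (hlift z u) + D \<phi> z (- vlift j (Gam (fst z) u w))"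
  proof -
    have "(0, \<chi> l. - (dGam (fst z) (fst (vlift j w)) u (snd z $ l) + Gam (fst z) u (snd (vlift j w) $ l)))
      = - vlift j (Gam (fst z) u w)"
      using x linear_0[OF linear_D[OF smooth_on_differentiable[OF smooth_Gam x]]]
      by (simp add: vlift_def axis_def vec_eq_iff)
    then show ?thesis unfolding D_hg[OF z] by simp
  qed
  also have "\<dots> = hess z (hlift z u) (vlift j w) - g (fst z) (vg j z) (Gam (fst z) u w)"
    using hess_sym[OF z] linear_D_phi[OF z] g_vg[OF z] by (simp add: linear_neg)
  also have "\<dots> = g (fst z) (nab (vg j) z u) w"
    using D_pairing_horizontal[OF z smooth_vg has_derivative_const, of j w u] D_vg[OF z] by simp
  finally show ?thesis .
qed

text \<open>\<open>fd i\<close> pairs \<open>hg\<close> with the \<open>i\<close>-th vector, which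
  depends on the \<open>j\<close>-th slot only for \<open>i = j\<close>; this is where the Kronecker
  delta of the identity originates.\<close>

lemma D_fd_vertical:
  assumes z: "z \<in> TU"
  shows "D (fd i) z (vlift j w) = g (fst z) (nab (vg j) z (snd z $ i)) w + (if i = j then g (fst z) (hg z) w else 0)"
proof -
  have x: "fst z \<in> U" using z by auto
  have "D (fd i) z = D (\<lambda>z. g (fst z) (hg z) (snd z $ i)) z"
    by (rule D_cong_open[OF open_TU z fd_eq])
  then show ?thesis
    using D_pairing_vertical[OF z smooth_hg tuple_has_derivative, of i j w] x
    by (simp add: commute_horizontal_vertical[OF z] snd_vlift)
qed

text \<open>The \<open>i\<close>-th vector is parallel along horizontal directions, so only the
  derivative of \<open>hg\<close> contributes.\<close>

lemma D_fd_horizontal: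
  assumes z: "z \<in> TU"
  shows "D (fd i) z (hlift z u) = g (fst z) (nab hg z u) (snd z $ i)"
proof -
  have x: "fst z \<in> U" using z by auto
  have "D (fd i) z = D (\<lambda>z. g (fst z) (hg z) (snd z $ i)) z"
    by (rule D_cong_open[OF open_TU z fd_eq])
  then show ?thesis
    using D_pairing_horizontal[OF z smooth_hg tuple_has_derivative, of i u] x
    by (simp add: hlift_def)
qed

text \<open>Second derivatives of \<open>\<phi>\<close> and the terms in \<open>Gam\<close> at
  \<open>u\<close> and \<open>v\<close> are symmetric. What survives is the derivative of
  \<open>\<phi>\<close> along the bracket of the horizontal lifts, which is vertical with components
  minus the curvature.\<close>

lemma nab_hg_antisym:
  assumes z: "z \<in> TU"
  shows "g (fst z) (nab hg z u) v - g (fst z) (nab hg z v) u =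
    - (\<Sum>l\<in>UNIV. g (fst z) (vg l z) (curv (fst z) u v (snd z $ l)))"
proof -
  have x: "fst z \<in> U" using z by auto
  \<comment> \<open>\<open>?K u v\<close> is the derivative of the horizontal lift of
    \<open>v\<close> in the direction \<open>hlift z u\<close>.\<close>
  let ?K = "\<lambda>u v. (0, \<chi> l. - (dGam (fst z) u v (snd z $ l) - Gam (fst z) v (Gam (fst z) u (snd z $ l)))) :: 'e \<times> ('e ^ 'k)"
  have n: "g (fst z) (nab hg z u) v + g (fst z) (hg z) (Gam (fst z) u v) =
    hess z (hlift z u) (hlift z v) + D \<phi> z (?K u v)" for u v
    using D_pairing_horizontal[OF z smooth_hg has_derivative_const, of v u] D_hg[OF z, of v "hlift z u"] x
    by (simp add: hlift_def)
  have "?K u v - ?K v u = - (\<Sum>l\<in>UNIV. vlift l (curv (fst z) u v (snd z $ l)))"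
  proof -
    have "(\<Sum>l\<in>UNIV. vlift l (c l)) = (0, \<chi> l. c l)" for c :: "'k \<Rightarrow> 'e"
      unfolding vlift_def sum_prod vec_lambda_as_sum_axis by simp
    then show ?thesis by (simp add: vec_eq_iff curv_def)
  qed
  moreover note linear_diff[OF linear_D_phi[OF z], of "?K u v" "?K v u"]
  ultimately have "D \<phi> z (?K u v) - D \<phi> z (?K v u) =
      D \<phi> z (- (\<Sum>l\<in>UNIV. vlift l (curv (fst z) u v (snd z $ l))))"
    by (simp only:)
  also have "\<dots> = - (\<Sum>l\<in>UNIV. D \<phi> z (vlift l (curv (fst z) u v (snd z $ l))))"
    by (simp add: linear_neg[OF linear_D_phi[OF z]] linear_sum[OF linear_D_phi[OF z]])
  finally show ?thesis
    using n[of u v] n[of v u] hess_sym[OF z, of "hlift z u" "hlift z v"] Gam_sym[OF x, of u v] g_vg[OF z]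
    by simp
qed

section \<open>The fields of the identity and their divergences in a chart\<close>

definition Yc :: "'k \<Rightarrow> 'k \<Rightarrow> 'e \<times> ('e ^ 'k) \<Rightarrow> 'e" where
  "Yc j i z = g (fst z) (hg z) (vg j z) *\<^sub>R (snd z $ i) - fd i z *\<^sub>R vg j z"

definition Zc :: "'k \<Rightarrow> 'e \<times> ('e ^ 'k) \<Rightarrow> 'e" where
  "Zc i z = fd i z *\<^sub>R hg z"

lemma smooth_Yc: "smooth_on (Yc j i) TU"
  unfolding Yc_def by (intro smooth_intros smooth_on_g smooth_hg smooth_vg smooth_fd open_TU) auto

lemma smooth_Zc: "smooth_on (Zc i) TU"
  unfolding Zc_def by (intro smooth_intros smooth_hg smooth_fd open_TU)

lemma D_Zc:
  assumes "z \<in> TU"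
  shows "D (Zc i) z h = fd i z *\<^sub>R D hg z h + D (fd i) z h *\<^sub>R hg z"
  unfolding Zc_def
  by (rule D_eqI, rule has_derivative_scaleR) (intro smooth_on_has_derivative[OF _ assms] smooth_fd smooth_hg)+

lemma nab_Yc:
  assumes z: "z \<in> TU"
  shows "nab (Yc j i) z u = (g (fst z) (nab hg z u) (vg j z) + g (fst z) (hg z) (nab (vg j) z u)) *\<^sub>R (snd z $ i)
    - (fd i z *\<^sub>R nab (vg j) z u + g (fst z) (nab hg z u) (snd z $ i) *\<^sub>R vg j z)"
proof -
  have x: "fst z \<in> U" using z by auto
  let ?s = "\<lambda>z. g (fst z) (hg z) (vg j z)"
  have s: "(?s has_derivative D ?s z) (at z)"
    by (intro smooth_on_has_derivative[OF _ z] smooth_on_g smooth_intros smooth_hg smooth_vg open_TU) auto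
  have Y: "D (Yc j i) z h = (?s z *\<^sub>R (snd h $ i) + D ?s z h *\<^sub>R (snd z $ i)) - (fd i z *\<^sub>R D (vg j) z h + D (fd i) z h *\<^sub>R vg j z)" for h
    unfolding Yc_def
    by (rule D_eqI)
      (intro has_derivative_diff has_derivative_scaleR tuple_has_derivative s
        smooth_on_has_derivative[OF _ z] smooth_vg smooth_fd)
  have S: "D ?s z (hlift z u) = g (fst z) (nab hg z u) (vg j z) + g (fst z) (hg z) (nab (vg j) z u)"
    unfolding nab_def[of "vg j"]
    by (rule D_pairing_horizontal[OF z smooth_hg smooth_on_has_derivative[OF smooth_vg z]])
  have h: "snd (hlift z u) $ i = - Gam (fst z) u (snd z $ i)"
    by (simp add: hlift_def)
  have V: "fd i z *\<^sub>R nab (vg j) z u = fd i z *\<^sub>R D (vg j) z (hlift z u) + fd i z *\<^sub>R Gam (fst z) u (vg j z)"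
    by (simp add: nab_def scaleR_add_right)
  show ?thesis
    unfolding nab_def[of "Yc j i"] Y S h D_fd_horizontal[OF z] V Yc_def using x by simp
qed

lemma linear_nab:
  assumes "z \<in> TU" "smooth_on X TU"
  shows "linear (nab X z)"
proof -
  have x: "fst z \<in> U" using assms by auto
  have "linear (\<lambda>u. D X z (hlift z u))"
    using linear_compose[OF linear_hlift[OF x] linear_D[OF smooth_on_differentiable[OF assms(2,1)]]] by (simp add: o_def)
  moreover have "linear (\<lambda>u. Gam (fst z) u (X z))"
    using bilinear_Gam[OF x] by (simp add: bilinear_def)
  ultimately show ?thesis
    unfolding nab_def by (rule linear_compose_add)
qed

theorem frame_flow_identity_in_chart:
  assumes z: "z \<in> TU" and B: "finite B" "card B = DIM('e)"
    and on: "\<And>u v. u \<in> B \<Longrightarrow> v \<in> B \<Longrightarrow> g (fst z) u v = (if u = v then 1 else 0)"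
  shows "(\<Sum>e\<in>B. g (fst z) (D (Zc i) z (vlift j e)) e) + (\<Sum>e\<in>B. g (fst z) (nab (Yc j i) z e) e)
      + (if i = j then 1 else 0) * g (fst z) (hg z) (hg z)
    = (\<Sum>l\<in>UNIV. g (fst z) (curv (fst z) (vg l z) (snd z $ l) (snd z $ i)) (vg j z))
      + 2 * D (fd i) z (vlift j (hg z))"
proof -
  have x: "fst z \<in> U" using z by auto
  note lin = linear_nab[OF z smooth_hg] linear_nab[OF z smooth_vg]
  \<comment> \<open>Every term of the divergences with a linear form in \<open>e\<close> times a
    component of a fixed vector collapses to the form evaluated at that vector.\<close>
  have trace: "(\<Sum>e\<in>B. k e * g (fst z) v e) = k v" if "linear k" for k :: "'e \<Rightarrow> real" and v
  proof -
    have "k v = k (\<Sum>e\<in>B. g (fst z) v e *\<^sub>R e)"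
      using orthonormal_expansion[OF bilinear_g[OF x] B on] by metis
    then show ?thesis using that by (simp add: linear_sum linear_cmul mult.commute)
  qed
  have l1: "linear (\<lambda>e. D (fd i) z (vlift j e))"
    using linear_compose[OF linear_vlift linear_D[OF smooth_on_differentiable[OF smooth_fd z]]] by (simp add: o_def)
  have l2: "linear (\<lambda>e. g (fst z) (nab X z e) b)" if "smooth_on X TU" for X b
    using linear_compose[OF linear_nab[OF z that] linear_g_left[OF x]] by (simp add: o_def)
  have l3: "linear (\<lambda>e. g (fst z) b (nab X z e))" if "smooth_on X TU" for X b
    using linear_compose[OF linear_nab[OF z that] linear_g_right[OF x]] by (simp add: o_def)
  let ?T = "\<Sum>e\<in>B. g (fst z) (nab (vg j) z e) e"
  \<comment> \<open>With both arguments equal to \<open>e\<close>,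
    \<open>commute_horizontal_vertical\<close> turns the vertical divergence of \<open>hg\<close>
    into \<open>?T\<close>, the horizontal divergence of \<open>vg j\<close>; fact \<open>2\<close>
    contains it with the opposite sign.\<close>
  have 1: "(\<Sum>e\<in>B. g (fst z) (D (Zc i) z (vlift j e)) e) = fd i z * ?T + D (fd i) z (vlift j (hg z))"
    using trace[OF l1, of "hg z"] x
    by (simp add: D_Zc[OF z] commute_horizontal_vertical[OF z] sum.distrib sum_distrib_left)
  have 2: "(\<Sum>e\<in>B. g (fst z) (nab (Yc j i) z e) e) =
    g (fst z) (nab hg z (snd z $ i)) (vg j z) + g (fst z) (hg z) (nab (vg j) z (snd z $ i))
    - (fd i z * ?T + g (fst z) (nab hg z (vg j z)) (snd z $ i))"
    using trace[OF l2[OF smooth_hg], of "vg j z" "snd z $ i"] trace[OF l3[OF smooth_vg], of "hg z" j "snd z $ i"]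
      trace[OF l2[OF smooth_hg], of "snd z $ i" "vg j z"] x
    by (simp add: nab_Yc[OF z] sum.distrib sum_subtractf sum_distrib_left distrib_right mult.assoc)
  \<comment> \<open>The delta term completes the mixed derivative from fact \<open>2\<close> to a
    second copy of the term already found in fact \<open>1\<close>, whence the factor 2.\<close>
  have 3: "g (fst z) (hg z) (nab (vg j) z (snd z $ i)) + (if i = j then 1 else 0) * g (fst z) (hg z) (hg z)
    = D (fd i) z (vlift j (hg z))"
    using D_fd_vertical[OF z, of i j "hg z"] sym_g[OF x] by simp
  \<comment> \<open>Pair symmetry and skew symmetry bring the curvature into the order produced by
    \<open>nab_hg_antisym\<close>; the two minus signs cancel.\<close>
  have 4: "g (fst z) (curv (fst z) (vg l z) (snd z $ l) (snd z $ i)) (vg j z)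
    = - g (fst z) (vg l z) (curv (fst z) (snd z $ i) (vg j z) (snd z $ l))" for l
    using curv_pair_sym[OF x, of "vg l z" "snd z $ l" "snd z $ i" "vg j z"]
      curv_skew[OF x, of "snd z $ i" "vg j z" "vg l z" "snd z $ l"] by simp
  show ?thesis
    using 1 2 3 nab_hg_antisym[OF z, of "snd z $ i" "vg j z"] by (simp add: 4 sum_negf)
qed

end


section \<open>Charts of a Riemannian manifold\<close>

lemma has_vector_derivative_linear_family:
  fixes L :: "'a::real_normed_vector \<Rightarrow> 'f::euclidean_space \<Rightarrow> 'b::real_normed_vector"
  assumes S: "open S" "x t \<in> S" and lin: "\<And>y. y \<in> S \<Longrightarrow> linear (L y)"
    and dif: "\<And>b. (\<lambda>y. L y b) differentiable (at (x t))"
    and x: "(x has_vector_derivative x') (at t)" and a: "(a has_vector_derivative a') (at t)"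
  shows "((\<lambda>s. L (x s) (a s)) has_vector_derivative (D (\<lambda>y. L y (a t)) (x t) x' + L (x t) a')) (at t)"
proof -
  have "((\<lambda>s. L (x s) (a s)) has_derivative
      (\<lambda>h. D (\<lambda>y. L y (a t)) (x t) (h *\<^sub>R x') + L (x t) (h *\<^sub>R a'))) (at t)"
    by (rule has_derivative_linear_family[where S = S and \<xi> = x and t = t and L = L, OF S lin dif])
      (use x a in \<open>auto simp: has_vector_derivative_def\<close>)
  moreover have "D (\<lambda>y. L y (a t)) (x t) (h *\<^sub>R x') + L (x t) (h *\<^sub>R a') =
      h *\<^sub>R (D (\<lambda>y. L y (a t)) (x t) x' + L (x t) a')" for h
    using linear_cmul[OF linear_D[OF dif]] linear_cmul[OF lin[OF S(2)]] by (simp add: scaleR_add_right)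
  ultimately show ?thesis by (simp add: has_vector_derivative_def)
qed

lemma has_vector_derivative_compose_D:
  assumes "(x has_vector_derivative x') (at t)" "f differentiable (at (x t))"
  shows "((\<lambda>s. f (x s)) has_vector_derivative D f (x t) x') (at t)"
proof -
  have "((\<lambda>s. f (x s)) has_derivative (\<lambda>h. D f (x t) (h *\<^sub>R x'))) (at t)"
    by (rule has_derivative_compose[OF assms(1)[unfolded has_vector_derivative_def] has_derivative_D[OF assms(2)]])
  then show ?thesis
    using linear_cmul[OF linear_D[OF assms(2)]] by (simp add: has_vector_derivative_def)
qed

lemma isCont_open_preimage:
  fixes x :: "real \<Rightarrow> 'a::metric_space"
  assumes "isCont x t" "open S" "x t \<in> S" "open I" "t \<in> I"
  obtains \<delta> where "\<delta> > 0" "ball t \<delta> \<subseteq> I" "\<And>s. s \<in> ball t \<delta> \<Longrightarrow> x s \<in> S"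
proof -
  obtain e where e: "e > 0" "ball (x t) e \<subseteq> S" using assms openE by blast
  obtain d where d: "d > 0" "\<And>s. dist s t < d \<Longrightarrow> dist (x s) (x t) < e"
    using assms(1) e(1) unfolding continuous_at_eps_delta by blast
  obtain d' where d': "d' > 0" "ball t d' \<subseteq> I" using assms openE by blast
  show ?thesis
    by (rule that[of "min d d'"]) (use d d' e in \<open>force simp: dist_commute\<close>)+
qed

locale riemannian =
  fixes M :: "('a, 'e::euclidean_space) manifold"
  assumes riem: "riemannian_manifold M"
begin

lemma smooth_manifold: "smooth_manifold M"
  using riem by (simp add: riemannian_manifold_def)

lemma Hausdorff_M: "Hausdorff_space (mtop M)"
  using smooth_manifold by (simp add: smooth_manifold_def)

lemma chart_open:
  assumes "c \<in> atlas M"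
  shows "openin (mtop M) (fst c)" "open (chart_image c)"
    "homeomorphic_map (subtopology (mtop M) (fst c)) (top_of_set (chart_image c)) (snd c)"
  using smooth_manifold assms by (auto simp: smooth_manifold_def)

lemma topspace_chart: "c \<in> atlas M \<Longrightarrow> topspace (subtopology (mtop M) (fst c)) = fst c"
  using openin_subset[OF chart_open(1)] by (simp add: topspace_subtopology Int_absorb1)

lemma inj_on_chart: "c \<in> atlas M \<Longrightarrow> inj_on (snd c) (fst c)"
  using homeomorphic_imp_injective_map[OF chart_open(3)] topspace_chart by metis

lemma chart_inv_chart [simp]: "c \<in> atlas M \<Longrightarrow> p \<in> fst c \<Longrightarrow> chart_inv c (snd c p) = p"
  unfolding chart_inv_def by (rule inv_into_f_f[OF inj_on_chart])

lemma chart_chart_inv [simp]: "x \<in> chart_image c \<Longrightarrow> snd c (chart_inv c x) = x"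
  unfolding chart_inv_def chart_image_def by (rule f_inv_into_f)

lemma chart_inv_in [simp]: "x \<in> chart_image c \<Longrightarrow> chart_inv c x \<in> fst c"
  unfolding chart_inv_def chart_image_def by (rule inv_into_into)

lemma chart_in_image [simp]: "p \<in> fst c \<Longrightarrow> snd c p \<in> chart_image c"
  by (simp add: chart_image_def)

lemma chart_subset: "c \<in> atlas M \<Longrightarrow> p \<in> fst c \<Longrightarrow> p \<in> topspace (mtop M)"
  using openin_subset[OF chart_open(1)] by blast

lemma continuous_chart_inv:
  assumes "c \<in> atlas M"
  shows "continuous_map (top_of_set (chart_image c)) (mtop M) (chart_inv c)"
proof -
  obtain h where h: "homeomorphic_maps (subtopology (mtop M) (fst c)) (top_of_set (chart_image c)) (snd c) h"
    using chart_open(3)[OF assms] homeomorphic_map_maps by blast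
  then have c: "continuous_map (top_of_set (chart_image c)) (subtopology (mtop M) (fst c)) h"
    and inv: "\<And>x. x \<in> fst c \<Longrightarrow> h (snd c x) = x"
    unfolding homeomorphic_maps_def topspace_chart[OF assms] by auto
  have "continuous_map (top_of_set (chart_image c)) (mtop M) h"
    using c continuous_map_in_subtopology by blast
  moreover have "h x = chart_inv c x" if "x \<in> chart_image c" for x
    using inv[of "chart_inv c x"] that by simp
  ultimately show ?thesis by (rule continuous_map_eq) auto
qed

section \<open>Transition maps and change of components\<close>

abbreviation transition :: "('a, 'e) chart \<Rightarrow> ('a, 'e) chart \<Rightarrow> 'e \<Rightarrow> 'e" where
  "transition c c' x \<equiv> snd c' (chart_inv c x)"

abbreviation overlap :: "('a, 'e) chart \<Rightarrow> ('a, 'e) chart \<Rightarrow> 'e set" where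
  "overlap c c' \<equiv> snd c ` (fst c \<inter> fst c')"

abbreviation T :: "('a, 'e) chart \<Rightarrow> ('a, 'e) chart \<Rightarrow> 'e \<Rightarrow> 'e \<Rightarrow> 'e" where
  "T c c' \<equiv> D (transition c c')"

lemma smooth_trans: "c \<in> atlas M \<Longrightarrow> c' \<in> atlas M \<Longrightarrow> smooth_on (transition c c') (overlap c c')"
  using smooth_manifold by (auto simp: smooth_manifold_def)

lemma overlap_iff: "c \<in> atlas M \<Longrightarrow> x \<in> overlap c c' \<longleftrightarrow> x \<in> chart_image c \<and> chart_inv c x \<in> fst c'"
proof
  assume c: "c \<in> atlas M"
  show "x \<in> overlap c c' \<Longrightarrow> x \<in> chart_image c \<and> chart_inv c x \<in> fst c'" using c by auto
  assume "x \<in> chart_image c \<and> chart_inv c x \<in> fst c'"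
  then show "x \<in> overlap c c'" by (intro image_eqI[of _ _ "chart_inv c x"]) auto
qed

lemma open_overlap:
  assumes "c \<in> atlas M" "c' \<in> atlas M"
  shows "open (overlap c c')"
proof -
  have "openin (subtopology (mtop M) (fst c)) (fst c \<inter> fst c')"
    using chart_open(1)[OF assms(2)] by (metis Int_commute openin_subtopology)
  then have "openin (top_of_set (chart_image c)) (overlap c c')"
    using homeomorphic_imp_open_map[OF chart_open(3)[OF assms(1)]] unfolding open_map_def by blast
  then show ?thesis using chart_open(2)[OF assms(1)] openin_open_trans by blast
qed

lemma T_linear:
  assumes "c \<in> atlas M" "c' \<in> atlas M" "x \<in> overlap c c'"
  shows "linear (T c c' x)"
  by (rule linear_D[OF smooth_on_differentiable[OF smooth_trans]]) (use assms in auto)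

lemma T_differentiable:
  assumes "c \<in> atlas M" "c' \<in> atlas M" "x \<in> overlap c c'"
  shows "(\<lambda>x. T c c' x b) differentiable (at x)"
  by (rule smooth_on_differentiable[OF smooth_on_D[OF smooth_trans]]) (use assms in auto)

text \<open>The cocycle rule for Jacobians is the chain rule, applied to an equation between
  transition maps that is valid on the intersection of two overlaps.\<close>

lemma T_comp:
  assumes "c \<in> atlas M" "c' \<in> atlas M" "c'' \<in> atlas M" "p \<in> fst c" "p \<in> fst c'" "p \<in> fst c''"
  shows "T c' c'' (snd c' p) (T c c' (snd c p) v) = T c c'' (snd c p) v"
proof -
  have x: "snd c p \<in> overlap c c'" "snd c p \<in> overlap c c''" "transition c c' (snd c p) \<in> overlap c' c''"
    using assms by auto
  have "((\<lambda>x. transition c' c'' (transition c c' x)) has_derivative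
     (\<lambda>v. T c' c'' (transition c c' (snd c p)) (T c c' (snd c p) v))) (at (snd c p))"
    by (rule has_derivative_compose[OF smooth_on_has_derivative[OF smooth_trans[OF assms(1,2)] x(1)]
        smooth_on_has_derivative[OF smooth_trans[OF assms(2,3)] x(3)]])
  then have "(transition c c'' has_derivative
     (\<lambda>v. T c' c'' (transition c c' (snd c p)) (T c c' (snd c p) v))) (at (snd c p))"
  proof (rule has_derivative_transform_open[of "overlap c c' \<inter> overlap c c''", rotated 2])
    show "open (overlap c c' \<inter> overlap c c'')" using assms open_overlap by (intro open_Int)
  qed (use assms x in \<open>auto simp: overlap_iff\<close>)
  from D_eqI[OF this, of v] show ?thesis using assms by simp
qed

lemma T_id:
  assumes "c \<in> atlas M" "p \<in> fst c"
  shows "T c c (snd c p) v = v"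
proof -
  have "((\<lambda>x. x) has_derivative (\<lambda>v. v)) (at (snd c p))" by (rule has_derivative_ident)
  then have "(transition c c has_derivative (\<lambda>v. v)) (at (snd c p))"
    by (rule has_derivative_transform_open[of "chart_image c", rotated 2])
      (use assms chart_open(2) in auto)
  then show ?thesis by (rule D_eqI)
qed

lemma pref_chart:
  assumes "p \<in> topspace (mtop M)"
  shows "pref_chart M p \<in> atlas M" "p \<in> fst (pref_chart M p)"
proof -
  have "\<exists>c. c \<in> atlas M \<and> p \<in> fst c"
    using smooth_manifold assms unfolding smooth_manifold_def by blast
  from someI_ex[OF this] show "pref_chart M p \<in> atlas M" "p \<in> fst (pref_chart M p)"
    by (simp_all add: pref_chart_def)
qed

lemma pref_chart':
  assumes "c \<in> atlas M" "p \<in> fst c"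
  shows "pref_chart M p \<in> atlas M" "p \<in> fst (pref_chart M p)"
  using pref_chart[OF chart_subset[OF assms]] .

lemma to_chart_eq: "to_chart M c p v = T (pref_chart M p) c (snd (pref_chart M p) p) v"
  by (simp add: to_chart_def)

lemma from_chart_eq: "from_chart M c p v = T c (pref_chart M p) (snd c p) v"
  by (simp add: from_chart_def)

text \<open>The preferred chart cancels by the cocycle rule; this makes its arbitrary dependence on
  the point harmless.\<close>

lemma to_from_chart:
  assumes "c \<in> atlas M" "c' \<in> atlas M" "p \<in> fst c" "p \<in> fst c'"
  shows "to_chart M c' p (from_chart M c p a) = T c c' (snd c p) a"
  unfolding to_chart_eq from_chart_eq
  by (rule T_comp) (use assms pref_chart'[OF assms(1,3)] in auto)

lemma to_from_id [simp]:
  assumes "c \<in> atlas M" "p \<in> fst c"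
  shows "to_chart M c p (from_chart M c p a) = a"
  using to_from_chart[OF assms(1) assms(1)] T_id assms by simp

lemma from_to_id [simp]:
  assumes "c \<in> atlas M" "p \<in> fst c"
  shows "from_chart M c p (to_chart M c p a) = a"
  unfolding to_chart_eq from_chart_eq
  using T_comp[OF pref_chart'(1)[OF assms] assms(1) pref_chart'(1)[OF assms]] T_id pref_chart'[OF assms] assms
  by simp

lemma from_chart_T:
  assumes "c \<in> atlas M" "c' \<in> atlas M" "p \<in> fst c" "p \<in> fst c'"
  shows "from_chart M c' p (T c c' (snd c p) a) = from_chart M c p a"
  unfolding from_chart_eq
  by (rule T_comp) (use assms pref_chart'[OF assms(1,3)] in auto)

lemma from_chart_pref:
  assumes "p \<in> topspace (mtop M)"
  shows "from_chart M (pref_chart M p) p a = a"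
  unfolding from_chart_eq by (rule T_id) (use pref_chart[OF assms] in auto)

lemma linear_from_chart:
  assumes "c \<in> atlas M" "p \<in> fst c"
  shows "linear (from_chart M c p)"
  unfolding from_chart_eq[abs_def]
  by (rule T_linear) (use assms pref_chart'[OF assms] in auto)

lemma from_chart_inject:
  assumes "c \<in> atlas M" "p \<in> fst c"
  shows "from_chart M c p a = from_chart M c p b \<longleftrightarrow> a = b"
  using to_from_id[OF assms] by metis

lemma chart_metric_transform:
  assumes "c \<in> atlas M" "c' \<in> atlas M" "y \<in> overlap c c'"
  shows "chart_metric M c y a b = chart_metric M c' (transition c c' y) (T c c' y a) (T c c' y b)"
proof -
  obtain p where p: "p \<in> fst c" "p \<in> fst c'" "y = snd c p" using assms(3) by auto
  show ?thesis using p assms from_chart_T[OF assms(1,2) p(1,2)] by (simp add: chart_metric_def)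
qed

lemma metric_eq_chart_metric:
  "metric M (chart_inv c x) (from_chart M c (chart_inv c x) a) (from_chart M c (chart_inv c x) b) = chart_metric M c x a b"
  by (simp add: chart_metric_def)

lemma metric_props:
  assumes "p \<in> topspace (mtop M)"
  shows "bilinear (metric M p)" "metric M p u v = metric M p v u" "u \<noteq> 0 \<Longrightarrow> metric M p u u > 0"
  using riem assms by (auto simp: riemannian_manifold_def)

lemma local_metric_chart:
  assumes c: "c \<in> atlas M"
  shows "local_metric (chart_image c) (chart_metric M c)"
proof
  show "open (chart_image c)" using chart_open c by blast
  fix x assume x: "x \<in> chart_image c"
  let ?p = "chart_inv c x"
  have p: "?p \<in> fst c" "?p \<in> topspace (mtop M)" using x c chart_subset by auto
  have lin: "linear (from_chart M c ?p)" using linear_from_chart[OF c p(1)] .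
  have bl: "linear (\<lambda>u. metric M ?p u v)" "linear (metric M ?p v)" for v
    using metric_props(1)[OF p(2)] by (auto simp: bilinear_def)
  show "bilinear (chart_metric M c x)"
    unfolding bilinear_def chart_metric_def
    using linear_compose[OF lin bl(1)] linear_compose[OF lin bl(2)] by (auto simp: o_def)
  show "chart_metric M c x a b = chart_metric M c x b a" for a b
    unfolding chart_metric_def by (rule metric_props(2)[OF p(2)])
  show "chart_metric M c x a a > 0" if "a \<noteq> 0" for a
  proof -
    have "from_chart M c ?p a \<noteq> from_chart M c ?p 0"
      using that from_chart_inject[OF c p(1)] by blast
    then show ?thesis
      unfolding chart_metric_def using linear_0[OF lin] by (intro metric_props(3)[OF p(2)]) simp
  qed
next
  show "smooth_on (\<lambda>x. chart_metric M c x a b) (chart_image c)" for a b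
    using riem c by (simp add: riemannian_manifold_def)
qed

abbreviation \<Gamma> :: "('a, 'e) chart \<Rightarrow> 'e \<Rightarrow> 'e \<Rightarrow> 'e \<Rightarrow> 'e" where
  "\<Gamma> c \<equiv> local_metric.Gam (chart_image c) (chart_metric M c)"

lemma christoffel_eq:
  assumes c: "c \<in> atlas M" and x: "x \<in> chart_image c"
  shows "christoffel M c x a b = \<Gamma> c x a b"
proof -
  interpret local_metric "chart_image c" "chart_metric M c" by (rule local_metric_chart[OF c])
  have *: "2 * chart_metric M c x w d = 2 * koszul x a b d \<longleftrightarrow> chart_metric M c x w d = chart_metric M c x (Gam x a b) d" for w d
    using g_Gam[OF x] by simp
  have k: "dg x a b d + dg x b a d - dg x d a b = 2 * koszul x a b d" for d
    by (simp add: koszul_def)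
  have "christoffel M c x a b = (THE w. \<forall>d. 2 * chart_metric M c x w d = 2 * koszul x a b d)"
    unfolding christoffel_def Let_def k ..
  also have "\<dots> = Gam x a b"
    unfolding * by (rule the_equality) (auto intro: g_nondegenerate[OF x])
  finally show ?thesis .
qed

text \<open>A transition map is an isometry of the chart metrics; its Jacobian is onto because the
  reverse transition inverts it.\<close>

lemma \<Gamma>_transform:
  assumes c: "c \<in> atlas M" "c' \<in> atlas M" and p: "p \<in> fst c" "p \<in> fst c'"
  shows "T c c' (snd c p) (\<Gamma> c (snd c p) a b) =
    \<Gamma> c' (snd c' p) (T c c' (snd c p) a) (T c c' (snd c p) b) + D (\<lambda>y. T c c' y b) (snd c p) a"
proof -
  have "T c c' (snd c p) (\<Gamma> c (snd c p) a b) =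
    \<Gamma> c' (transition c c' (snd c p)) (T c c' (snd c p) a) (T c c' (snd c p) b) + D (\<lambda>y. T c c' y b) (snd c p) a"
  proof (rule Gam_transform[OF local_metric_chart[OF c(1)] local_metric_chart[OF c(2)] open_overlap[OF c]])
    show "surj (T c c' (snd c p))"
      by (rule surjI[of _ "T c' c (snd c' p)"]) (use T_comp[OF c(2) c(1) c(2) p(2) p(1) p(2)] T_id[OF c(2) p(2)] in simp)
    show "overlap c c' \<subseteq> chart_image c" by (auto simp: chart_image_def)
    show "transition c c' ` overlap c c' \<subseteq> chart_image c'" using c by auto
  qed (use p c smooth_trans chart_metric_transform in auto)
  then show ?thesis using c p by simp
qed

text \<open>\<open>cov_deriv\<close> is computed in the preferred chart at
  \<open>\<gamma> t\<close>. Passing to \<open>c\<close>, the derivative of the Jacobian along the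
  curve is cancelled by the inhomogeneous term of \<open>\<Gamma>_transform\<close>, so the usual
  formula holds in every chart.\<close>

lemma cov_deriv_in_chart:
  assumes c: "c \<in> atlas M" and I: "open I" "t \<in> I"
    and x: "\<And>s. s \<in> I \<Longrightarrow> x s \<in> chart_image c" "\<And>s. s \<in> I \<Longrightarrow> \<gamma> s = chart_inv c (x s)"
      "(x has_vector_derivative x') (at t)"
    and a: "\<And>s. s \<in> I \<Longrightarrow> V s = from_chart M c (\<gamma> s) (a s)" "(a has_vector_derivative a') (at t)"
  shows "velocity M \<gamma> t = from_chart M c (\<gamma> t) x'"
    "cov_deriv M \<gamma> V t = from_chart M c (\<gamma> t) (a' + \<Gamma> c (x t) x' (a t))"
proof -
  let ?c = "pref_chart M (\<gamma> t)"
  have p: "\<gamma> t \<in> fst c" using x I by simp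
  note c' = pref_chart'[OF c p]
  have xt: "snd c (\<gamma> t) = x t" using x I by simp
  have xd: "x t \<in> overlap c ?c" unfolding xt[symmetric] using p c' by auto
  obtain \<delta> where \<delta>: "\<delta> > 0" "ball t \<delta> \<subseteq> I" "\<And>s. s \<in> ball t \<delta> \<Longrightarrow> x s \<in> overlap c ?c"
    using isCont_open_preimage[OF has_vector_derivative_continuous[OF x(3)] open_overlap[OF c c'(1)] xd I] by blast
  have \<gamma>: "\<gamma> s \<in> fst c" "\<gamma> s \<in> fst ?c" "\<gamma> s = chart_inv c (x s)" "snd c (\<gamma> s) = x s"
    if "s \<in> ball t \<delta>" for s
    using \<delta>(2,3) that x c by (auto simp: overlap_iff)
  have "((\<lambda>s. transition c ?c (x s)) has_vector_derivative T c ?c (x t) x') (at t)"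
    by (rule has_vector_derivative_compose_D[OF x(3) smooth_on_differentiable[OF smooth_trans[OF c c'(1)] xd]])
  then have "((\<lambda>s. snd ?c (\<gamma> s)) has_vector_derivative T c ?c (x t) x') (at t)"
    by (rule has_vector_derivative_transform_within_open[of _ _ _ "ball t \<delta>"]) (use \<delta> \<gamma>(3) in auto)
  then have vel: "velocity M \<gamma> t = T c ?c (x t) x'"
    unfolding velocity_def by (rule vector_derivative_at)
  then show "velocity M \<gamma> t = from_chart M c (\<gamma> t) x'"
    by (simp add: from_chart_eq xt)
  have "((\<lambda>s. T c ?c (x s) (a s)) has_vector_derivative
      (D (\<lambda>y. T c ?c y (a t)) (x t) x' + T c ?c (x t) a')) (at t)"
    by (rule has_vector_derivative_linear_family[where S = "overlap c ?c" and x = x and t = t and L = "T c ?c", OF open_overlap[OF c c'(1)] xd _ _ x(3) a(2)])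
      (auto intro: T_linear T_differentiable c c'(1) xd)
  then have "((\<lambda>s. to_chart M ?c (\<gamma> s) (V s)) has_vector_derivative
      (D (\<lambda>y. T c ?c y (a t)) (x t) x' + T c ?c (x t) a')) (at t)"
  proof (rule has_vector_derivative_transform_within_open[of _ _ _ "ball t \<delta>"])
    fix s assume s: "s \<in> ball t \<delta>"
    then show "T c ?c (x s) (a s) = to_chart M ?c (\<gamma> s) (V s)"
      using to_from_chart[OF c c'(1) \<gamma>(1,2)[OF s]] a(1) \<delta>(2) \<gamma>(4) by auto
  qed (use \<delta> in auto)
  then have "cov_deriv M \<gamma> V t = D (\<lambda>y. T c ?c y (a t)) (x t) x' + T c ?c (x t) a'
     + christoffel M ?c (snd ?c (\<gamma> t)) (T c ?c (x t) x') (T c ?c (x t) (a t))"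
    using a(1) I(2) unfolding cov_deriv_def Let_def vel
    by (simp add: vector_derivative_at from_chart_eq xt)
  also have "\<dots> = T c ?c (x t) (a' + \<Gamma> c (x t) x' (a t))"
    using \<Gamma>_transform[OF c c'(1) p c'(2), of x' "a t"] linear_add[OF T_linear[OF c c'(1) xd]] c'(2)
    by (simp add: christoffel_eq[OF c'(1)] xt)
  finally show "cov_deriv M \<gamma> V t = from_chart M c (\<gamma> t) (a' + \<Gamma> c (x t) x' (a t))"
    by (simp add: from_chart_eq xt)
qed

text \<open>The cancellation of \<open>cov_deriv_in_chart\<close>, now for vector fields. Allowing
  any chart matters for curvature, where the preferred chart changes with the point of the inner
  derivative.\<close>

lemma nabla_in_chart:
  assumes c: "c \<in> atlas M" "q \<in> fst c" and Z: "\<And>q. q \<in> fst c \<Longrightarrow> Z q = from_chart M c q (Zc (snd c q))"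
    and dif: "Zc differentiable (at (snd c q))"
  shows "nabla M (from_chart M c q u) Z q =
    from_chart M c q (D Zc (snd c q) u + \<Gamma> c (snd c q) u (Zc (snd c q)))"
proof -
  let ?c = "pref_chart M q"
  note c' = pref_chart'[OF c]
  let ?x = "snd c q" and ?y = "snd ?c q"
  have xd: "?x \<in> overlap c ?c" and yd: "?y \<in> overlap ?c c" using c c' by auto
  have \<xi>: "(transition ?c c has_derivative T ?c c ?y) (at ?y)"
    by (rule smooth_on_has_derivative[OF smooth_trans[OF c'(1) c(1)] yd])
  have xy: "transition ?c c ?y = ?x" using c c' by simp
  have V: "((\<lambda>y. Zc (transition ?c c y)) has_derivative (\<lambda>h. D Zc ?x (T ?c c ?y h))) (at ?y)"
    by (rule has_derivative_compose[OF \<xi>]) (simp only: xy has_derivative_D[OF dif])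
  have "((\<lambda>y. T c ?c (transition ?c c y) (Zc (transition ?c c y))) has_derivative
     (\<lambda>h. D (\<lambda>x. T c ?c x (Zc (transition ?c c ?y))) (transition ?c c ?y) (T ?c c ?y h) +
       T c ?c (transition ?c c ?y) (D Zc ?x (T ?c c ?y h)))) (at ?y)"
    by (rule has_derivative_linear_family[where S = "overlap c ?c" and \<xi> = "transition ?c c" and t = ?y and L = "T c ?c", OF open_overlap[OF c(1) c'(1)] _ _ _ \<xi> V])
      (auto simp: xy intro: T_linear T_differentiable c(1) c'(1) xd)
  then have "((\<lambda>y. T c ?c (transition ?c c y) (Zc (transition ?c c y))) has_derivative
     (\<lambda>h. D (\<lambda>x. T c ?c x (Zc ?x)) ?x (T ?c c ?y h) + T c ?c ?x (D Zc ?x (T ?c c ?y h)))) (at ?y)"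
    unfolding xy .
  then have "(field_in_chart M ?c Z has_derivative
     (\<lambda>h. D (\<lambda>x. T c ?c x (Zc ?x)) ?x (T ?c c ?y h) + T c ?c ?x (D Zc ?x (T ?c c ?y h)))) (at ?y)"
  proof (rule has_derivative_transform_open[OF open_overlap[OF c'(1) c(1)] yd])
    fix y assume y: "y \<in> overlap ?c c"
    have "chart_inv ?c y \<in> fst c" "chart_inv ?c y \<in> fst ?c" using y c'(1) by auto
    then show "field_in_chart M ?c Z y = T c ?c (transition ?c c y) (Zc (transition ?c c y))"
      using to_from_chart[OF c(1) c'(1)] Z by (simp add: field_in_chart_def)
  qed
  from D_eqI[OF this, of "T c ?c ?x u"]
  have "D (field_in_chart M ?c Z) ?y (T c ?c ?x u) = D (\<lambda>x. T c ?c x (Zc ?x)) ?x u + T c ?c ?x (D Zc ?x u)"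
    using T_comp[OF c(1) c'(1) c(1) c(2) c'(2) c(2)] T_id[OF c] by simp
  then have "nabla M (from_chart M c q u) Z q = D (\<lambda>x. T c ?c x (Zc ?x)) ?x u + T c ?c ?x (D Zc ?x u)
     + christoffel M ?c ?y (T c ?c ?x u) (T c ?c ?x (Zc ?x))"
    unfolding nabla_def Let_def using Z[OF c(2)] by (simp add: from_chart_eq)
  also have "\<dots> = T c ?c ?x (D Zc ?x u + \<Gamma> c ?x u (Zc ?x))"
    using \<Gamma>_transform[OF c(1) c'(1) c(2) c'(2), of u "Zc ?x"] linear_add[OF T_linear[OF c(1) c'(1) xd]] c'
    by (simp add: christoffel_eq[OF c'(1)])
  finally show ?thesis by (simp add: from_chart_eq)
qed

text \<open>The extensions have constant components in the preferred chart of \<open>p\<close>, so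
  the bracket vanishes, the inner derivative has components \<open>Gam\<close>, and the outer one
  differentiates these.\<close>

lemma curvature_in_chart:
  assumes p: "p \<in> topspace (mtop M)"
  defines "c \<equiv> pref_chart M p"
  shows "curvature M p u v w = local_metric.curv (chart_image c) (chart_metric M c) (snd c p) u v w"
proof -
  have c: "c \<in> atlas M" "p \<in> fst c" using pref_chart[OF p] by (auto simp: c_def)
  interpret local_metric "chart_image c" "chart_metric M c" by (rule local_metric_chart[OF c(1)])
  have x: "snd c p \<in> chart_image c" using c by simp
  have ext: "local_extension M p u = (\<lambda>q. from_chart M c q u)" for u
    by (rule ext) (simp add: local_extension_def c_def)
  have fp: "from_chart M c p a = a" for a
    unfolding c_def by (rule from_chart_pref[OF p])
  have n1: "nabla M (from_chart M c q v) (\<lambda>q. from_chart M c q w) q = from_chart M c q (Gam (snd c q) v w)"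
    if "q \<in> fst c" for q v w
    using nabla_in_chart[OF c(1) that, of "\<lambda>q. from_chart M c q w" "\<lambda>x. w" v] by simp
  have n2: "nabla M (from_chart M c p u) (\<lambda>q. nabla M (from_chart M c q v) (\<lambda>q. from_chart M c q w) q) p
    = dGam (snd c p) u v w + Gam (snd c p) u (Gam (snd c p) v w)" for u v w
    using nabla_in_chart[OF c, of "\<lambda>q. nabla M (from_chart M c q v) (\<lambda>q. from_chart M c q w) q"
        "\<lambda>x. Gam x v w" u] n1 smooth_on_differentiable[OF smooth_Gam x] fp by simp
  have fc: "D (field_in_chart M c (\<lambda>q. from_chart M c q u)) (snd c p) h = 0" for u h
  proof -
    have "D (field_in_chart M c (\<lambda>q. from_chart M c q u)) (snd c p) = D (\<lambda>y. u) (snd c p)"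
      by (rule D_cong_open[OF open_U x]) (use c in \<open>simp add: field_in_chart_def\<close>)
    then show ?thesis by simp
  qed
  have "lie_bracket M (\<lambda>q. from_chart M c q u) (\<lambda>q. from_chart M c q v) p = 0"
    unfolding lie_bracket_def Let_def c_def[symmetric] by (simp add: fc)
  moreover have "nabla M 0 (\<lambda>q. from_chart M c q w) p = 0"
    using n1[OF c(2), of 0 w] x fp by simp
  ultimately show ?thesis
    unfolding curvature_def curvature_fields_def ext n2 curv_def by simp
qed

end


section \<open>Geodesics and parallel transport in a chart\<close>

lemma has_vector_derivative_Pair:
  assumes "(f has_vector_derivative f') (at t)" "(h has_vector_derivative h') (at t)"
  shows "((\<lambda>t. (f t, h t)) has_vector_derivative (f', h')) (at t)"
  using has_derivative_Pair[OF assms[unfolded has_vector_derivative_def]]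
  by (simp add: has_vector_derivative_def)

lemma has_vector_derivative_fst:
  "(f has_vector_derivative f') (at t) \<Longrightarrow> ((\<lambda>t. fst (f t)) has_vector_derivative fst f') (at t)"
  by (rule bounded_linear.has_vector_derivative[OF bounded_linear_fst])

lemma has_vector_derivative_snd:
  "(f has_vector_derivative f') (at t) \<Longrightarrow> ((\<lambda>t. snd (f t)) has_vector_derivative snd f') (at t)"
  by (rule bounded_linear.has_vector_derivative[OF bounded_linear_snd])

lemma smooth_on_has_vector_derivative:
  assumes "smooth_on f I" "t \<in> I"
  shows "(f has_vector_derivative vector_derivative f (at t)) (at t)"
    and "vector_derivative f (at t) = D f t 1"
proof -
  have "(f has_derivative D f t) (at t)" using smooth_on_has_derivative[OF assms] .
  moreover have "D f t h = h *\<^sub>R D f t 1" for h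
    using linear_cmul[OF linear_D[OF smooth_on_differentiable[OF assms]], of h 1] by simp
  ultimately have h: "(f has_vector_derivative D f t 1) (at t)"
    unfolding has_vector_derivative_def by (metis (no_types, lifting) ext)
  then show "vector_derivative f (at t) = D f t 1" by (rule vector_derivative_at)
  with h show "(f has_vector_derivative vector_derivative f (at t)) (at t)" by simp
qed

lemma smooth_on_vector_derivative:
  assumes "smooth_on f I" "open I"
  shows "smooth_on (\<lambda>t. vector_derivative f (at t)) I"
  by (rule smooth_on_transform[OF assms(2) smooth_on_D[OF assms(1)]])
    (rule smooth_on_has_vector_derivative(2)[OF assms(1)])

context local_metric
begin

text \<open>The geodesic equation and the equation of parallel transport along the geodesic, as one autonomous
  system for position, velocity and transported vector.\<close>

definition spray :: "'e \<times> 'e \<times> 'e \<Rightarrow> 'e \<times> 'e \<times> 'e" where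
  "spray w = (fst (snd w), - Gam (fst w) (fst (snd w)) (fst (snd w)), - Gam (fst w) (fst (snd w)) (snd (snd w)))"

lemma smooth_spray: "smooth_on spray (U \<times> UNIV)"
  unfolding spray_def
  by (intro smooth_intros smooth_on_Gam open_Times open_U) auto

definition geodesic_transport :: "real set \<Rightarrow> (real \<Rightarrow> 'e) \<Rightarrow> (real \<Rightarrow> 'e) \<Rightarrow> (real \<Rightarrow> 'e) \<Rightarrow> bool" where
  "geodesic_transport I x y a \<longleftrightarrow> (\<forall>t\<in>I. x t \<in> U \<and>
     (x has_vector_derivative y t) (at t) \<and>
     (y has_vector_derivative - Gam (x t) (y t) (y t)) (at t) \<and>
     (a has_vector_derivative - Gam (x t) (y t) (a t)) (at t))"

text \<open>Gives access to the results on autonomous equations, which then yield existence,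
  uniqueness and smoothness for geodesics and transport together.\<close>

lemma geodesic_transport_iff_spray:
  "geodesic_transport I x y a \<longleftrightarrow> (\<forall>t\<in>I. (x t, y t, a t) \<in> U \<times> UNIV \<and>
    ((\<lambda>t. (x t, y t, a t)) has_vector_derivative spray (x t, y t, a t)) (at t))"
proof -
  have "((\<lambda>t. (x t, y t, a t)) has_vector_derivative (x', y', a')) (at t) \<longleftrightarrow>
    (x has_vector_derivative x') (at t) \<and> (y has_vector_derivative y') (at t) \<and> (a has_vector_derivative a') (at t)"
    for x' y' a' t
  proof
    assume h: "((\<lambda>t. (x t, y t, a t)) has_vector_derivative (x', y', a')) (at t)"
    show "(x has_vector_derivative x') (at t) \<and> (y has_vector_derivative y') (at t) \<and> (a has_vector_derivative a') (at t)"
      using has_vector_derivative_fst[OF h] has_vector_derivative_fst[OF has_vector_derivative_snd[OF h]]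
        has_vector_derivative_snd[OF has_vector_derivative_snd[OF h]] by simp
  qed (intro has_vector_derivative_Pair; simp)
  then show ?thesis unfolding geodesic_transport_def spray_def by simp
qed

lemma geodesic_transport_exists:
  assumes "x0 \<in> U"
  obtains \<epsilon> x y a where "\<epsilon> > 0" "x 0 = x0" "y 0 = y0" "a 0 = a0"
    "geodesic_transport {-\<epsilon><..<\<epsilon>} x y a"
proof -
  obtain \<epsilon> w where w: "\<epsilon> > 0" "w 0 = (x0, y0, a0)" "\<And>t. t \<in> {-\<epsilon><..<\<epsilon>} \<Longrightarrow> w t \<in> U \<times> UNIV"
    "\<And>t. t \<in> {-\<epsilon><..<\<epsilon>} \<Longrightarrow> (w has_vector_derivative spray (w t)) (at t)"
    using ode_exists_local[OF open_Times[OF open_U open_UNIV] smooth_spray, of "(x0, y0, a0)"] assms by auto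
  show ?thesis
    by (rule that[of \<epsilon> "\<lambda>t. fst (w t)" "\<lambda>t. fst (snd (w t))" "\<lambda>t. snd (snd (w t))"])
      (use w in \<open>auto simp: geodesic_transport_iff_spray\<close>)
qed

lemma geodesic_transport_unique_local:
  assumes "geodesic_transport J x y a" "geodesic_transport J x2 y2 a2" "open J" "t0 \<in> J"
    "x t0 = x2 t0" "y t0 = y2 t0" "a t0 = a2 t0"
  obtains \<delta> where "\<delta> > 0" "ball t0 \<delta> \<subseteq> J"
    "\<And>t. t \<in> ball t0 \<delta> \<Longrightarrow> x t = x2 t \<and> y t = y2 t \<and> a t = a2 t"
proof -
  obtain \<delta> where \<delta>: "\<delta> > 0" "ball t0 \<delta> \<subseteq> J"
    "\<And>t. t \<in> ball t0 \<delta> \<Longrightarrow> (x t, y t, a t) = (x2 t, y2 t, a2 t)"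
    by (rule ode_unique_local[OF open_Times[OF open_U open_UNIV] smooth_spray assms(3,4),
          of "\<lambda>t. (x t, y t, a t)" "\<lambda>t. (x2 t, y2 t, a2 t)"])
      (use assms in \<open>simp_all add: geodesic_transport_iff_spray\<close>)
  then show ?thesis using that by blast
qed

lemma geodesic_transport_smooth:
  assumes "geodesic_transport I x y a" "open I"
  shows "smooth_on x I" "smooth_on y I" "smooth_on a I"
proof -
  have s: "smooth_on (\<lambda>t. (x t, y t, a t)) I"
    by (rule ode_solution_smooth[OF smooth_spray assms(2)])
      (use assms(1) in \<open>simp_all add: geodesic_transport_iff_spray\<close>)
  show "smooth_on x I" "smooth_on y I" "smooth_on a I"
    using smooth_on_fst[OF s assms(2)] smooth_on_fst[OF smooth_on_snd[OF s assms(2)] assms(2)]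
      smooth_on_snd[OF smooth_on_snd[OF s assms(2)] assms(2)] by simp_all
qed

end

context riemannian
begin

section \<open>Chart solutions versus geodesics and parallel fields on the manifold\<close>

abbreviation chart_transport :: "('a, 'e) chart \<Rightarrow> real set \<Rightarrow> (real \<Rightarrow> 'e) \<Rightarrow> (real \<Rightarrow> 'e) \<Rightarrow> (real \<Rightarrow> 'e) \<Rightarrow> bool" where
  "chart_transport c \<equiv> local_metric.geodesic_transport (chart_image c) (chart_metric M c)"

lemma chart_transportD:
  assumes "c \<in> atlas M" "chart_transport c I x y a" "t \<in> I"
  shows "x t \<in> chart_image c" "(x has_vector_derivative y t) (at t)"
    "(y has_vector_derivative - \<Gamma> c (x t) (y t) (y t)) (at t)"
    "(a has_vector_derivative - \<Gamma> c (x t) (y t) (a t)) (at t)"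
  using assms(2,3) unfolding local_metric.geodesic_transport_def[OF local_metric_chart[OF assms(1)]] by auto

text \<open>\<open>cov_deriv_in_chart\<close> expects a field along the curve; the zero field serves
  as a dummy.\<close>

lemma chart_transport_velocity:
  assumes c: "c \<in> atlas M" and I: "open I" "t \<in> I" and sol: "chart_transport c I x y a"
    and \<gamma>: "\<And>s. s \<in> I \<Longrightarrow> \<gamma> s = chart_inv c (x s)"
  shows "velocity M \<gamma> t = from_chart M c (\<gamma> t) (y t)"
  by (rule cov_deriv_in_chart(1)[OF c I chart_transportD(1)[OF c sol] \<gamma> chart_transportD(2)[OF c sol I(2)],
        where V = "\<lambda>s. from_chart M c (\<gamma> s) 0" and a = "\<lambda>s. 0" and a' = 0]) auto

text \<open>Smoothness is demanded in every chart \<open>c'\<close>; it holds on the open set of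
  times spent in \<open>c'\<close>, where the components arise through the smooth Jacobian.\<close>

lemma chart_transport_parallel:
  assumes c: "c \<in> atlas M" and I: "open I" and sol: "chart_transport c I x y a"
    and \<gamma>: "\<And>s. s \<in> I \<Longrightarrow> \<gamma> s = chart_inv c (x s)"
    and V: "\<And>s. s \<in> I \<Longrightarrow> V s = from_chart M c (\<gamma> s) (a s)"
  shows "parallel_on M I \<gamma> V"
  unfolding parallel_on_def smooth_field_along_on_def
proof (intro conjI ballI)
  note sm = local_metric.geodesic_transport_smooth[OF local_metric_chart[OF c] sol I]
  fix c' assume c': "c' \<in> atlas M"
  have eq: "{t \<in> I. \<gamma> t \<in> fst c'} = I \<inter> x -` overlap c c'"
    using \<gamma> chart_transportD(1)[OF c sol] by (auto simp: overlap_iff[OF c] chart_inv_chart[OF c])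
  have o: "open (I \<inter> x -` overlap c c')"
    using continuous_open_preimage[OF smooth_on_continuous[OF sm(1)] I open_overlap[OF c c']] .
  have sx: "smooth_on x (I \<inter> x -` overlap c c')" "smooth_on a (I \<inter> x -` overlap c c')"
    using sm smooth_on_subset by blast+
  have sT: "smooth_on (\<lambda>t. T c c' (x t) b) (I \<inter> x -` overlap c c')" for b
    by (rule smooth_on_compose[OF smooth_on_D[OF smooth_trans[OF c c']] sx(1) _ o]) auto
  have "smooth_on (\<lambda>t. T c c' (x t) (a t)) (I \<inter> x -` overlap c c')"
    by (rule smooth_on_linear_family[where L = "T c c'" and S = "overlap c c'" and \<xi> = x,
        OF T_linear[OF c c'] sT _ sx(2) o]) auto
  then show "smooth_on (\<lambda>t. to_chart M c' (\<gamma> t) (V t)) {t \<in> I. \<gamma> t \<in> fst c'}"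
    unfolding eq
  proof (rule smooth_on_transform[OF o])
    fix t assume t: "t \<in> I \<inter> x -` overlap c c'"
    then have "\<gamma> t \<in> fst c" "\<gamma> t \<in> fst c'" "snd c (\<gamma> t) = x t" "V t = from_chart M c (\<gamma> t) (a t)"
      using \<gamma> V by (auto simp: overlap_iff[OF c] chart_inv_chart[OF c])
    then show "to_chart M c' (\<gamma> t) (V t) = T c c' (x t) (a t)"
      using to_from_chart[OF c c'] by metis
  qed
next
  fix t assume t: "t \<in> I"
  have "cov_deriv M \<gamma> V t = from_chart M c (\<gamma> t) (- \<Gamma> c (x t) (y t) (a t) + \<Gamma> c (x t) (y t) (a t))"
    by (rule cov_deriv_in_chart(2)[OF c I t chart_transportD(1)[OF c sol] \<gamma> chart_transportD(2)[OF c sol t]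
          V chart_transportD(4)[OF c sol t]])
  moreover have "\<gamma> t \<in> fst c" using \<gamma> t chart_transportD(1)[OF c sol] by simp
  ultimately show "cov_deriv M \<gamma> V t = 0"
    using linear_0[OF linear_from_chart[OF c]] by simp
qed

lemma chart_transport_geodesic:
  assumes c: "c \<in> atlas M" and I: "open I" and sol: "chart_transport c I x y a"
    and \<gamma>: "\<And>s. s \<in> I \<Longrightarrow> \<gamma> s = chart_inv c (x s)"
  shows "geodesic_on M I \<gamma>"
  unfolding geodesic_on_def smooth_curve_on_def
proof (intro conjI ballI)
  note sm = local_metric.geodesic_transport_smooth[OF local_metric_chart[OF c] sol I]
  have "continuous_map (top_of_set I) (top_of_set (chart_image c)) x"
    using smooth_on_continuous[OF sm(1)] chart_transportD(1)[OF c sol]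
    by (auto simp: continuous_map_in_subtopology)
  from continuous_map_compose[OF this continuous_chart_inv[OF c]]
  show "continuous_map (top_of_set I) (mtop M) \<gamma>"
    by (rule continuous_map_eq) (use \<gamma> in auto)
  fix c' assume c': "c' \<in> atlas M"
  have eq: "{t \<in> I. \<gamma> t \<in> fst c'} = I \<inter> x -` overlap c c'"
    using \<gamma> chart_transportD(1)[OF c sol] by (auto simp: overlap_iff[OF c] chart_inv_chart[OF c])
  have o: "open (I \<inter> x -` overlap c c')"
    using continuous_open_preimage[OF smooth_on_continuous[OF sm(1)] I open_overlap[OF c c']] .
  have sx: "smooth_on x (I \<inter> x -` overlap c c')"
    using sm smooth_on_subset by blast
  have "smooth_on (\<lambda>t. transition c c' (x t)) (I \<inter> x -` overlap c c')"
    by (rule smooth_on_compose[OF smooth_trans[OF c c'] sx _ o]) auto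
  then show "smooth_on (\<lambda>t. snd c' (\<gamma> t)) {t \<in> I. \<gamma> t \<in> fst c'}"
    unfolding eq by (rule smooth_on_transform[OF o]) (use \<gamma> in auto)
next
  fix t assume t: "t \<in> I"
  have "cov_deriv M \<gamma> (velocity M \<gamma>) t = from_chart M c (\<gamma> t) (- \<Gamma> c (x t) (y t) (y t) + \<Gamma> c (x t) (y t) (y t))"
    by (rule cov_deriv_in_chart(2)[OF c I t chart_transportD(1)[OF c sol] \<gamma> chart_transportD(2)[OF c sol t]
          chart_transport_velocity[OF c I _ sol \<gamma>] chart_transportD(3)[OF c sol t]])
  moreover have "\<gamma> t \<in> fst c" using \<gamma> t chart_transportD(1)[OF c sol] by simp
  ultimately show "cov_deriv M \<gamma> (velocity M \<gamma>) t = 0"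
    using linear_0[OF linear_from_chart[OF c]] by simp
qed

text \<open>The transported vector is filled with 0, which solves its linear equation, so that a
  bare geodesic fits the combined system.\<close>

lemma geodesic_in_chart:
  assumes c: "c \<in> atlas M" and J: "open J" "J \<subseteq> I" "\<gamma> ` J \<subseteq> fst c" and geo: "geodesic_on M I \<gamma>"
  defines "x \<equiv> \<lambda>t. snd c (\<gamma> t)"
  defines "y \<equiv> \<lambda>t. vector_derivative x (at t)"
  shows "chart_transport c J x y (\<lambda>t. 0)" "\<And>t. t \<in> J \<Longrightarrow> velocity M \<gamma> t = from_chart M c (\<gamma> t) (y t)"
proof -
  interpret local_metric "chart_image c" "chart_metric M c" by (rule local_metric_chart[OF c])
  have sx: "smooth_on x J"
    unfolding x_def
    by (rule smooth_on_subset[of _ "{t\<in>I. \<gamma> t \<in> fst c}"])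
      (use geo c J in \<open>auto simp: geodesic_on_def smooth_curve_on_def\<close>)
  have sy: "smooth_on y J"
    unfolding y_def by (rule smooth_on_vector_derivative[OF sx J(1)])
  have xU: "x t \<in> chart_image c" "\<gamma> t = chart_inv c (x t)" if "t \<in> J" for t
    using that J c by (auto simp: x_def)
  have dx: "(x has_vector_derivative y t) (at t)" if "t \<in> J" for t
    unfolding y_def by (rule smooth_on_has_vector_derivative(1)[OF sx that])
  show vel: "velocity M \<gamma> t = from_chart M c (\<gamma> t) (y t)" if "t \<in> J" for t
    by (rule cov_deriv_in_chart(1)[OF c J(1) that xU dx[OF that],
        where V = "\<lambda>s. from_chart M c (\<gamma> s) 0" and a = "\<lambda>s. 0" and a' = 0]) auto
  show "chart_transport c J x y (\<lambda>t. 0)"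
    unfolding geodesic_transport_def
  proof (intro ballI conjI)
    fix t assume t: "t \<in> J"
    let ?y' = "vector_derivative y (at t)"
    have dy: "(y has_vector_derivative ?y') (at t)"
      by (rule smooth_on_has_vector_derivative(1)[OF sy t])
    have "cov_deriv M \<gamma> (velocity M \<gamma>) t = from_chart M c (\<gamma> t) (?y' + Gam (x t) (y t) (y t))"
      by (rule cov_deriv_in_chart(2)[OF c J(1) t xU dx[OF t] vel dy])
    moreover have "cov_deriv M \<gamma> (velocity M \<gamma>) t = 0"
      using geo t J by (auto simp: geodesic_on_def)
    moreover have g: "\<gamma> t \<in> fst c" using t J by auto
    ultimately have "?y' + Gam (x t) (y t) (y t) = 0"
      using from_chart_inject[OF c g] linear_0[OF linear_from_chart[OF c g]] by metis
    then have "?y' = - Gam (x t) (y t) (y t)" by (simp add: eq_neg_iff_add_eq_0)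
    then show "(y has_vector_derivative - Gam (x t) (y t) (y t)) (at t)" using dy by simp
    show "((\<lambda>t. 0) has_vector_derivative - Gam (x t) (y t) 0) (at t)" using xU(1)[OF t] by simp
  qed (use xU dx in auto)
qed

lemma parallel_in_chart:
  assumes c: "c \<in> atlas M" and J: "open J" "J \<subseteq> I" and sol: "chart_transport c J x y b"
    and \<gamma>: "\<And>s. s \<in> J \<Longrightarrow> \<gamma> s = chart_inv c (x s)"
    and par: "parallel_on M I \<gamma> V"
  shows "chart_transport c J x y (\<lambda>t. to_chart M c (\<gamma> t) (V t))"
proof -
  interpret local_metric "chart_image c" "chart_metric M c" by (rule local_metric_chart[OF c])
  let ?a = "\<lambda>t. to_chart M c (\<gamma> t) (V t)"
  have g: "\<gamma> t \<in> fst c" if "t \<in> J" for t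
    using that \<gamma> chart_transportD(1)[OF c sol] by simp
  have sa: "smooth_on ?a J"
    by (rule smooth_on_subset[of _ "{t\<in>I. \<gamma> t \<in> fst c}"])
      (use par c J g in \<open>auto simp: parallel_on_def smooth_field_along_on_def\<close>)
  have "(?a has_vector_derivative - Gam (x t) (y t) (?a t)) (at t)" if t: "t \<in> J" for t
  proof -
    let ?a' = "vector_derivative ?a (at t)"
    have da: "(?a has_vector_derivative ?a') (at t)"
      by (rule smooth_on_has_vector_derivative(1)[OF sa t])
    have V: "V s = from_chart M c (\<gamma> s) (?a s)" if "s \<in> J" for s
      using from_to_id[OF c g[OF that]] by simp
    have "cov_deriv M \<gamma> V t = from_chart M c (\<gamma> t) (?a' + Gam (x t) (y t) (?a t))"
      by (rule cov_deriv_in_chart(2)[OF c J(1) t chart_transportD(1)[OF c sol] \<gamma> chart_transportD(2)[OF c sol t] V da])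
    moreover have "cov_deriv M \<gamma> V t = 0"
      using par t J by (auto simp: parallel_on_def)
    ultimately have "?a' + Gam (x t) (y t) (?a t) = 0"
      using from_chart_inject[OF c g[OF t]] linear_0[OF linear_from_chart[OF c g[OF t]]] by metis
    then have "?a' = - Gam (x t) (y t) (?a t)" by (simp add: eq_neg_iff_add_eq_0)
    then show ?thesis using da by simp
  qed
  then show ?thesis using sol unfolding geodesic_transport_def by blast
qed

text \<open>A competing geodesic need not stay in the chart. The Hausdorff property makes the set of times at which
  the two curves agree closed, and it is open by uniqueness in the chart.\<close>

lemma geodesic_unique:
  assumes c: "c \<in> atlas M" and sol: "chart_transport c {-\<epsilon><..<\<epsilon>} x y a"
    and I: "open I" "is_interval I" "0 \<in> I" and t: "t \<in> I" "t \<in> {-\<epsilon><..<\<epsilon>}"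
    and geo: "geodesic_on M I \<gamma>"
    and init: "\<gamma> 0 = chart_inv c (x 0)" "velocity M \<gamma> 0 = from_chart M c (\<gamma> 0) (y 0)"
  shows "\<gamma> t = chart_inv c (x t)"
proof -
  interpret local_metric "chart_image c" "chart_metric M c" by (rule local_metric_chart[OF c])
  define J where "J = I \<inter> {-\<epsilon><..<\<epsilon>}"
  have J: "open J" "connected J" "0 \<in> J" "t \<in> J"
    unfolding J_def using I t
    by (auto intro!: is_interval_connected is_interval_Int simp: is_interval_oo)
  have xU: "x s \<in> chart_image c" if "s \<in> J" for s
    using chart_transportD(1)[OF c sol] that by (auto simp: J_def)
  have xc: "continuous_on J x"
    by (rule continuous_on_subset[OF smooth_on_continuous[OF geodesic_transport_smooth(1)[OF sol]]]) (auto simp: J_def)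
  have yc: "continuous_on J y"
    by (rule continuous_on_subset[OF smooth_on_continuous[OF geodesic_transport_smooth(2)[OF sol]]]) (auto simp: J_def)
  have gc: "continuous_map (top_of_set J) (mtop M) \<gamma>"
  proof -
    have "continuous_map (top_of_set I) (mtop M) \<gamma>"
      using geo by (simp add: geodesic_on_def smooth_curve_on_def)
    then have "continuous_map (subtopology (top_of_set I) J) (mtop M) \<gamma>"
      by (rule continuous_map_from_subtopology)
    moreover have "subtopology (top_of_set I) J = top_of_set J"
      by (simp add: subtopology_subtopology J_def Int_absorb1 inf.absorb2)
    ultimately show ?thesis by simp
  qed
  have xm: "continuous_map (top_of_set J) (mtop M) (\<lambda>s. chart_inv c (x s))"
  proof -
    have "continuous_map (top_of_set J) (top_of_set (chart_image c)) x"
      using xc xU by (auto simp: continuous_map_in_subtopology)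
    from continuous_map_compose[OF this continuous_chart_inv[OF c]] show ?thesis by (simp add: o_def)
  qed
  define E where "E = {s \<in> J. \<gamma> s = chart_inv c (x s)}"
  have "closedin (top_of_set J) E"
    using closedin_continuous_maps_eq[OF Hausdorff_M gc xm] by (simp add: E_def)
  then obtain C1 where C1: "closed C1" "E = J \<inter> C1" by (auto simp: closedin_closed)
  define J1 where "J1 = {s \<in> J. \<gamma> s \<in> fst c}"
  have J1: "open J1" "J1 \<subseteq> I" "J1 \<subseteq> J" "\<gamma> ` J1 \<subseteq> fst c"
  proof -
    have "openin (top_of_set J) J1"
      unfolding J1_def using openin_continuous_map_preimage[OF gc chart_open(1)[OF c]] by simp
    then show "open J1" using J(1) openin_open_trans by blast
  qed (auto simp: J1_def J_def)
  define x1 where "x1 = (\<lambda>s. snd c (\<gamma> s))"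
  define y1 where "y1 = (\<lambda>s. vector_derivative x1 (at s))"
  note sol1 = geodesic_in_chart(1)[OF c J1(1,2,4) geo, folded x1_def, folded y1_def]
  have vel1: "velocity M \<gamma> s = from_chart M c (\<gamma> s) (y1 s)" if "s \<in> J1" for s
    unfolding y1_def x1_def by (rule geodesic_in_chart(2)[OF c J1(1,2,4) geo that])
  have y1c: "continuous_on J1 y1"
    using smooth_on_continuous[OF geodesic_transport_smooth(2)[OF sol1 J1(1)]] .
  have "closedin (top_of_set J1) {s \<in> J1. y1 s - y s = 0}"
    using y1c yc J1(3) by (intro continuous_closedin_preimage_constant continuous_on_diff)
      (auto intro: continuous_on_subset)
  then obtain C2 where C2: "closed C2" "{s \<in> J1. y1 s - y s = 0} = J1 \<inter> C2" by (auto simp: closedin_closed)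
  \<comment> \<open>Equality of velocities is known to be closed only relative to \<open>J1\<close>,
    the times when \<open>\<gamma>\<close> is in the chart. Since \<open>E\<close> is closed in
    \<open>J\<close> and contained in \<open>J1\<close>, the intersection is closed in
    \<open>J\<close>.\<close>
  have EJ1: "E \<subseteq> J1" using xU by (auto simp: E_def J1_def)
  \<comment> \<open>The equation is of second order: local uniqueness, hence openness, requires
    equal velocities besides equal positions.\<close>
  define S where "S = {s \<in> E. y1 s = y s}"
  have "S = J \<inter> (C1 \<inter> C2)"
    using C1(2) C2(2) EJ1 by (auto simp: S_def set_eq_iff)
  then have clo: "closedin (top_of_set J) S"
    using closedin_closed_Int[OF closed_Int[OF C1(1) C2(1)], of J] by simp
  have sol0: "geodesic_transport J1 x y (\<lambda>t. 0)"
    using sol J1(3) xU unfolding geodesic_transport_def by (auto simp: J_def)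
  have "open S"
  proof (rule openI)
    fix s assume s: "s \<in> S"
    have eqs: "s \<in> J1" "x1 s = x s" "y1 s = y s"
      using s EJ1 xU by (auto simp: S_def E_def x1_def)
    obtain \<delta> where \<delta>: "\<delta> > 0" "ball s \<delta> \<subseteq> J1"
      "\<And>r. r \<in> ball s \<delta> \<Longrightarrow> x1 r = x r \<and> y1 r = y r \<and> (0::'e) = 0"
      using geodesic_transport_unique_local[OF sol1 sol0 J1(1) eqs(1-3) refl] by metis
    have "ball s \<delta> \<subseteq> S"
    proof
      fix r assume r: "r \<in> ball s \<delta>"
      have "r \<in> J1" using r \<delta>(2) by blast
      then have "\<gamma> r \<in> fst c" "r \<in> J" using J1(3,4) by blast+
      then have "\<gamma> r = chart_inv c (x1 r)" using c by (simp add: x1_def)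
      then show "r \<in> S" using \<delta>(3)[OF r] \<open>r \<in> J\<close> by (simp add: S_def E_def)
    qed
    with \<delta>(1) show "\<exists>e>0. ball s e \<subseteq> S" by blast
  qed
  then have "openin (top_of_set J) S"
    using J(1) by (intro open_subset) (auto simp: S_def E_def)
  moreover have "0 \<in> S"
  proof -
    have E0: "0 \<in> E" using J(3) init(1) by (simp add: E_def)
    then have "0 \<in> J1" using EJ1 by auto
    then have "from_chart M c (\<gamma> 0) (y1 0) = from_chart M c (\<gamma> 0) (y 0)" "\<gamma> 0 \<in> fst c"
      using vel1[of 0] init(2) by (auto simp: J1_def)
    then show ?thesis using from_chart_inject[OF c] E0 by (simp add: S_def)
  qed
  ultimately have "S = J" using J(2) clo unfolding connected_clopen by blast
  then show ?thesis using J(4) by (auto simp: S_def E_def)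
qed

text \<open>The curve is given and stays in the chart, so both fields solve the same linear equation
  for components; the times of agreement form a nonempty open and closed subset of an
  interval.\<close>

lemma parallel_unique:
  assumes c: "c \<in> atlas M" and sol: "chart_transport c {-\<epsilon><..<\<epsilon>} x y a"
    and I: "open I" "is_interval I" "0 \<in> I" and t: "t \<in> I" "t \<in> {-\<epsilon><..<\<epsilon>}"
    and \<gamma>: "\<And>s. s \<in> {-\<epsilon><..<\<epsilon>} \<Longrightarrow> \<gamma> s = chart_inv c (x s)"
    and par: "parallel_on M I \<gamma> V" and init: "V 0 = from_chart M c (\<gamma> 0) (a 0)"
  shows "V t = from_chart M c (\<gamma> t) (a t)"
proof -
  interpret local_metric "chart_image c" "chart_metric M c" by (rule local_metric_chart[OF c])
  define J where "J = I \<inter> {-\<epsilon><..<\<epsilon>}"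
  have J: "open J" "connected J" "0 \<in> J" "t \<in> J" "J \<subseteq> I"
    unfolding J_def using I t
    by (auto intro!: is_interval_connected is_interval_Int simp: is_interval_oo)
  have solJ: "geodesic_transport J x y a"
    using sol unfolding geodesic_transport_def by (auto simp: J_def)
  have \<gamma>J: "\<gamma> s = chart_inv c (x s)" if "s \<in> J" for s using that \<gamma> by (auto simp: J_def)
  have gf: "\<gamma> s \<in> fst c" if "s \<in> J" for s
    using that \<gamma>J chart_transportD(1)[OF c solJ] by simp
  let ?a = "\<lambda>t. to_chart M c (\<gamma> t) (V t)"
  have sol1: "geodesic_transport J x y ?a"
    by (rule parallel_in_chart[OF c J(1,5) solJ \<gamma>J par])
  define S where "S = {s \<in> J. ?a s - a s = 0}"
  have "closedin (top_of_set J) S"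
    unfolding S_def
    by (intro continuous_closedin_preimage_constant continuous_on_diff smooth_on_continuous
        geodesic_transport_smooth(3)[OF solJ J(1)] geodesic_transport_smooth(3)[OF sol1 J(1)])
  moreover have "open S"
  proof (rule openI)
    fix s assume s: "s \<in> S"
    have eqs: "s \<in> J" "?a s = a s" using s by (auto simp: S_def)
    obtain \<delta> where "\<delta> > 0" "ball s \<delta> \<subseteq> J"
      "\<And>r. r \<in> ball s \<delta> \<Longrightarrow> x r = x r \<and> y r = y r \<and> ?a r = a r"
      using geodesic_transport_unique_local[OF sol1 solJ J(1) eqs(1) refl refl eqs(2)] by metis
    then show "\<exists>e>0. ball s e \<subseteq> S" by (auto simp: S_def)
  qed
  then have "openin (top_of_set J) S"
    using J(1) by (intro open_subset) (auto simp: S_def)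
  moreover have "0 \<in> S"
    using init J(3) gf[OF J(3)] c by (simp add: S_def)
  ultimately have "S = J" using J(2) unfolding connected_clopen by blast
  then have "?a t = a t" using J(4) by (auto simp: S_def)
  then show ?thesis using from_to_id[OF c gf[OF J(4)], of "V t"] by simp
qed

text \<open>The chart solution witnesses existence in the unique-choice term;
  \<open>geodesic_unique\<close> refutes any other value.\<close>

lemma geodesic_at_in_chart:
  assumes c: "c \<in> atlas M" and sol: "chart_transport c {-\<epsilon><..<\<epsilon>} x y a" and t: "t \<in> {-\<epsilon><..<\<epsilon>}"
    and p: "p = chart_inv c (x 0)" and u: "u = from_chart M c p (y 0)"
  shows "geodesic_at M p u t = chart_inv c (x t)"
  unfolding geodesic_at_def
proof (rule the_equality)
  let ?I = "{-\<epsilon><..<\<epsilon>}" and ?\<gamma> = "\<lambda>s. chart_inv c (x s)"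
  have I: "open ?I" "0 \<in> ?I" "is_interval ?I" using t by (auto simp: is_interval_oo)
  show "\<exists>I \<gamma>. open I \<and> is_interval I \<and> 0 \<in> I \<and> t \<in> I \<and>
        geodesic_on M I \<gamma> \<and> \<gamma> 0 = p \<and> velocity M \<gamma> 0 = u \<and> \<gamma> t = chart_inv c (x t)"
    using I t chart_transport_geodesic[OF c I(1) sol, of ?\<gamma>] chart_transport_velocity[OF c I(1,2) sol, of ?\<gamma>] p u
    by (intro exI[of _ ?I] exI[of _ ?\<gamma>]) auto
  fix q assume "\<exists>I \<gamma>. open I \<and> is_interval I \<and> 0 \<in> I \<and> t \<in> I \<and>
        geodesic_on M I \<gamma> \<and> \<gamma> 0 = p \<and> velocity M \<gamma> 0 = u \<and> \<gamma> t = q"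
  then show "q = chart_inv c (x t)"
    using geodesic_unique[OF c sol _ _ _ _ t] p u by blast
qed

lemma parallel_transport_in_chart:
  assumes c: "c \<in> atlas M" and sol: "chart_transport c {-\<epsilon><..<\<epsilon>} x y a" and t: "t \<in> {-\<epsilon><..<\<epsilon>}"
    and \<gamma>: "\<And>s. s \<in> {-\<epsilon><..<\<epsilon>} \<Longrightarrow> \<gamma> s = chart_inv c (x s)" and v: "v = from_chart M c (\<gamma> 0) (a 0)"
  shows "parallel_transport M \<gamma> v t = from_chart M c (\<gamma> t) (a t)"
  unfolding parallel_transport_def
proof (rule the_equality)
  let ?I = "{-\<epsilon><..<\<epsilon>}" and ?V = "\<lambda>s. from_chart M c (\<gamma> s) (a s)"
  have I: "open ?I" "0 \<in> ?I" "is_interval ?I" using t by (auto simp: is_interval_oo)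
  show "\<exists>I V. open I \<and> is_interval I \<and> 0 \<in> I \<and> t \<in> I \<and> parallel_on M I \<gamma> V \<and> V 0 = v
      \<and> V t = from_chart M c (\<gamma> t) (a t)"
    using I t chart_transport_parallel[OF c I(1) sol \<gamma>, of ?V] v
    by (intro exI[of _ ?I] exI[of _ ?V]) auto
  fix w assume "\<exists>I V. open I \<and> is_interval I \<and> 0 \<in> I \<and> t \<in> I \<and> parallel_on M I \<gamma> V \<and> V 0 = v \<and> V t = w"
  then show "w = from_chart M c (\<gamma> t) (a t)"
    using parallel_unique[OF c sol _ _ _ _ t \<gamma>] v by blast
qed

end


section \<open>The identity on the bundle of tuples\<close>

context riemannian
begin

text \<open>The inverse of the bundle chart that \<open>c\<close> induces on the tuples over its
  domain.\<close>

definition lift :: "('a, 'e) chart \<Rightarrow> 'e \<times> ('e ^ 'k::finite) \<Rightarrow> ('a, 'e, 'k) tuple" where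
  "lift c z = (chart_inv c (fst z), \<chi> m. from_chart M c (chart_inv c (fst z)) (snd z $ m))"

lemma fst_lift [simp]: "fst (lift c z) = chart_inv c (fst z)"
  and snd_lift [simp]: "snd (lift c z) $ m = from_chart M c (chart_inv c (fst z)) (snd z $ m)"
  by (simp_all add: lift_def)

lemma metric_nondegenerate:
  assumes p: "p \<in> topspace (mtop M)" and eq: "\<And>u. metric M p v u = metric M p w u"
  shows "v = w"
proof (rule ccontr)
  assume "v \<noteq> w"
  then have "metric M p (v - w) (v - w) > 0" by (intro metric_props(3)[OF p]) simp
  moreover have "metric M p (v - w) (v - w) = 0"
    using eq bilinear_lsub[OF metric_props(1)[OF p]] by simp
  ultimately show False by simp
qed

text \<open>Only the velocity of the transported tuple at time 0 is needed, so the smoothness of the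
  geodesic flow in its initial data never has to be established.\<close>

lemma transported_in_chart:
  fixes z :: "'e \<times> ('e ^ 'k::finite)"
  assumes c: "c \<in> atlas M" and z: "fst z \<in> chart_image c"
  obtains \<delta> \<zeta> where "\<delta> > 0" "\<zeta> 0 = z"
    "(\<zeta> has_vector_derivative (u, \<chi> l. - \<Gamma> c (fst z) u (snd z $ l))) (at 0)"
    "\<And>t. \<bar>t\<bar> < \<delta> \<Longrightarrow> fst (\<zeta> t) \<in> chart_image c"
    "\<And>t. \<bar>t\<bar> < \<delta> \<Longrightarrow> transported M (lift c z) (from_chart M c (chart_inv c (fst z)) u) t = lift c (\<zeta> t)"
proof -
  interpret local_metric "chart_image c" "chart_metric M c" by (rule local_metric_chart[OF c])
  have "\<exists>\<epsilon> x y a. \<epsilon> > 0 \<and> x 0 = fst z \<and> y 0 = u \<and> a 0 = snd z $ m \<and> geodesic_transport {-\<epsilon><..<\<epsilon>} x y a" for m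
    using geodesic_transport_exists[OF z, of u "snd z $ m"] by metis
  then obtain e X Y A where sol: "\<And>m. e m > (0::real)" "\<And>m. X m 0 = fst z" "\<And>m. Y m 0 = u" "\<And>m. A m 0 = snd z $ m"
    "\<And>m. geodesic_transport {-e m<..<e m} (X m) (Y m) (A m)"
    by metis
  \<comment> \<open>The combined system transports one vector, so each index \<open>m\<close> has
    its own solution and its own interval; finitely many of them share the smallest.\<close>
  define \<delta> where "\<delta> = Min (range e)"
  have \<delta>: "\<delta> > 0" using sol(1) by (simp add: \<delta>_def)
  have in_I: "t \<in> {-e m<..<e m}" if "\<bar>t\<bar> < \<delta>" for t m
  proof -
    have "\<delta> \<le> e m" by (simp add: \<delta>_def)
    then show ?thesis using that by auto
  qed
  let ?p = "chart_inv c (fst z)"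
  define \<gamma> where "\<gamma> = geodesic_at M ?p (from_chart M c ?p u)"
  have \<gamma>: "\<gamma> t = chart_inv c (X m t)" if "t \<in> {-e m<..<e m}" for m t
    unfolding \<gamma>_def by (rule geodesic_at_in_chart[OF c sol(5) that]) (simp_all add: sol)
  have XU: "X m t \<in> chart_image c" if "t \<in> {-e m<..<e m}" for m t
    using chart_transportD(1)[OF c sol(5) that] .
  have par: "parallel_transport M \<gamma> (from_chart M c ?p (snd z $ m)) t = from_chart M c (\<gamma> t) (A m t)"
    if "t \<in> {-e m<..<e m}" for m t
    by (rule parallel_transport_in_chart[OF c sol(5) that \<gamma>]) (use \<gamma>[of 0 m] sol in simp_all)
  \<comment> \<open>An arbitrary index: all \<open>X m\<close> describe the same geodesic, so any of
    them can supply the footpoint.\<close>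
  obtain m0 :: 'k where True by simp
  define \<zeta> where "\<zeta> t = (X m0 t, \<chi> m. A m t)" for t
  show ?thesis
  proof (rule that[of \<delta> \<zeta>])
    show "\<zeta> 0 = z" by (simp add: \<zeta>_def sol prod_eq_iff vec_eq_iff)
    have "((\<lambda>t. \<chi> m. A m t) has_vector_derivative (\<chi> m. - Gam (fst z) u (snd z $ m))) (at 0)"
    proof -
      have "(A m has_derivative (\<lambda>h. h *\<^sub>R - Gam (fst z) u (snd z $ m))) (at 0)" for m
        using chart_transportD(4)[OF c sol(5) in_I[of 0 m]] \<delta> by (simp add: sol has_vector_derivative_def)
      from has_derivative_vec_lambda[of A, OF this]
      have "((\<lambda>t. \<chi> m. A m t) has_derivative (\<lambda>h. \<chi> m. h *\<^sub>R - Gam (fst z) u (snd z $ m))) (at 0)" .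
      moreover have "(\<lambda>h. \<chi> m. h *\<^sub>R - Gam (fst z) u (snd z $ m)) = (\<lambda>h. h *\<^sub>R (\<chi> m. - Gam (fst z) u (snd z $ m)))"
        by (simp add: fun_eq_iff vec_eq_iff)
      ultimately show ?thesis by (simp add: has_vector_derivative_def)
    qed
    moreover have "(X m0 has_vector_derivative u) (at 0)"
      using chart_transportD(2)[OF c sol(5) in_I[of 0 m0]] \<delta> by (simp add: sol)
    ultimately show "(\<zeta> has_vector_derivative (u, \<chi> l. - Gam (fst z) u (snd z $ l))) (at 0)"
      unfolding \<zeta>_def by (intro has_vector_derivative_Pair)
    fix t assume t: "\<bar>t\<bar> < \<delta>"
    show "fst (\<zeta> t) \<in> chart_image c" using XU[OF in_I[OF t]] by (simp add: \<zeta>_def)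
    show "transported M (lift c z) (from_chart M c ?p u) t = lift c (\<zeta> t)"
      using par[OF in_I[OF t]] \<gamma>[OF in_I[OF t], of m0]
      by (simp add: transported_def Let_def \<gamma>_def[symmetric] lift_def \<zeta>_def)
  qed (use \<delta> in auto)
qed

lemma shifted_lift:
  assumes c: "c \<in> atlas M" and z: "fst z \<in> chart_image c"
  shows "shifted (lift c z) l (t *\<^sub>R from_chart M c (chart_inv c (fst z)) w) = lift c (z + t *\<^sub>R vlift l w)"
proof -
  have "linear (from_chart M c (chart_inv c (fst z)))"
    using linear_from_chart[OF c] z by simp
  then show ?thesis
    by (simp add: shifted_def lift_def vec_eq_iff snd_vlift linear_add linear_cmul linear_0)
qed

lemma line_has_vector_derivative:
  assumes "f differentiable (at z)"
  shows "((\<lambda>t. f (z + t *\<^sub>R w)) has_vector_derivative D f z w) (at 0)"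
proof -
  have "((\<lambda>t. z + t *\<^sub>R w) has_vector_derivative w) (at 0)"
    by (auto intro!: derivative_eq_intros)
  from has_vector_derivative_compose_D[OF this, of f] show ?thesis using assms by simp
qed

text \<open>Stated for a general \<open>F\<close> because the identity involves the vertical
  gradients of both \<open>\<phi>\<close> and \<open>flow_deriv M i \<phi>\<close>.\<close>

lemma vgrad_lift:
  fixes F :: "('a, 'e, 'k::finite) tuple \<Rightarrow> real"
  assumes c: "c \<in> atlas M" and z: "fst z \<in> chart_image c"
    and F: "\<And>y. fst y \<in> chart_image c \<Longrightarrow> F (lift c y) = Fc y" and dif: "Fc differentiable (at z)"
    and w: "\<And>u. chart_metric M c (fst z) w u = D Fc z (vlift l u)"
  shows "vgrad M l F (lift c z) = from_chart M c (chart_inv c (fst z)) w"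
  unfolding vgrad_def
proof (rule the_equality)
  let ?p = "chart_inv c (fst z)"
  have p: "?p \<in> fst c" "?p \<in> topspace (mtop M)" using z chart_subset[OF c] by auto
  have d: "((\<lambda>t. F (shifted (lift c z) l (t *\<^sub>R u))) has_real_derivative metric M (fst (lift c z)) (from_chart M c ?p w) u) (at 0)" for u
  proof -
    obtain u' where u: "u = from_chart M c ?p u'" using from_to_id[OF c p(1)] by metis
    have "((\<lambda>t. Fc (z + t *\<^sub>R vlift l u')) has_vector_derivative D Fc z (vlift l u')) (at 0)"
      by (rule line_has_vector_derivative[OF dif])
    then show ?thesis
      unfolding u shifted_lift[OF c z] has_real_derivative_iff_has_vector_derivative
      using F z w[of u'] by (simp add: chart_metric_def)
  qed
  then show "\<forall>u. ((\<lambda>t. F (shifted (lift c z) l (t *\<^sub>R u))) has_real_derivative metric M (fst (lift c z)) (from_chart M c ?p w) u) (at 0)"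
    by blast
  fix v assume "\<forall>u. ((\<lambda>t. F (shifted (lift c z) l (t *\<^sub>R u))) has_real_derivative metric M (fst (lift c z)) v u) (at 0)"
  then have "metric M ?p v u = metric M ?p (from_chart M c ?p w) u" for u
    using DERIV_unique d by fastforce
  then show "v = from_chart M c ?p w" by (rule metric_nondegenerate[OF p(2)])
qed

text \<open>The footpoint is fixed, so working in its preferred chart turns
  \<open>from_chart\<close> into the identity and the derivative becomes that of the component
  function.\<close>

lemma vnabla_lift:
  fixes X :: "('a, 'e, 'k::finite) tuple \<Rightarrow> 'e"
  assumes p: "p \<in> topspace (mtop M)" and c: "c = pref_chart M p" and f: "f = lift c z" "fst z = snd c p"
    and X: "\<And>y. fst y \<in> chart_image c \<Longrightarrow> X (lift c y) = from_chart M c (chart_inv c (fst y)) (Xc y)"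
    and dif: "Xc differentiable (at z)"
  shows "vnabla l u X f = D Xc z (vlift l u)"
proof -
  have c': "c \<in> atlas M" "p \<in> fst c" using pref_chart[OF p] c by auto
  have z: "fst z \<in> chart_image c" "chart_inv c (fst z) = p" using c' f by auto
  have fp: "from_chart M c p v = v" for v using from_chart_pref[OF p] c by simp
  have s: "shifted f l (t *\<^sub>R u) = lift c (z + t *\<^sub>R vlift l u)" for t
    using shifted_lift[OF c'(1) z(1), of l t u] by (simp add: f(1) z(2) fp)
  have "X (shifted f l (t *\<^sub>R u)) = Xc (z + t *\<^sub>R vlift l u)" for t
    unfolding s using X[of "z + t *\<^sub>R vlift l u"] z by (simp add: fp)
  then show ?thesis
    unfolding vnabla_def using vector_derivative_at[OF line_has_vector_derivative[OF dif]] by simp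
qed

text \<open>The curve of tuples leaves the footpoint, so \<open>from_chart\<close> is the identity
  only at time 0; \<open>cov_deriv_in_chart\<close> handles the other times.\<close>

lemma hnabla_lift:
  fixes X :: "('a, 'e, 'k::finite) tuple \<Rightarrow> 'e"
  assumes p: "p \<in> topspace (mtop M)" and c: "c = pref_chart M p" and f: "f = lift c z" "fst z = snd c p"
    and X: "\<And>y. fst y \<in> chart_image c \<Longrightarrow> X (lift c y) = from_chart M c (chart_inv c (fst y)) (Xc y)"
    and dif: "Xc differentiable (at z)"
  shows "hnabla M u X f = D Xc z (u, \<chi> l. - \<Gamma> c (fst z) u (snd z $ l)) + \<Gamma> c (fst z) u (Xc z)"
proof -
  have c': "c \<in> atlas M" "p \<in> fst c" using pref_chart[OF p] c by auto
  have z: "fst z \<in> chart_image c" "chart_inv c (fst z) = p" using c' f by auto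
  have fp: "from_chart M c p v = v" for v using from_chart_pref[OF p] c by simp
  obtain \<delta> \<zeta> where \<zeta>: "\<delta> > 0" "\<zeta> 0 = z"
    "(\<zeta> has_vector_derivative (u, \<chi> l. - \<Gamma> c (fst z) u (snd z $ l))) (at 0)"
    "\<And>t. \<bar>t\<bar> < \<delta> \<Longrightarrow> fst (\<zeta> t) \<in> chart_image c"
    "\<And>t. \<bar>t\<bar> < \<delta> \<Longrightarrow> transported M (lift c z) (from_chart M c (chart_inv c (fst z)) u) t = lift c (\<zeta> t)"
    using transported_in_chart[OF c'(1) z(1), of u] by metis
  have tr: "transported M f u t = lift c (\<zeta> t)" if "\<bar>t\<bar> < \<delta>" for t
    using \<zeta>(5)[OF that] unfolding z(2) fp f(1) .
  have dX: "((\<lambda>t. Xc (\<zeta> t)) has_vector_derivative D Xc (\<zeta> 0) (u, \<chi> l. - \<Gamma> c (fst z) u (snd z $ l))) (at 0)"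
    by (rule has_vector_derivative_compose_D[OF \<zeta>(3)]) (use dif \<zeta>(2) in simp)
  have df: "((\<lambda>t. fst (\<zeta> t)) has_vector_derivative u) (at 0)"
    using has_vector_derivative_fst[OF \<zeta>(3)] by simp
  have "cov_deriv M (\<lambda>t. fst (transported M f u t)) (\<lambda>t. X (transported M f u t)) 0
    = from_chart M c (fst (transported M f u 0))
       (D Xc (\<zeta> 0) (u, \<chi> l. - \<Gamma> c (fst z) u (snd z $ l)) + \<Gamma> c (fst (\<zeta> 0)) u (Xc (\<zeta> 0)))"
    by (rule cov_deriv_in_chart(2)[OF c'(1) _ _ _ _ df _ dX, of "{-\<delta><..<\<delta>}"])
      (use \<zeta>(1,4) tr X in \<open>auto simp: abs_less_iff\<close>)
  then show ?thesis
    using tr[of 0] \<zeta>(1,2) z(2) fp by (simp add: hnabla_def)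
qed

text \<open>The Gram--Schmidt frame in the preferred chart, evaluated at \<open>p\<close>, shows
  that the choice in \<open>some_onb\<close> is not vacuous.\<close>

lemma orthonormal_basis_some_onb:
  assumes p: "p \<in> topspace (mtop M)"
  shows "orthonormal_basis M p (some_onb M p)"
proof -
  let ?c = "pref_chart M p"
  note c = pref_chart[OF p]
  interpret local_metric "chart_image ?c" "chart_metric M ?c" by (rule local_metric_chart[OF c(1)])
  have x: "snd ?c p \<in> chart_image ?c" using c by simp
  have "chart_metric M ?c (snd ?c p) = metric M p"
    using c by (simp add: chart_metric_def fun_eq_iff from_chart_pref[OF p])
  then have "orthonormal_basis M p ((\<lambda>b. frame b (snd ?c p)) ` Basis)"
    unfolding orthonormal_basis_def using frame_basis[OF x] by simp
  then show ?thesis unfolding some_onb_def by (rule someI)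
qed

end

locale tuple_function = riemannian M for M :: "('a, 'e::euclidean_space) manifold" +
  fixes \<phi> :: "('a, 'e, 'k::finite) tuple \<Rightarrow> real"
  assumes smooth_tuple: "smooth_on_tuple_bundle M \<phi>"
begin

lemma chart_function:
  assumes c: "c \<in> atlas M"
  shows "chart_function (chart_image c) (chart_metric M c) (\<lambda>z. \<phi> (lift c z))"
proof (intro chart_function.intro chart_function_axioms.intro local_metric_chart c)
  have "(\<lambda>z. \<phi> (lift c z)) = (\<lambda>(x, a). \<phi> (chart_inv c x, \<chi> m. from_chart M c (chart_inv c x) (a $ m)))"
    by (simp add: lift_def fun_eq_iff)
  then show "smooth_on (\<lambda>z. \<phi> (lift c z)) (chart_image c \<times> UNIV)"
    using smooth_tuple c by (simp add: smooth_on_tuple_bundle_def)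
qed

section \<open>Gradients and frame flow of the given function as lifts from a chart\<close>

abbreviation "hgc c \<equiv> chart_function.hg (chart_image c) (chart_metric M c) (\<lambda>z. \<phi> (lift c z))"
abbreviation "vgc c \<equiv> chart_function.vg (chart_image c) (chart_metric M c) (\<lambda>z. \<phi> (lift c z))"
abbreviation "fdc c \<equiv> chart_function.fd (chart_image c) (chart_metric M c) (\<lambda>z. \<phi> (lift c z))"

lemma horizontal_derivative:
  fixes z :: "'e \<times> ('e ^ 'k)"
  assumes c: "c \<in> atlas M" and z: "fst z \<in> chart_image c"
  shows "((\<lambda>t. \<phi> (transported M (lift c z) (from_chart M c (chart_inv c (fst z)) u) t)) has_real_derivative
    chart_metric M c (fst z) (hgc c z) u) (at 0)"
proof -
  interpret chart_function "chart_image c" "chart_metric M c" "\<lambda>z. \<phi> (lift c z)" by (rule chart_function[OF c])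
  have zT: "z \<in> TU" using z by (simp add: mem_Times_iff)
  obtain \<delta> \<zeta> where \<zeta>: "\<delta> > 0" "\<zeta> 0 = z"
    "(\<zeta> has_vector_derivative (u, \<chi> l. - \<Gamma> c (fst z) u (snd z $ l))) (at 0)"
    "\<And>t. \<bar>t\<bar> < \<delta> \<Longrightarrow> fst (\<zeta> t) \<in> chart_image c"
    "\<And>t. \<bar>t\<bar> < \<delta> \<Longrightarrow> transported M (lift c z) (from_chart M c (chart_inv c (fst z)) u) t = lift c (\<zeta> t)"
    using transported_in_chart[OF c z, of u] by metis
  have "((\<lambda>t. \<phi> (lift c (\<zeta> t))) has_vector_derivative D (\<lambda>z. \<phi> (lift c z)) (\<zeta> 0) (hlift z u)) (at 0)"
    unfolding hlift_def
    by (rule has_vector_derivative_compose_D[OF \<zeta>(3), of "\<lambda>z. \<phi> (lift c z)"])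
      (use smooth_on_differentiable[OF smooth_phi zT] \<zeta>(2) in simp)
  then have "((\<lambda>t. \<phi> (transported M (lift c z) (from_chart M c (chart_inv c (fst z)) u) t))
     has_vector_derivative D (\<lambda>z. \<phi> (lift c z)) (\<zeta> 0) (hlift z u)) (at 0)"
    by (rule has_vector_derivative_transform_within_open[of _ _ _ "{-\<delta><..<\<delta>}"])
      (use \<zeta>(1,5) in \<open>auto simp: abs_less_iff\<close>)
  then show ?thesis
    using g_hg[OF zT] \<zeta>(2) by (simp add: has_real_derivative_iff_has_vector_derivative)
qed

lemma hgrad_lift:
  fixes z :: "'e \<times> ('e ^ 'k)"
  assumes c: "c \<in> atlas M" and z: "fst z \<in> chart_image c"
  shows "hgrad M \<phi> (lift c z) = from_chart M c (chart_inv c (fst z)) (hgc c z)"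
  unfolding hgrad_def
proof (rule the_equality)
  let ?p = "chart_inv c (fst z)"
  have p: "?p \<in> fst c" "?p \<in> topspace (mtop M)" using z chart_subset[OF c] by auto
  have d: "((\<lambda>t. \<phi> (transported M (lift c z) u t)) has_real_derivative
    metric M (fst (lift c z)) (from_chart M c ?p (hgc c z)) u) (at 0)" for u
  proof -
    obtain u' where u: "u = from_chart M c ?p u'" using from_to_id[OF c p(1)] by metis
    show ?thesis
      unfolding u using horizontal_derivative[OF c z, of u'] by (simp add: chart_metric_def)
  qed
  then show "\<forall>u. ((\<lambda>t. \<phi> (transported M (lift c z) u t)) has_real_derivative
    metric M (fst (lift c z)) (from_chart M c ?p (hgc c z)) u) (at 0)" by blast
  fix v assume "\<forall>u. ((\<lambda>t. \<phi> (transported M (lift c z) u t)) has_real_derivative metric M (fst (lift c z)) v u) (at 0)"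
  then have "metric M ?p v u = metric M ?p (from_chart M c ?p (hgc c z)) u" for u
    using DERIV_unique d by fastforce
  then show "v = from_chart M c ?p (hgc c z)" by (rule metric_nondegenerate[OF p(2)])
qed

lemma flow_deriv_lift:
  assumes c: "c \<in> atlas M" and z: "fst z \<in> chart_image c"
  shows "flow_deriv M i \<phi> (lift c z) = fdc c i z"
proof -
  interpret chart_function "chart_image c" "chart_metric M c" "\<lambda>z. \<phi> (lift c z)" by (rule chart_function[OF c])
  have zT: "z \<in> TU" using z by (simp add: mem_Times_iff)
  show ?thesis
    using DERIV_imp_deriv[OF horizontal_derivative[OF c z, of "snd z $ i"]]
    by (simp add: flow_deriv_def frame_flow_def fd_eq[OF zT])
qed

lemma vgrad_phi_lift:
  assumes c: "c \<in> atlas M" and z: "fst z \<in> chart_image c"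
  shows "vgrad M l \<phi> (lift c z) = from_chart M c (chart_inv c (fst z)) (vgc c l z)"
proof -
  interpret chart_function "chart_image c" "chart_metric M c" "\<lambda>z. \<phi> (lift c z)" by (rule chart_function[OF c])
  have zT: "z \<in> TU" using z by (simp add: mem_Times_iff)
  show ?thesis
    by (rule vgrad_lift[OF c z _ smooth_on_differentiable[OF smooth_phi zT] g_vg[OF zT]]) simp
qed

theorem frame_flow_identity:
  assumes p: "fst f \<in> topspace (mtop M)"
  shows "vdiv M j (Zfield M \<phi> i) f + hdiv M (Yfield M \<phi> j i) f
           + (if i = j then 1 else 0) * metric M (fst f) (hgrad M \<phi> f) (hgrad M \<phi> f)
       = (\<Sum>l\<in>UNIV. metric M (fst f)
            (curvature M (fst f) (vgrad M l \<phi> f) (snd f $ l) (snd f $ i)) (vgrad M j \<phi> f))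
         + 2 * metric M (fst f) (hgrad M \<phi> f) (vgrad M j (flow_deriv M i \<phi>) f)"
proof -
  define p where "p = fst f"
  define c where "c = pref_chart M p"
  \<comment> \<open>In the preferred chart of the footpoint the tuple is its own component tuple, so
    every term of the identity at \<open>f\<close> equals its chart counterpart at
    \<open>z\<close>.\<close>
  define z where "z = (snd c p, snd f)"
  have pt: "p \<in> topspace (mtop M)" using p by (simp add: p_def)
  have c: "c \<in> atlas M" "p \<in> fst c" using pref_chart[OF pt] by (auto simp: c_def)
  interpret chart_function "chart_image c" "chart_metric M c" "\<lambda>z. \<phi> (lift c z)" by (rule chart_function[OF c(1)])
  have z: "fst z \<in> chart_image c" "fst z = snd c p" "chart_inv c (fst z) = p" "snd z = snd f"
    using c by (auto simp: z_def)
  have zT: "z \<in> TU" using z by (simp add: mem_Times_iff)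
  have fp: "from_chart M c p v = v" for v using from_chart_pref[OF pt] by (simp add: c_def)
  have f: "f = lift c z"
    by (rule prod_eqI) (simp_all add: z(3,4) p_def[symmetric] fp vec_eq_iff)
  have m: "metric M p = chart_metric M c (fst z)"
    using c by (simp add: chart_metric_def fun_eq_iff z(2) fp)
  have hgr: "hgrad M \<phi> f = hg z"
    using hgrad_lift[OF c(1) z(1)] unfolding z(3) fp f .
  have vgr: "vgrad M l \<phi> f = vg l z" for l
    using vgrad_phi_lift[OF c(1) z(1)] unfolding z(3) fp f .
  have Y: "Yfield M \<phi> j i (lift c y) = from_chart M c (chart_inv c (fst y)) (Yc j i y)"
    if y: "fst y \<in> chart_image c" for y
    using linear_from_chart[OF c(1), of "chart_inv c (fst y)"] y
    by (simp add: Yfield_def Yc_def hgrad_lift[OF c(1) y] vgrad_phi_lift[OF c(1) y] flow_deriv_lift[OF c(1) y]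
        metric_eq_chart_metric linear_diff linear_cmul)
  have Z: "Zfield M \<phi> i (lift c y) = from_chart M c (chart_inv c (fst y)) (Zc i y)"
    if y: "fst y \<in> chart_image c" for y
    using linear_from_chart[OF c(1), of "chart_inv c (fst y)"] y
    by (simp add: Zfield_def Zc_def hgrad_lift[OF c(1) y] flow_deriv_lift[OF c(1) y] linear_cmul)
  have vn: "vnabla j e (Zfield M \<phi> i) f = D (Zc i) z (vlift j e)" for e
    by (rule vnabla_lift[OF pt c_def f z(2) Z smooth_on_differentiable[OF smooth_Zc zT]])
  have hn: "hnabla M e (Yfield M \<phi> j i) f = nab (Yc j i) z e" for e
    unfolding nab_def hlift_def
    by (rule hnabla_lift[OF pt c_def f z(2) Y smooth_on_differentiable[OF smooth_Yc zT]])
  \<comment> \<open>The chart components of the vertical gradient of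
    \<open>flow_deriv M i \<phi>\<close>, obtained by raising the index of the vertical derivative
    of \<open>fd i\<close>.\<close>
  define w where "w = sharp (fst z) (\<lambda>u. D (fd i) z (vlift j u))"
  have lin: "linear (\<lambda>u. D (fd i) z (vlift j u))"
    using linear_compose[OF linear_vlift linear_D[OF smooth_on_differentiable[OF smooth_fd zT]]]
    by (simp add: o_def)
  have w: "chart_metric M c (fst z) w u = D (fd i) z (vlift j u)" for u
    unfolding w_def by (rule g_sharp[OF z(1) lin])
  have vG: "vgrad M j (flow_deriv M i \<phi>) f = w"
    using vgrad_lift[OF c(1) z(1) flow_deriv_lift[OF c(1)] smooth_on_differentiable[OF smooth_fd zT] w]
    unfolding z(3) fp f .
  have cu: "curvature M p u v w = curv (fst z) u v w" for u v w
    using curvature_in_chart[OF pt] z(2) by (simp add: c_def)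
  have "orthonormal_basis M p (some_onb M p)"
    by (rule orthonormal_basis_some_onb[OF pt])
  then have B: "finite (some_onb M p)" "card (some_onb M p) = DIM('e)"
    "\<And>u v. u \<in> some_onb M p \<Longrightarrow> v \<in> some_onb M p \<Longrightarrow> chart_metric M c (fst z) u v = (if u = v then 1 else 0)"
    by (auto simp: orthonormal_basis_def m)
  show ?thesis
    using frame_flow_identity_in_chart[OF zT B, of i j] w[of "hg z"] sym_g[OF z(1), of w "hg z"]
    by (simp add: vdiv_def hdiv_def p_def[symmetric] vn hn hgr vgr vG m cu z(4))
qed

end

theorem theorem3p4:
  fixes M :: "('a, 'e::euclidean_space) manifold"
    and \<phi> :: "('a, 'e, 'k::finite) tuple \<Rightarrow> real"
    and i j :: 'k
    and f :: "('a, 'e, 'k) tuple"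
  assumes "compact_riemannian_manifold M"
    and "1 \<le> CARD('k)" and "CARD('k) \<le> DIM('e)"
    and "smooth_on_tuple_bundle M \<phi>"
    and "f \<in> tuple_bundle M"
  shows "vdiv M j (Zfield M \<phi> i) f + hdiv M (Yfield M \<phi> j i) f
           + (if i = j then 1 else 0) * metric M (fst f) (hgrad M \<phi> f) (hgrad M \<phi> f)
       = (\<Sum>l\<in>UNIV. metric M (fst f)
            (curvature M (fst f) (vgrad M l \<phi> f) (snd f $ l) (snd f $ i)) (vgrad M j \<phi> f))
         + 2 * metric M (fst f) (hgrad M \<phi> f) (vgrad M j (flow_deriv M i \<phi>) f)"
proof -
  interpret tuple_function M \<phi>
    by unfold_locales (use assms in \<open>simp_all add: compact_riemannian_manifold_def\<close>)
  show ?thesis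
    by (rule frame_flow_identity) (use assms(5) in \<open>auto simp: tuple_bundle_def\<close>)
qed

end
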